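(* Let $A$ be a commutative ring, $n\ge 0$ an integer, $F\in\mathrm{Mat}_n(A)$ with $F^2=F$, and let $M$ be the image of $F$ in $A^n$. Define $R(X)=r_0+r_1X+\cdots+r_nX^n\in A[X]$ by $R(1+X)=\det(\mathrm{I}_n+XF)$. (1) For each $k=0,\ldots,n$, the matrix $r_kF$, viewed as a matrix with entries in $A_{r_k}$ (identified with $r_kA$), has as image a projective module of rank $k$ over the ring $A_{r_k}$. (2) For each $k$, let $(t_{k,i})_i$ be the family of diagonal minors of order $k$ of $F$, and put $s_{k,i}=r_kt_{k,i}$. Then for each fixed $k$ the sum $\sum_i s_{k,i}$ equals $r_k$, and each module $M_{s_{k,i}}$ is free of rank $k$ over $A_{s_{k,i}}$. Consequently the family of all the $s_{k,i}$ ($0\le k\le n$) has sum $1$, and all the localizations $M_{s_{k,i}}$ are free. (3) In particular, for every finitely generated projective $A$-module $N$ generated by $n$ elements there exist $2^n$ elements $s_1,\dots,s_{2^n}$ of $A$ with $s_1A+\cdots+s_{2^n}A=A$ such that each $N_{s_i}$ is a free $A_{s_i}$-module.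
   Context: $(r_0,\ldots,r_n)$ is a fundamental system of orthogonal idempotents of $A$ (i.e. $r_ir_j=0$ for $i\neq j$ and $\sum r_i=1$). For an idempotent $r$, the localization $A_r=A[1/r]$ is identified with the ideal $rA$, viewed as a ring with unit $r$. A diagonal minor is a principal minor; the unique diagonal minor of order $0$ of $F$ is $1$. For $s\in A$, $A_s=A[1/s]$ and $M_s$ is the localization of $M$; $A_s$ may be the trivial ring. A finitely generated projective module over a nontrivial commutative ring $B$ is said to be of (constant) rank $k$ if, for every square matrix $G$ of any size $m\times m$ over $B$ with $G^2=G$ and image isomorphic to the module, the characteristic polynomial $\det(X\mathrm{I}_m-G)$ is equal, up to nilpotent elements of $B$ (coefficientwise), to $(X-1)^kX^{m-k}$ (it is equivalent to require this for one such $G$). By convention, over the trivial ring the (trivial) module is projective of constant rank $k$, and free of rank $k$, for every integer $k\ge0$. *)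

theory Defs
  imports "HOL-Combinatorics.Permutations" "HOL-Algebra.UnivPoly"
begin

section \<open>Matrices over a carrier ring\<close>

text \<open>
  The underlying ring may be trivial, hence everything lives in the carrier-based setting.
  An \<open>n \<times> n\<close> matrix is a function \<open>nat \<Rightarrow> nat \<Rightarrow> 'a\<close> of which only the entries with
  both indices below \<open>n\<close> are relevant.
\<close>

definition idem_mat :: "('a, 'b) ring_scheme \<Rightarrow> nat \<Rightarrow> (nat \<Rightarrow> nat \<Rightarrow> 'a) \<Rightarrow> bool" where
  "idem_mat R n F \<longleftrightarrow>
     (\<forall>i<n. \<forall>j<n. F i j \<in> carrier R) \<and>
     (\<forall>i<n. \<forall>j<n. (\<Oplus>\<^bsub>R\<^esub>l\<in>{..<n}. F i l \<otimes>\<^bsub>R\<^esub> F l j) = F i j)"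

text \<open>
  The rows and columns of the determinant are indexed by an arbitrary finite set \<open>I\<close>. Thus
  \<open>det_on R {..<n} F\<close> is the determinant of \<open>F\<close>, and for \<open>I \<subseteq> {..<n}\<close> the element
  \<open>det_on R I F\<close> is the diagonal minor of \<open>F\<close> of order \<open>card I\<close> on the rows and columns in \<open>I\<close>.
\<close>

definition det_on :: "('a, 'b) ring_scheme \<Rightarrow> nat set \<Rightarrow> (nat \<Rightarrow> nat \<Rightarrow> 'a) \<Rightarrow> 'a" where
  "det_on R I F =
     (\<Oplus>\<^bsub>R\<^esub>p\<in>{p. p permutes I}. add_pow R (sign p :: int) (\<Otimes>\<^bsub>R\<^esub>i\<in>I. F i (p i)))"

abbreviation UP_const :: "('a, 'b) ring_scheme \<Rightarrow> 'a \<Rightarrow> nat \<Rightarrow> 'a" where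
  "UP_const R a \<equiv> monom (UP R) a 0"

abbreviation UP_X :: "('a, 'b) ring_scheme \<Rightarrow> nat \<Rightarrow> 'a" where
  "UP_X R \<equiv> monom (UP R) \<one>\<^bsub>R\<^esub> 1"

definition char_poly_on :: "('a, 'b) ring_scheme \<Rightarrow> nat \<Rightarrow> (nat \<Rightarrow> nat \<Rightarrow> 'a) \<Rightarrow> nat \<Rightarrow> 'a" where
  "char_poly_on R m G =
     det_on (UP R) {..<m}
       (\<lambda>i j. (if i = j then UP_X R else \<zero>\<^bsub>UP R\<^esub>) \<ominus>\<^bsub>UP R\<^esub> UP_const R (G i j))"

text \<open>The polynomial \<open>R(X)\<close> with \<open>R(1 + X) = det (I + X F)\<close>.\<close>

definition rank_poly :: "('a, 'b) ring_scheme \<Rightarrow> nat \<Rightarrow> (nat \<Rightarrow> nat \<Rightarrow> 'a) \<Rightarrow> nat \<Rightarrow> 'a" where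
  "rank_poly A n F = (THE P. P \<in> carrier (UP A) \<and>
     eval A (UP A) (UP_const A) (\<one>\<^bsub>UP A\<^esub> \<oplus>\<^bsub>UP A\<^esub> UP_X A) P =
     det_on (UP A) {..<n}
       (\<lambda>i j. (if i = j then \<one>\<^bsub>UP A\<^esub> else \<zero>\<^bsub>UP A\<^esub>)
              \<oplus>\<^bsub>UP A\<^esub> UP_X A \<otimes>\<^bsub>UP A\<^esub> UP_const A (F i j)))"


section \<open>Free and finitely generated projective modules\<close>

text \<open>
  The module record extends the ring record; its fields for multiplication and unit are
  meaningless for modules and are left unspecified.
\<close>

definition std_module :: "('a, 'b) ring_scheme \<Rightarrow> nat \<Rightarrow> ('a, nat \<Rightarrow> 'a) module" where
  "std_module R n = \<lparr>
     carrier = {..<n} \<rightarrow>\<^sub>E carrier R,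
     mult = undefined,
     one = undefined,
     zero = (\<lambda>i\<in>{..<n}. \<zero>\<^bsub>R\<^esub>),
     add = (\<lambda>x y. \<lambda>i\<in>{..<n}. x i \<oplus>\<^bsub>R\<^esub> y i),
     smult = (\<lambda>a x. \<lambda>i\<in>{..<n}. a \<otimes>\<^bsub>R\<^esub> x i)\<rparr>"

definition mat_image :: "('a, 'b) ring_scheme \<Rightarrow> nat \<Rightarrow> (nat \<Rightarrow> nat \<Rightarrow> 'a) \<Rightarrow> ('a, nat \<Rightarrow> 'a) module"
  where "mat_image R n F = (std_module R n)\<lparr>carrier :=
     (\<lambda>x. \<lambda>i\<in>{..<n}. \<Oplus>\<^bsub>R\<^esub>j\<in>{..<n}. F i j \<otimes>\<^bsub>R\<^esub> x j) ` carrier (std_module R n)\<rparr>"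

definition modules_iso ::
    "('a, 'b) ring_scheme \<Rightarrow> ('a, 'c, 'd) module_scheme \<Rightarrow> ('a, 'e, 'f) module_scheme \<Rightarrow> bool" where
  "modules_iso R M N \<longleftrightarrow> (\<exists>h. bij_betw h (carrier M) (carrier N) \<and>
     (\<forall>x\<in>carrier M. \<forall>y\<in>carrier M. h (x \<oplus>\<^bsub>M\<^esub> y) = h x \<oplus>\<^bsub>N\<^esub> h y) \<and>
     (\<forall>a\<in>carrier R. \<forall>x\<in>carrier M. h (a \<odot>\<^bsub>M\<^esub> x) = a \<odot>\<^bsub>N\<^esub> h x))"

definition free_of_rank :: "('a, 'b) ring_scheme \<Rightarrow> ('a, 'c, 'd) module_scheme \<Rightarrow> nat \<Rightarrow> bool" where
  "free_of_rank R M k \<longleftrightarrow> module R M \<and> modules_iso R M (std_module R k)"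

definition fin_free :: "('a, 'b) ring_scheme \<Rightarrow> ('a, 'c, 'd) module_scheme \<Rightarrow> bool" where
  "fin_free R M \<longleftrightarrow> (\<exists>k. free_of_rank R M k)"

text \<open>Finitely generated projective: isomorphic to a direct summand of some \<open>R\<^sup>m\<close>.\<close>

definition fg_projective :: "('a, 'b) ring_scheme \<Rightarrow> ('a, 'c, 'd) module_scheme \<Rightarrow> bool" where
  "fg_projective R M \<longleftrightarrow> module R M \<and>
     (\<exists>m U V. submodule U R (std_module R m) \<and> submodule V R (std_module R m) \<and>
        U <+>\<^bsub>std_module R m\<^esub> V = carrier (std_module R m) \<and>
        U \<inter> V = {\<zero>\<^bsub>std_module R m\<^esub>} \<and>
        modules_iso R M ((std_module R m)\<lparr>carrier := U\<rparr>))"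

definition eq_mod_nilpotents :: "('a, 'b) ring_scheme \<Rightarrow> (nat \<Rightarrow> 'a) \<Rightarrow> (nat \<Rightarrow> 'a) \<Rightarrow> bool" where
  "eq_mod_nilpotents R p q \<longleftrightarrow>
     (\<forall>i. \<exists>e::nat. (coeff (UP R) p i \<ominus>\<^bsub>R\<^esub> coeff (UP R) q i) [^]\<^bsub>R\<^esub> e = \<zero>\<^bsub>R\<^esub>)"

definition projective_of_rank :: "('a, 'b) ring_scheme \<Rightarrow> ('a, 'c, 'd) module_scheme \<Rightarrow> nat \<Rightarrow> bool"
  where "projective_of_rank R M k \<longleftrightarrow> fg_projective R M \<and>
     (\<one>\<^bsub>R\<^esub> \<noteq> \<zero>\<^bsub>R\<^esub> \<longrightarrow>
       (\<forall>m G. idem_mat R m G \<and> modules_iso R (mat_image R m G) M \<longrightarrow>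
          k \<le> m \<and>
          eq_mod_nilpotents R (char_poly_on R m G)
            ((UP_X R \<ominus>\<^bsub>UP R\<^esub> \<one>\<^bsub>UP R\<^esub>) [^]\<^bsub>UP R\<^esub> k \<otimes>\<^bsub>UP R\<^esub> UP_X R [^]\<^bsub>UP R\<^esub> (m - k))))"

definition generated_by ::
    "('a, 'b) ring_scheme \<Rightarrow> ('a, 'c, 'd) module_scheme \<Rightarrow> nat \<Rightarrow> bool" where
  "generated_by R M n \<longleftrightarrow> (\<exists>g \<in> {..<n} \<rightarrow> carrier M. \<forall>x\<in>carrier M.
     \<exists>a \<in> {..<n} \<rightarrow> carrier R. x = (\<Oplus>\<^bsub>M\<^esub>i\<in>{..<n}. a i \<odot>\<^bsub>M\<^esub> g i))"


section \<open>Localization\<close>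

definition powers_of :: "('a, 'b) ring_scheme \<Rightarrow> 'a \<Rightarrow> 'a set" where
  "powers_of R s = {s [^]\<^bsub>R\<^esub> k | k::nat. True}"

text \<open>A fraction \<open>x / s\<close> is the class of the pair \<open>(x, s)\<close>.\<close>

definition loc_rel ::
    "('a, 'b) ring_scheme \<Rightarrow> 'a set \<Rightarrow> ('a, 'c, 'd) module_scheme \<Rightarrow> (('c \<times> 'a) \<times> ('c \<times> 'a)) set" where
  "loc_rel R S M = {((x, s), (y, t)). x \<in> carrier M \<and> y \<in> carrier M \<and> s \<in> S \<and> t \<in> S \<and>
     (\<exists>u\<in>S. u \<odot>\<^bsub>M\<^esub> (t \<odot>\<^bsub>M\<^esub> x) = u \<odot>\<^bsub>M\<^esub> (s \<odot>\<^bsub>M\<^esub> y))}"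

definition loc_frac ::
    "('a, 'b) ring_scheme \<Rightarrow> 'a set \<Rightarrow> ('a, 'c, 'd) module_scheme \<Rightarrow> 'c \<Rightarrow> 'a \<Rightarrow> ('c \<times> 'a) set" where
  "loc_frac R S M x s = loc_rel R S M `` {(x, s)}"

definition self_module :: "('a, 'b) ring_scheme \<Rightarrow> ('a, 'a) module" where
  "self_module R = \<lparr>carrier = carrier R, mult = mult R, one = one R, zero = zero R,
     add = add R, smult = mult R\<rparr>"

abbreviation ring_frac :: "('a, 'b) ring_scheme \<Rightarrow> 'a set \<Rightarrow> 'a \<Rightarrow> 'a \<Rightarrow> ('a \<times> 'a) set" where
  "ring_frac R S \<equiv> loc_frac R S (self_module R)"

definition loc_ring :: "('a, 'b) ring_scheme \<Rightarrow> 'a set \<Rightarrow> ('a \<times> 'a) set ring" where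
  "loc_ring R S = \<lparr>
     carrier = (carrier R \<times> S) // loc_rel R S (self_module R),
     mult = (\<lambda>p q. \<Union>(x, s)\<in>p. \<Union>(y, t)\<in>q. ring_frac R S (x \<otimes>\<^bsub>R\<^esub> y) (s \<otimes>\<^bsub>R\<^esub> t)),
     one = ring_frac R S \<one>\<^bsub>R\<^esub> \<one>\<^bsub>R\<^esub>,
     zero = ring_frac R S \<zero>\<^bsub>R\<^esub> \<one>\<^bsub>R\<^esub>,
     add = (\<lambda>p q. \<Union>(x, s)\<in>p. \<Union>(y, t)\<in>q.
              ring_frac R S (t \<otimes>\<^bsub>R\<^esub> x \<oplus>\<^bsub>R\<^esub> s \<otimes>\<^bsub>R\<^esub> y) (s \<otimes>\<^bsub>R\<^esub> t))\<rparr>"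

definition loc_module ::
    "('a, 'b) ring_scheme \<Rightarrow> 'a set \<Rightarrow> ('a, 'c, 'd) module_scheme \<Rightarrow>
      (('a \<times> 'a) set, ('c \<times> 'a) set) module" where
  "loc_module R S M = \<lparr>
     carrier = (carrier M \<times> S) // loc_rel R S M,
     mult = undefined,
     one = undefined,
     zero = loc_frac R S M \<zero>\<^bsub>M\<^esub> \<one>\<^bsub>R\<^esub>,
     add = (\<lambda>p q. \<Union>(x, s)\<in>p. \<Union>(y, t)\<in>q.
              loc_frac R S M (t \<odot>\<^bsub>M\<^esub> x \<oplus>\<^bsub>M\<^esub> s \<odot>\<^bsub>M\<^esub> y) (s \<otimes>\<^bsub>R\<^esub> t)),
     smult = (\<lambda>p q. \<Union>(a, s)\<in>p. \<Union>(x, t)\<in>q. loc_frac R S M (a \<odot>\<^bsub>M\<^esub> x) (s \<otimes>\<^bsub>R\<^esub> t))\<rparr>"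

abbreviation loc_ring_at :: "('a, 'b) ring_scheme \<Rightarrow> 'a \<Rightarrow> ('a \<times> 'a) set ring" where
  "loc_ring_at R s \<equiv> loc_ring R (powers_of R s)"

abbreviation loc_module_at ::
    "('a, 'b) ring_scheme \<Rightarrow> 'a \<Rightarrow> ('a, 'c, 'd) module_scheme \<Rightarrow>
      (('a \<times> 'a) set, ('c \<times> 'a) set) module" where
  "loc_module_at R s M \<equiv> loc_module R (powers_of R s) M"

text \<open>For an idempotent \<open>r\<close>: the ideal generated by \<open>r\<close> as a ring with unit \<open>r\<close>.\<close>

definition idem_ring :: "('a, 'b) ring_scheme \<Rightarrow> 'a \<Rightarrow> ('a, 'b) ring_scheme" where
  "idem_ring R r = R\<lparr>carrier := PIdl\<^bsub>R\<^esub> r, one := r\<rparr>"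

end

theory Submission
  imports Defs "HOL-Library.Poly_Mapping" "HOL-Library.Countable_Set"
    "Jordan_Normal_Form.Determinant"
begin

hide_const (open) Polynomial.coeff Polynomial.monom Polynomial.smult Poly_Mapping.range
  Modules.module Ring_Hom.ring_hom

text \<open>
  Let \<open>D u = det (I + (u - 1) F)\<close>, so that the polynomial \<open>R\<close> of the theorem is \<open>D\<close> at the
  indeterminate. For an idempotent matrix \<open>F\<close> the matrices \<open>I + (u - 1) F\<close> and \<open>I + (v - 1) F\<close> have
  the product \<open>I + (u v - 1) F\<close>, hence \<open>D u * D v = D (u v)\<close>. With independent indeterminates for \<open>u\<close>
  and \<open>v\<close> this is the identity \<open>R(U) R(V) = R(U V)\<close>, and a comparison of coefficients says exactly
  that the coefficients \<open>r_k\<close> of \<open>R\<close> are orthogonal idempotents (\<open>rank_coeff_orthogonal\<close>). Their sum is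
  \<open>R(1) = det I = 1\<close> (\<open>sum_rank_coeff\<close>). The sum \<open>e_k\<close> of the diagonal minors of order \<open>k\<close> is the
  coefficient of \<open>X^k\<close> in \<open>R(1 + X)\<close>, that is \<open>e_k = (\<Sum>j. (j choose k) r_j)\<close>, and therefore
  \<open>r_k e_k = r_k\<close> (\<open>rank_coeff_mult_minor_sum\<close>).

  A ring homomorphism that sends \<open>r_k\<close> to \<open>1\<close> kills the other \<open>r_j\<close>, and the characteristic polynomial
  \<open>(\<Sum>j. r_j (X - 1)^j X^(n - j))\<close> of \<open>F\<close> (\<open>char_poly_on_eq\<close>) becomes \<open>(X - 1)^k X^(n - k)\<close>. The same
  happens for every other idempotent matrix \<open>G\<close> with isomorphic image: then \<open>F = P Q\<close> and \<open>G = Q P\<close>,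
  and \<open>det (I + u P Q) = det (I + u Q P)\<close> shows that \<open>F\<close> and \<open>G\<close> have the same coefficients \<open>r_j\<close>
  (\<open>rank_coeff_iso\<close>). This gives the constant rank, both over the ring of fractions and over the ideal
  generated by \<open>r_k\<close>.

  Suppose in addition that the diagonal minor of \<open>F\<close> on a set \<open>I\<close> of \<open>k\<close> indices is invertible. The
  columns of \<open>F\<close> with index in \<open>I\<close>, together with the rows with index in \<open>I\<close> multiplied by the inverse
  of the block, are matrices \<open>U\<close> and \<open>V\<close> with \<open>V U = 1\<close>, and \<open>U V\<close> splits off a free summand of rank
  \<open>k\<close> from the image of \<open>F\<close>. The remaining part \<open>Q = F - U V\<close> satisfies
  \<open>det (I + (X - 1) F) = X^k det (I + (X - 1) Q)\<close>. The left side is \<open>X^k\<close>, so \<open>det (I - Q) = 1\<close>, which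
  leaves no room for a nonzero fixed vector of \<open>Q\<close>: the free summand is the whole image
  (\<open>mat_image_free\<close>, \<open>mat_image_free_unit_minor\<close>). Inverting \<open>r_k t\<close> for a diagonal minor \<open>t\<close> of order
  \<open>k\<close> makes \<open>t\<close> invertible and turns the idempotent \<open>r_k\<close> into \<open>1\<close>, which is the situation just
  described (\<open>minor_localization_free\<close>); it uses that the localization of the image of \<open>F\<close> is the image
  of \<open>F\<close> over the localized ring (\<open>loc_module_mat_image_iso\<close>).

  A projective module with \<open>n\<close> generators is isomorphic to the image of an idempotent matrix of size
  \<open>n\<close> (\<open>fg_projective_idem_mat\<close>), and the subsets of \<open>{..<n}\<close> index \<open>2^n\<close> minors.

  All the determinant identities are identities between polynomials with integer coefficients in the
  entries of the matrices. They are therefore proved for integral domains, in particular for the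
  polynomial ring over the integers in countably many indeterminates, and carried over to an arbitrary
  commutative ring, which may be trivial, by a homomorphism that takes prescribed values
  (\<open>finite_subset_range_hom\<close>).
\<close>


section \<open>Determinants over commutative rings\<close>

text \<open>
  An arbitrary index set makes the diagonal minors and the full determinant instances of the same
  notion, and avoids renumbering the rows of a minor.
\<close>

definition cdet :: "nat set \<Rightarrow> (nat \<Rightarrow> nat \<Rightarrow> 'a::comm_ring_1) \<Rightarrow> 'a" where
  "cdet I F = (\<Sum>p | p permutes I. of_int (sign p) * (\<Prod>i\<in>I. F i (p i)))"

lemma cdet_eq_det: "cdet {..<n} F = det (mat n n (\<lambda>(i, j). F i j))"
proof -
  have "det (mat n n (\<lambda>(i, j). F i j)) =
      (\<Sum>p | p permutes {0..<n}. of_int (sign p) * (\<Prod>i = 0..<n. F i (p i)))"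
    unfolding det_def'[OF mat_carrier]
    by (intro sum.cong refl arg_cong2[of _ _ _ _ "(*)"] prod.cong)
       (auto simp: sign_def permutes_in_image)
  then show ?thesis unfolding cdet_def by (simp add: atLeast0LessThan)
qed

text \<open>
  Expanding each row of the Leibniz formula into its scalar and its matrix part assigns to a
  permutation a set \<open>J\<close> of rows that use the matrix. The rows outside \<open>J\<close> contribute only if the
  permutation fixes them, and the permutations of \<open>J\<close> that remain build the minor on \<open>J\<close>.
\<close>

lemma cdet_scalar_plus:
  fixes a b :: "'a::comm_ring_1"
  assumes "finite I"
  shows "cdet I (\<lambda>i j. (if i = j then a else 0) + b * F i j) =
    (\<Sum>J\<in>Pow I. a ^ (card I - card J) * b ^ card J * cdet J F)"
proof -
  let ?D = "\<lambda>i j. if i = j then a else (0::'a)"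
  have "cdet I (\<lambda>i j. ?D i j + b * F i j) =
      (\<Sum>p | p permutes I. of_int (sign p) * (\<Prod>i\<in>I. b * F i (p i) + ?D i (p i)))"
    unfolding cdet_def by (simp add: add.commute)
  also have "\<dots> = (\<Sum>p | p permutes I. \<Sum>J\<in>Pow I.
      of_int (sign p) * ((\<Prod>i\<in>J. b * F i (p i)) * (\<Prod>i\<in>I - J. ?D i (p i))))"
    by (simp only: prod_add[OF assms] sum_distrib_left)
  also have "\<dots> = (\<Sum>J\<in>Pow I. \<Sum>p | p permutes I.
      of_int (sign p) * ((\<Prod>i\<in>J. b * F i (p i)) * (\<Prod>i\<in>I - J. ?D i (p i))))"
    by (rule sum.swap)
  also have "\<dots> = (\<Sum>J\<in>Pow I. a ^ (card I - card J) * b ^ card J * cdet J F)"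
  proof (rule sum.cong[OF refl])
    fix J assume "J \<in> Pow I"
    then have J: "J \<subseteq> I" by simp
    then have finJ: "finite J" using assms finite_subset by blast
    have "(\<Sum>p | p permutes I.
        of_int (sign p) * ((\<Prod>i\<in>J. b * F i (p i)) * (\<Prod>i\<in>I - J. ?D i (p i)))) =
      (\<Sum>p | p permutes J.
        of_int (sign p) * ((\<Prod>i\<in>J. b * F i (p i)) * (\<Prod>i\<in>I - J. ?D i (p i))))"
    proof (rule sum.mono_neutral_right)
      show "finite {p. p permutes I}" using assms by (rule finite_permutations)
      show "{p. p permutes J} \<subseteq> {p. p permutes I}" using J permutes_subset by blast
      \<comment> \<open>A permutation moving a point outside \<open>J\<close> meets an off-diagonal zero.\<close>
      show "\<forall>p\<in>{p. p permutes I} - {p. p permutes J}.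
          of_int (sign p) * ((\<Prod>i\<in>J. b * F i (p i)) * (\<Prod>i\<in>I - J. ?D i (p i))) = 0"
      proof
        fix p assume p: "p \<in> {p. p permutes I} - {p. p permutes J}"
        then have "\<exists>i\<in>I - J. p i \<noteq> i"
          using J unfolding permutes_def by blast
        then have "(\<Prod>i\<in>I - J. ?D i (p i)) = 0"
          using assms by (intro prod_zero) force+
        then show "of_int (sign p) * ((\<Prod>i\<in>J. b * F i (p i)) * (\<Prod>i\<in>I - J. ?D i (p i))) = 0"
          by simp
      qed
    qed
    also have "\<dots> = (\<Sum>p | p permutes J.
        of_int (sign p) * ((\<Prod>i\<in>J. b * F i (p i)) * a ^ (card I - card J)))"
    proof (rule sum.cong[OF refl])
      fix p assume "p \<in> {p. p permutes J}"
      then have "(\<Prod>i\<in>I - J. ?D i (p i)) = (\<Prod>i\<in>I - J. a)"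
        by (intro prod.cong) (auto simp: permutes_def)
      then show "of_int (sign p) * ((\<Prod>i\<in>J. b * F i (p i)) * (\<Prod>i\<in>I - J. ?D i (p i))) =
          of_int (sign p) * ((\<Prod>i\<in>J. b * F i (p i)) * a ^ (card I - card J))"
        using J finJ by (simp add: card_Diff_subset)
    qed
    also have "\<dots> = a ^ (card I - card J) * b ^ card J * cdet J F"
      unfolding cdet_def by (simp add: sum_distrib_left prod.distrib ac_simps)
    finally show "(\<Sum>p | p permutes I.
        of_int (sign p) * ((\<Prod>i\<in>J. b * F i (p i)) * (\<Prod>i\<in>I - J. ?D i (p i)))) =
      a ^ (card I - card J) * b ^ card J * cdet J F" .
  qed
  finally show ?thesis .
qed

lemma cdet_scalar_plus_graded:
  fixes a b :: "'a::comm_ring_1"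
  shows "cdet {..<n} (\<lambda>i j. (if i = j then a else 0) + b * F i j) =
    (\<Sum>k\<le>n. (\<Sum>J | J \<subseteq> {..<n} \<and> card J = k. cdet J F) * a ^ (n - k) * b ^ k)"
proof -
  have "cdet {..<n} (\<lambda>i j. (if i = j then a else 0) + b * F i j) =
      (\<Sum>J\<in>Pow {..<n}. a ^ (n - card J) * b ^ card J * cdet J F)"
    by (simp add: cdet_scalar_plus)
  also have "\<dots> = (\<Sum>k\<le>n. \<Sum>J | J \<in> Pow {..<n} \<and> card J = k. a ^ (n - card J) * b ^ card J * cdet J F)"
    by (rule sum.group[symmetric]) (auto dest: subset_eq_atLeast0_lessThan_card simp: lessThan_atLeast0)
  also have "\<dots> = (\<Sum>k\<le>n. (\<Sum>J | J \<subseteq> {..<n} \<and> card J = k. cdet J F) * a ^ (n - k) * b ^ k)"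
    by (intro sum.cong refl) (simp add: sum_distrib_left sum_distrib_right ac_simps)
  finally show ?thesis .
qed

text \<open>
  The coefficients of \<open>R\<close> when \<open>e k\<close> are those of \<open>R(1 + X)\<close>: the expansion of \<open>(\<Sum>k. e k (X - 1)^k)\<close>
  in powers of \<open>X\<close>.
\<close>

definition shifted_coeff :: "nat \<Rightarrow> (nat \<Rightarrow> 'a::comm_ring_1) \<Rightarrow> nat \<Rightarrow> 'a" where
  "shifted_coeff n e j = (\<Sum>k\<le>n. of_int ((- 1) ^ (k - j) * int (k choose j)) * e k)"

text \<open>
  The homogeneous form of the substitution \<open>X - 1\<close> for \<open>X\<close>: write \<open>b\<close> as \<open>(a + b) - a\<close>. Homogeneity in
  \<open>a\<close> and \<open>b\<close> allows \<open>a = 1\<close> and \<open>b = u - 1\<close>, which gives \<open>R\<close>, and also \<open>a = X\<close> and \<open>b = - 1\<close>, which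
  gives the characteristic polynomial.
\<close>

lemma sum_shifted_coeff:
  fixes a b :: "'a::comm_ring_1"
  shows "(\<Sum>k\<le>n. e k * a ^ (n - k) * b ^ k) =
    (\<Sum>j\<le>n. shifted_coeff n e j * (a + b) ^ j * a ^ (n - j))"
proof -
  have "e k * a ^ (n - k) * b ^ k =
      (\<Sum>j\<le>n. of_int ((- 1) ^ (k - j) * int (k choose j)) * e k * (a + b) ^ j * a ^ (n - j))"
    if k: "k \<le> n" for k
  proof -
    have "b ^ k = ((a + b) + (- a)) ^ k" by simp
    also have "\<dots> = (\<Sum>j\<le>k. of_nat (k choose j) * (a + b) ^ j * (- a) ^ (k - j))"
      by (rule binomial_ring)
    finally have "e k * a ^ (n - k) * b ^ k =
        (\<Sum>j\<le>k. e k * a ^ (n - k) * (of_nat (k choose j) * (a + b) ^ j * (- a) ^ (k - j)))"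
      by (simp add: sum_distrib_left)
    also have "\<dots> = (\<Sum>j\<le>k. of_int ((- 1) ^ (k - j) * int (k choose j)) * e k * (a + b) ^ j * a ^ (n - j))"
    proof (intro sum.cong refl)
      fix j assume "j \<in> {..k}"
      then have "a ^ (n - j) = a ^ (n - k) * a ^ (k - j)"
        using k by (simp add: power_add[symmetric])
      then show "e k * a ^ (n - k) * (of_nat (k choose j) * (a + b) ^ j * (- a) ^ (k - j)) =
          of_int ((- 1) ^ (k - j) * int (k choose j)) * e k * (a + b) ^ j * a ^ (n - j)"
        by (simp add: power_minus[of a] ac_simps)
    qed
    also have "\<dots> = (\<Sum>j\<le>n. of_int ((- 1) ^ (k - j) * int (k choose j)) * e k * (a + b) ^ j * a ^ (n - j))"
      using k by (intro sum.mono_neutral_left) (simp_all add: binomial_eq_0)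
    finally show ?thesis .
  qed
  then have "(\<Sum>k\<le>n. e k * a ^ (n - k) * b ^ k) =
      (\<Sum>k\<le>n. \<Sum>j\<le>n. of_int ((- 1) ^ (k - j) * int (k choose j)) * e k * (a + b) ^ j * a ^ (n - j))"
    by simp
  also have "\<dots> = (\<Sum>j\<le>n. shifted_coeff n e j * (a + b) ^ j * a ^ (n - j))"
    unfolding shifted_coeff_def sum_distrib_right by (rule sum.swap)
  finally show ?thesis .
qed

text \<open>
  Substituting \<open>1 + X\<close> back recovers the original coefficients; the identity is read off from the
  previous one over the polynomials with \<open>a = 1\<close> and \<open>b = X\<close>.
\<close>

lemma shifted_coeff_inversion:
  fixes e :: "nat \<Rightarrow> 'a::comm_ring_1"
  assumes k: "k \<le> n"
  shows "e k = (\<Sum>j\<le>n. of_int (int (j choose k)) * shifted_coeff n e j)"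
proof -
  let ?E = "\<lambda>k. [:e k:]"
  have const: "shifted_coeff n ?E j = [:shifted_coeff n e j:]" for j
    unfolding shifted_coeff_def by (simp add: of_int_poly mult.commute flip: sum_to_poly)
  have "(\<Sum>k\<le>n. [:e k:] * 1 ^ (n - k) * [:0, 1:] ^ k) =
      (\<Sum>j\<le>n. [:shifted_coeff n e j:] * (1 + [:0, 1:]) ^ j * 1 ^ (n - j))"
    using sum_shifted_coeff[of ?E 1 n "[:0, 1:]"] by (simp only: const)
  moreover have "1 + [:0, 1:] = [:1, 1 :: 'a:]" by (simp add: one_pCons)
  ultimately have "Polynomial.coeff (\<Sum>j\<le>n. Polynomial.monom (e j) j) k =
      Polynomial.coeff (\<Sum>j\<le>n. Polynomial.smult (shifted_coeff n e j) ([:1, 1:] ^ j)) k"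
    by (simp add: Polynomial.monom_altdef)
  moreover have "Polynomial.coeff ([:1, 1:] ^ j :: 'a poly) k = of_nat (j choose k)" for j
  proof (cases "k \<le> j")
    case True
    then show ?thesis using coeff_linear_poly_power[of k j 1 1] by simp
  next
    case False
    moreover have "Polynomial.degree ([:1, 1:] ^ j :: 'a poly) \<le> j"
      by (rule order.trans[OF degree_power_le]) simp
    ultimately show ?thesis by (simp add: coeff_eq_0 binomial_eq_0)
  qed
  ultimately show ?thesis
    using k by (simp add: coeff_sum if_distrib mult.commute cong: if_cong)
qed

text \<open>
  The identity of Sylvester. Both sides are the determinant of the block matrix with rows \<open>(I, - U)\<close>
  and \<open>(V, I)\<close>, which row operations bring to either triangular shape.
\<close>

lemma det_one_plus_mult_commute:
  fixes U V :: "'a::idom mat"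
  assumes U: "U \<in> carrier_mat n k" and V: "V \<in> carrier_mat k n"
  shows "det (1\<^sub>m n + U * V) = det (1\<^sub>m k + V * U)"
proof -
  let ?M = "four_block_mat (1\<^sub>m n) (- U) V (1\<^sub>m k)"
  have M: "?M \<in> carrier_mat (n + k) (n + k)" using U V by auto
  have "four_block_mat (1\<^sub>m n) U (0\<^sub>m k n) (1\<^sub>m k) * ?M =
      four_block_mat (1\<^sub>m n + U * V) (0\<^sub>m n k) V (1\<^sub>m k)"
    by (subst mult_four_block_mat[of _ n n _ k _ k _ _ n _ k]) (use U V in auto)
  then have "det (four_block_mat (1\<^sub>m n) U (0\<^sub>m k n) (1\<^sub>m k)) * det ?M =
      det (four_block_mat (1\<^sub>m n + U * V) (0\<^sub>m n k) V (1\<^sub>m k))"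
    using U M by (subst det_mult[symmetric, of _ "n + k"]) auto
  then have 1: "det ?M = det (1\<^sub>m n + U * V)"
    using U V by (simp add: det_four_block_mat_lower_left_zero[of _ n _ k]
        det_four_block_mat_upper_right_zero[of _ n _ k])
  have "four_block_mat (1\<^sub>m n) (0\<^sub>m n k) (- V) (1\<^sub>m k) * ?M =
      four_block_mat (1\<^sub>m n) (- U) (0\<^sub>m k n) (1\<^sub>m k + V * U)"
    by (subst mult_four_block_mat[of _ n n _ k _ k _ _ n _ k]) (use U V in \<open>auto simp: comm_add_mat[of _ k k]\<close>)
  then have "det (four_block_mat (1\<^sub>m n) (0\<^sub>m n k) (- V) (1\<^sub>m k)) * det ?M =
      det (four_block_mat (1\<^sub>m n) (- U) (0\<^sub>m k n) (1\<^sub>m k + V * U))"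
    using V M by (subst det_mult[symmetric, of _ "n + k"]) auto
  then have 2: "det ?M = det (1\<^sub>m k + V * U)"
    using U V by (simp add: det_four_block_mat_lower_left_zero[of _ n _ k]
        det_four_block_mat_upper_right_zero[of _ n _ k])
  show ?thesis using 1 2 by simp
qed

lemma cdet_one_plus_mult_commute:
  fixes u :: "'a::idom"
  shows "cdet {..<n} (\<lambda>i j. (if i = j then 1 else 0) + u * (\<Sum>l<k. U i l * V l j)) =
    cdet {..<k} (\<lambda>i j. (if i = j then 1 else 0) + u * (\<Sum>l<n. V i l * U l j))"
proof -
  let ?U = "mat n k (\<lambda>(i, j). u * U i j)" and ?V = "mat k n (\<lambda>(i, j). V i j)"
  have "mat n n (\<lambda>(i, j). (if i = j then 1 else 0) + u * (\<Sum>l<k. U i l * V l j)) = 1\<^sub>m n + ?U * ?V"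
    by (intro eq_matI) (auto simp: scalar_prod_def sum_distrib_left lessThan_atLeast0 ac_simps)
  moreover have "mat k k (\<lambda>(i, j). (if i = j then 1 else 0) + u * (\<Sum>l<n. V i l * U l j)) = 1\<^sub>m k + ?V * ?U"
    by (intro eq_matI) (auto simp: scalar_prod_def sum_distrib_left lessThan_atLeast0 ac_simps)
  ultimately show ?thesis
    unfolding cdet_eq_det by (simp add: det_one_plus_mult_commute[of _ n k])
qed

text \<open>
  The product is multiplied out for arbitrary \<open>F\<close> and \<open>G\<close>. Later \<open>F * G\<close> is \<open>F\<close> again, or zero, and
  the entries collapse.
\<close>

lemma cdet_one_plus_mult:
  fixes u v :: "'a::comm_ring_1"
  shows "cdet {..<n} (\<lambda>i j. (if i = j then 1 else 0) + u * F i j) *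
    cdet {..<n} (\<lambda>i j. (if i = j then 1 else 0) + v * G i j) =
    cdet {..<n} (\<lambda>i j. (if i = j then 1 else 0) + (u * F i j + (v * G i j + u * v * (\<Sum>l<n. F i l * G l j))))"
proof -
  let ?d = "\<lambda>i j. if i = j then 1 else (0::'a)"
  let ?F = "mat n n (\<lambda>(i, j). ?d i j + u * F i j)" and ?G = "mat n n (\<lambda>(i, j). ?d i j + v * G i j)"
  have entry: "(\<Sum>l<n. (?d i l + u * F i l) * (?d l j + v * G l j)) =
      ?d i j + (u * F i j + (v * G i j + u * v * (\<Sum>l<n. F i l * G l j)))" if "i < n" "j < n" for i j
  proof -
    have "(\<Sum>l<n. (?d i l + u * F i l) * (?d l j + v * G l j)) =
      (\<Sum>l<n. ?d i l * ?d l j) + ((\<Sum>l<n. u * F i l * ?d l j) + ((\<Sum>l<n. ?d i l * (v * G l j)) +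
        (\<Sum>l<n. u * v * (F i l * G l j))))"
      unfolding sum.distrib[symmetric] by (intro sum.cong refl) (simp add: algebra_simps)
    also have "(\<Sum>l<n. ?d i l * ?d l j) = ?d i j"
      using that by (simp add: if_distrib[of "\<lambda>x. x * _"] sum.delta' cong: if_cong)
    also have "(\<Sum>l<n. u * F i l * ?d l j) = u * F i j"
      using that by (simp add: if_distrib[of "\<lambda>x. _ * x"] sum.delta cong: if_cong)
    also have "(\<Sum>l<n. ?d i l * (v * G l j)) = v * G i j"
      using that by (simp add: if_distrib[of "\<lambda>x. x * _"] sum.delta' cong: if_cong)
    finally show ?thesis by (simp add: sum_distrib_left)
  qed
  have "?F * ?G = mat n n (\<lambda>(i, j). ?d i j + (u * F i j + (v * G i j + u * v * (\<Sum>l<n. F i l * G l j))))"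
    by (intro eq_matI) (auto simp: scalar_prod_def lessThan_atLeast0[symmetric] entry)
  then show ?thesis
    unfolding cdet_eq_det by (subst det_mult[symmetric, of _ n]) auto
qed

text \<open>
  \<open>H\<close> is a block of the adjugate of the square matrix that agrees with \<open>F\<close> on \<open>I\<close> and with the
  identity elsewhere.
\<close>

lemma cdet_adjugate_ex:
  fixes F :: "nat \<Rightarrow> nat \<Rightarrow> 'a::comm_ring_1"
  assumes "finite I"
  obtains H where
    "\<And>i j. i \<in> I \<Longrightarrow> j \<in> I \<Longrightarrow> (\<Sum>l\<in>I. H i l * F l j) = (if i = j then cdet I F else 0)"
proof -
  obtain n where n: "I \<subseteq> {..<n}" using assms finite_nat_iff_bounded by blast
  \<comment> \<open>The block \<open>F\<close> on \<open>I\<close>, completed by the identity, has the determinant of the block.\<close>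
  define G where "G i j = (if i \<in> I \<and> j \<in> I then F i j else if i = j then 1 else 0)" for i j
  have "cdet {..<n} G = (\<Sum>p | p permutes I. of_int (sign p) * (\<Prod>i<n. G i (p i)))"
    unfolding cdet_def
  proof (rule sum.mono_neutral_right)
    show "{p. p permutes I} \<subseteq> {p. p permutes {..<n}}" using n permutes_subset by blast
    show "\<forall>p\<in>{p. p permutes {..<n}} - {p. p permutes I}. of_int (sign p) * (\<Prod>i<n. G i (p i)) = 0"
    proof
      fix p assume p: "p \<in> {p. p permutes {..<n}} - {p. p permutes I}"
      then have "\<exists>i\<in>{..<n} - I. p i \<noteq> i" unfolding permutes_def by blast
      then have "\<exists>i\<in>{..<n}. G i (p i) = 0" by (auto simp: G_def)
      then have "(\<Prod>i<n. G i (p i)) = 0" by (intro prod_zero) auto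
      then show "of_int (sign p) * (\<Prod>i<n. G i (p i)) = 0" by simp
    qed
  qed (simp add: finite_permutations)
  also have "\<dots> = cdet I F"
    unfolding cdet_def
  proof (rule sum.cong[OF refl])
    fix p assume p: "p \<in> {p. p permutes I}"
    then have "(\<Prod>i<n. G i (p i)) = (\<Prod>i\<in>I. G i (p i))"
      using n by (intro prod.mono_neutral_right) (auto simp: G_def permutes_not_in)
    also have "\<dots> = (\<Prod>i\<in>I. F i (p i))"
      using p by (intro prod.cong) (auto simp: G_def permutes_in_image)
    finally show "of_int (sign p) * (\<Prod>i<n. G i (p i)) = of_int (sign p) * (\<Prod>i\<in>I. F i (p i))" by simp
  qed
  finally have det: "cdet {..<n} G = cdet I F" .
  let ?G = "mat n n (\<lambda>(i, j). G i j)"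
  have "(\<Sum>l\<in>I. adj_mat ?G $$ (i, l) * F l j) = (if i = j then cdet I F else 0)"
    if ij: "i \<in> I" "j \<in> I" for i j
  proof -
    have "(\<Sum>l\<in>I. adj_mat ?G $$ (i, l) * F l j) = (\<Sum>l<n. adj_mat ?G $$ (i, l) * G l j)"
      using n ij by (intro sum.mono_neutral_cong_left) (auto simp: G_def)
    moreover have "(adj_mat ?G * ?G) $$ (i, j) = (det ?G \<cdot>\<^sub>m 1\<^sub>m n) $$ (i, j)"
      by (simp add: adj_mat(3)[of _ n])
    ultimately show ?thesis
      using n ij adj_mat(1)[of ?G n]
      by (auto simp: scalar_prod_def det[symmetric] cdet_eq_det atLeast0LessThan subset_iff)
  qed
  then show thesis by (rule that)
qed


section \<open>Evaluation of integer polynomials in a commutative ring\<close>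

text \<open>
  The link between identities proved for all integral domains of a type class and rings with an
  explicit carrier.
\<close>

locale hom_to_cring = cring S for S :: "('s, 'b) ring_scheme" (structure) +
  fixes h :: "'p::idom \<Rightarrow> 's"
  assumes h_closed [simp]: "h a \<in> carrier S"
    and h_one [simp]: "h 1 = \<one>"
    and h_add: "h (a + b) = h a \<oplus> h b"
    and h_mult: "h (a * b) = h a \<otimes> h b"

text \<open>
  The type \<open>(nat \<Rightarrow>\<^sub>0 nat) \<Rightarrow>\<^sub>0 int\<close> is the polynomial ring over the integers in
  indeterminates \<open>x 0\<close>, \<open>x 1\<close>, and so on; it is an integral domain. The next two definitions are the
  substitution of ring elements for the indeterminates.
\<close>

definition eval_monomial :: "('s, 'b) ring_scheme \<Rightarrow> (nat \<Rightarrow> 's) \<Rightarrow> (nat \<Rightarrow>\<^sub>0 nat) \<Rightarrow> 's" where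
  "eval_monomial S x m = (\<Otimes>\<^bsub>S\<^esub>i\<in>Poly_Mapping.keys m. x i [^]\<^bsub>S\<^esub> Poly_Mapping.lookup m i)"

definition eval_poly_mapping ::
    "('s, 'b) ring_scheme \<Rightarrow> (nat \<Rightarrow> 's) \<Rightarrow> ((nat \<Rightarrow>\<^sub>0 nat) \<Rightarrow>\<^sub>0 int) \<Rightarrow> 's" where
  "eval_poly_mapping S x p =
    (\<Oplus>\<^bsub>S\<^esub>m\<in>Poly_Mapping.keys p. add_pow S (Poly_Mapping.lookup p m) (eval_monomial S x m))"

context cring
begin

context
  fixes x :: "nat \<Rightarrow> 'a"
  assumes x: "\<And>i. x i \<in> carrier R"
begin

lemma eval_monomial_closed [simp]: "eval_monomial R x m \<in> carrier R"
  unfolding eval_monomial_def using x by (intro finprod_closed) auto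

lemma eval_monomial_superset:
  assumes "finite K" "Poly_Mapping.keys m \<subseteq> K"
  shows "eval_monomial R x m = (\<Otimes>i\<in>K. x i [^] Poly_Mapping.lookup m i)"
  unfolding eval_monomial_def using assms x
  by (intro finprod_mono_neutral_cong_left) (auto simp: in_keys_iff)

lemma eval_monomial_add:
  "eval_monomial R x (m + m') = eval_monomial R x m \<otimes> eval_monomial R x m'"
proof -
  let ?K = "Poly_Mapping.keys m \<union> Poly_Mapping.keys m'"
  have "eval_monomial R x (m + m') = (\<Otimes>i\<in>?K. x i [^] Poly_Mapping.lookup (m + m') i)"
    by (rule eval_monomial_superset) (auto simp: keys_add)
  also have "\<dots> = (\<Otimes>i\<in>?K. x i [^] Poly_Mapping.lookup m i \<otimes> x i [^] Poly_Mapping.lookup m' i)"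
    using x by (intro finprod_cong') (auto simp: lookup_add nat_pow_mult)
  also have "\<dots> = (\<Otimes>i\<in>?K. x i [^] Poly_Mapping.lookup m i) \<otimes> (\<Otimes>i\<in>?K. x i [^] Poly_Mapping.lookup m' i)"
    using x by (intro finprod_multf) auto
  also have "\<dots> = eval_monomial R x m \<otimes> eval_monomial R x m'"
    using eval_monomial_superset[of ?K m] eval_monomial_superset[of ?K m'] by simp
  finally show ?thesis .
qed

lemma eval_poly_mapping_closed [simp]: "eval_poly_mapping R x p \<in> carrier R"
  unfolding eval_poly_mapping_def by (intro finsum_closed) auto

lemma eval_poly_mapping_superset:
  assumes "finite K" "Poly_Mapping.keys p \<subseteq> K"
  shows "eval_poly_mapping R x p = (\<Oplus>m\<in>K. add_pow R (Poly_Mapping.lookup p m) (eval_monomial R x m))"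
  unfolding eval_poly_mapping_def using assms
  by (intro add.finprod_mono_neutral_cong_left) (auto simp: in_keys_iff add_pow_int_ge)

lemma eval_poly_mapping_add:
  "eval_poly_mapping R x (p + q) = eval_poly_mapping R x p \<oplus> eval_poly_mapping R x q"
proof -
  let ?K = "Poly_Mapping.keys p \<union> Poly_Mapping.keys q"
  have "eval_poly_mapping R x (p + q) =
      (\<Oplus>m\<in>?K. add_pow R (Poly_Mapping.lookup (p + q) m) (eval_monomial R x m))"
    by (rule eval_poly_mapping_superset) (use keys_add[of p q] in auto)
  also have "\<dots> = (\<Oplus>m\<in>?K. add_pow R (Poly_Mapping.lookup p m) (eval_monomial R x m) \<oplus>
      add_pow R (Poly_Mapping.lookup q m) (eval_monomial R x m))"
    by (intro finsum_cong') (auto simp: lookup_add add.int_pow_mult)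
  also have "\<dots> = (\<Oplus>m\<in>?K. add_pow R (Poly_Mapping.lookup p m) (eval_monomial R x m)) \<oplus>
      (\<Oplus>m\<in>?K. add_pow R (Poly_Mapping.lookup q m) (eval_monomial R x m))"
    by (intro finsum_addf) auto
  also have "\<dots> = eval_poly_mapping R x p \<oplus> eval_poly_mapping R x q"
    using eval_poly_mapping_superset[of ?K p] eval_poly_mapping_superset[of ?K q] by simp
  finally show ?thesis .
qed

lemma eval_poly_mapping_diff:
  "eval_poly_mapping R x (p - q) = eval_poly_mapping R x p \<ominus> eval_poly_mapping R x q"
proof -
  have "eval_poly_mapping R x p = eval_poly_mapping R x (p - q) \<oplus> eval_poly_mapping R x q"
    using eval_poly_mapping_add[of "p - q" q] by simp
  then show ?thesis by (simp add: minus_eq a_assoc r_neg)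
qed

lemma eval_poly_mapping_frag_of: "eval_poly_mapping R x (frag_of m) = eval_monomial R x m"
  by (simp add: eval_poly_mapping_def keys_frag_of add.int_pow_1)

lemma eval_poly_mapping_zero: "eval_poly_mapping R x 0 = \<zero>"
  by (simp add: eval_poly_mapping_def)

text \<open>
  Both factors are finite sums and differences of monomials, so that biadditivity reduces the claim to
  \<open>eval_monomial_add\<close>.
\<close>

lemma eval_poly_mapping_mult:
  "eval_poly_mapping R x (p * q) = eval_poly_mapping R x p \<otimes> eval_poly_mapping R x q"
proof -
  have monomial: "eval_poly_mapping R x (frag_of m * q) = eval_monomial R x m \<otimes> eval_poly_mapping R x q"
    for m and q :: "(nat \<Rightarrow>\<^sub>0 nat) \<Rightarrow>\<^sub>0 int"
    using subset_UNIV[of "Poly_Mapping.keys q"]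
  proof (induction q rule: frag_induction)
    case (one m')
    have "frag_of m * frag_of m' = frag_of (m + m')"
      by (simp add: mult_single)
    then show ?case by (simp add: eval_poly_mapping_frag_of eval_monomial_add)
  qed (simp_all add: eval_poly_mapping_zero right_diff_distrib eval_poly_mapping_diff
      minus_eq r_distr r_minus)
  show ?thesis
    using subset_UNIV[of "Poly_Mapping.keys p"]
    by (induction p rule: frag_induction)
       (simp_all add: monomial eval_poly_mapping_frag_of eval_poly_mapping_zero left_diff_distrib
         eval_poly_mapping_diff minus_eq l_distr l_minus)
qed

lemma hom_to_cring_eval_poly_mapping: "hom_to_cring R (eval_poly_mapping R x)"
proof
  show "eval_poly_mapping R x 1 = \<one>"
    using eval_poly_mapping_frag_of[of 0] by (simp add: eval_monomial_def)
qed (simp_all add: eval_poly_mapping_add eval_poly_mapping_mult)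

end

text \<open>
  The transfer principle: the indeterminates are mapped onto an enumeration of the finite set, with
  zero added so that there is something to enumerate.
\<close>

lemma finite_subset_range_hom:
  assumes "finite X" "X \<subseteq> carrier R"
  obtains h :: "((nat \<Rightarrow>\<^sub>0 nat) \<Rightarrow>\<^sub>0 int) \<Rightarrow> 'a" where "hom_to_cring R h" "X \<subseteq> range h"
proof -
  define x where "x = from_nat_into (insert \<zero> X)"
  have "range x = insert \<zero> X"
    unfolding x_def using assms(1) by (intro range_from_nat_into) (auto intro: countable_finite)
  then have x: "x i \<in> carrier R" for i using assms(2) rangeI[of x i] by auto
  have "x i = eval_poly_mapping R x (frag_of (Poly_Mapping.single i 1))" for i
    using x by (simp add: eval_poly_mapping_frag_of eval_monomial_def)
  then have "X \<subseteq> range (eval_poly_mapping R x)"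
    using \<open>range x = insert \<zero> X\<close> by (metis image_subset_iff insert_subset rangeE rangeI subsetI subset_insertI subsetD)
  with hom_to_cring_eval_poly_mapping[of x, OF x] that show thesis by blast
qed

end

context hom_to_cring
begin

lemma h_zero [simp]: "h 0 = \<zero>"
proof -
  have "h 0 \<oplus> h 0 = h 0 \<oplus> \<zero>" using h_add[of 0 0] by simp
  then show ?thesis by simp
qed

lemma h_uminus: "h (- a) = \<ominus> h a"
  using h_add[of "- a" a] by (simp add: minus_equality[symmetric])

lemma h_sum: "h (sum f X) = (\<Oplus>i\<in>X. h (f i))"
  by (induction X rule: infinite_finite_induct) (auto simp: h_add)

lemma h_prod: "h (prod f X) = (\<Otimes>i\<in>X. h (f i))"
  by (induction X rule: infinite_finite_induct) (auto simp: h_mult)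

lemma h_power: "h (a ^ k) = h a [^] (k::nat)"
  by (induction k) (auto simp: h_mult m_comm)

lemma h_of_nat_mult: "h (of_nat k * a) = add_pow S k (h a)"
  by (induction k) (auto simp: h_add distrib_right a_comm)

lemma h_of_int_mult: "h (of_int z * a) = add_pow S z (h a)"
proof (cases "z \<ge> 0")
  case True
  then obtain k where "z = int k" using nonneg_int_cases by blast
  then show ?thesis using h_of_nat_mult by (simp add: add_pow_int_ge)
next
  case False
  then obtain k where z: "z = - int k" and "k > 0" by (metis neg_int_cases not_le)
  then show ?thesis
    using h_uminus[of "of_nat k * a"] h_of_nat_mult by (simp add: add_pow_int_lt)
qed

lemma h_cdet: "h (cdet I F) = det_on S I (\<lambda>i j. h (F i j))"
  unfolding cdet_def det_on_def by (simp add: h_sum h_of_int_mult h_prod)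

end


section \<open>Determinant identities over an arbitrary commutative ring\<close>

text \<open>
  As a function, a matrix is unrestricted outside its index range, in contrast to the vectors of a
  standard module below.
\<close>

abbreviation mats :: "('a, 'b) ring_scheme \<Rightarrow> nat \<Rightarrow> nat \<Rightarrow> (nat \<Rightarrow> nat \<Rightarrow> 'a) set" where
  "mats R n m \<equiv> {..<n} \<rightarrow> {..<m} \<rightarrow> carrier R"

definition minor_sum :: "('a, 'b) ring_scheme \<Rightarrow> nat \<Rightarrow> (nat \<Rightarrow> nat \<Rightarrow> 'a) \<Rightarrow> nat \<Rightarrow> 'a" where
  "minor_sum R n F k = (\<Oplus>\<^bsub>R\<^esub>I\<in>{I. I \<subseteq> {..<n} \<and> card I = k}. det_on R I F)"

text \<open>
  An explicit formula for the coefficients of the polynomial \<open>R\<close>, which makes their behaviour under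
  ring homomorphisms evident; \<open>coeff_rank_poly\<close> below shows the agreement.
\<close>

definition rank_coeff :: "('a, 'b) ring_scheme \<Rightarrow> nat \<Rightarrow> (nat \<Rightarrow> nat \<Rightarrow> 'a) \<Rightarrow> nat \<Rightarrow> 'a" where
  "rank_coeff R n F j =
     (\<Oplus>\<^bsub>R\<^esub>k\<in>{..n}. add_pow R ((- 1) ^ (k - j) * int (k choose j)) (minor_sum R n F k))"

context cring
begin

lemma det_on_closed [simp]:
  assumes "\<And>i j. i \<in> I \<Longrightarrow> j \<in> I \<Longrightarrow> F i j \<in> carrier R"
  shows "det_on R I F \<in> carrier R"
  unfolding det_on_def using assms
  by (intro finsum_closed Pi_I add.int_pow_closed finprod_closed) (auto simp: permutes_in_image)

lemma det_on_cong:
  assumes "\<And>i j. i \<in> I \<Longrightarrow> j \<in> I \<Longrightarrow> F i j = G i j"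
    and "\<And>i j. i \<in> I \<Longrightarrow> j \<in> I \<Longrightarrow> G i j \<in> carrier R"
  shows "det_on R I F = det_on R I G"
proof -
  have prods: "(\<Otimes>i\<in>I. F i (p i)) = (\<Otimes>i\<in>I. G i (p i))" if "p permutes I" for p
    using that assms by (intro finprod_cong') (auto simp: permutes_in_image)
  show ?thesis unfolding det_on_def using assms(2)
    by (intro finsum_cong' refl Pi_I add.int_pow_closed finprod_closed)
       (auto simp: prods permutes_in_image)
qed

context
  fixes n :: nat and F :: "nat \<Rightarrow> nat \<Rightarrow> 'a"
  assumes F: "F \<in> mats R n n"
begin

lemma minor_closed: "I \<subseteq> {..<n} \<Longrightarrow> det_on R I F \<in> carrier R"
  using F by (intro det_on_closed) (auto simp: Pi_iff subset_iff)

lemma minor_sum_closed [simp]: "minor_sum R n F k \<in> carrier R"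
  unfolding minor_sum_def by (intro finsum_closed) (auto simp: minor_closed)

lemma rank_coeff_closed [simp]: "rank_coeff R n F j \<in> carrier R"
  unfolding rank_coeff_def by (intro finsum_closed) auto

lemma rank_coeff_above: "n < j \<Longrightarrow> rank_coeff R n F j = \<zero>"
  unfolding rank_coeff_def by (intro add.finprod_one_eqI) (simp add: binomial_eq_0 add_pow_int_ge)

text \<open>
  All the data of an identity that involves \<open>F\<close> and the elements of \<open>X\<close> come from one integral domain.
\<close>

lemma lift_matrix:
  assumes "finite X" "X \<subseteq> carrier R"
  obtains h :: "((nat \<Rightarrow>\<^sub>0 nat) \<Rightarrow>\<^sub>0 int) \<Rightarrow> 'a" and G
  where "hom_to_cring R h" "X \<subseteq> range h" "\<forall>i<n. \<forall>j<n. h (G i j) = F i j"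
proof -
  have "finite (X \<union> case_prod F ` ({..<n} \<times> {..<n}))" using assms by simp
  moreover have "X \<union> case_prod F ` ({..<n} \<times> {..<n}) \<subseteq> carrier R" using assms F by (auto simp: Pi_iff)
  ultimately obtain h :: "((nat \<Rightarrow>\<^sub>0 nat) \<Rightarrow>\<^sub>0 int) \<Rightarrow> 'a"
    where h: "hom_to_cring R h" "X \<union> case_prod F ` ({..<n} \<times> {..<n}) \<subseteq> range h"
    by (rule finite_subset_range_hom)
  have "h (inv_into UNIV h (F i j)) = F i j" if "i < n" "j < n" for i j
    using h(2) that by (intro f_inv_into_f) auto
  with h show thesis by (intro that[of h "\<lambda>i j. inv_into UNIV h (F i j)"]) auto
qed

end

lemma hom_minor_sum:
  assumes "hom_to_cring R h" "F \<in> mats R n n"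
    and "\<forall>i<n. \<forall>j<n. h (G i j) = F i j"
  shows "h (\<Sum>J | J \<subseteq> {..<n} \<and> card J = k. cdet J G) = minor_sum R n F k"
proof -
  interpret hom_to_cring R h by fact
  have "det_on R J (\<lambda>i j. h (G i j)) = det_on R J F" if "J \<subseteq> {..<n}" for J
  proof -
    have "i < n" if "i \<in> J" for i using \<open>J \<subseteq> {..<n}\<close> that by auto
    then show ?thesis using assms(2,3) by (intro det_on_cong) (auto simp: Pi_iff)
  qed
  then show ?thesis unfolding minor_sum_def h_sum h_cdet
    using minor_closed[where F = F and n = n, OF assms(2)] by (intro finsum_cong') auto
qed

lemma hom_shifted_coeff:
  assumes "hom_to_cring R h" "F \<in> mats R n n"
    and "\<forall>i<n. \<forall>j<n. h (G i j) = F i j"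
  shows "h (shifted_coeff n (\<lambda>k. \<Sum>J | J \<subseteq> {..<n} \<and> card J = k. cdet J G) j) = rank_coeff R n F j"
proof -
  interpret hom_to_cring R h by fact
  have "minor_sum R n F k \<in> carrier R" for k
    using assms(2) by (rule minor_sum_closed)
  then show ?thesis
    unfolding shifted_coeff_def rank_coeff_def h_sum[of _ "{..n}"] h_of_int_mult hom_minor_sum[OF assms]
    by (intro finsum_cong') auto
qed

text \<open>
  The common source of \<open>R\<close> (take \<open>a = 1\<close>) and of the characteristic polynomial (take \<open>a = X\<close> and
  \<open>b = - 1\<close>).
\<close>

lemma det_scalar_plus:
  assumes F: "F \<in> mats R n n"
    and ab: "a \<in> carrier R" "b \<in> carrier R"
  shows "det_on R {..<n} (\<lambda>i j. (if i = j then a else \<zero>) \<oplus> b \<otimes> F i j) =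
    (\<Oplus>j\<in>{..n}. rank_coeff R n F j \<otimes> (a \<oplus> b) [^] j \<otimes> a [^] (n - j))"
proof -
  obtain h :: "((nat \<Rightarrow>\<^sub>0 nat) \<Rightarrow>\<^sub>0 int) \<Rightarrow> 'a" and G where
    h: "hom_to_cring R h" "{a, b} \<subseteq> range h" and G: "\<forall>i<n. \<forall>j<n. h (G i j) = F i j"
    using lift_matrix[where F = F and n = n, OF F, of "{a, b}"] ab by auto
  interpret hom_to_cring R h by fact
  from h(2) obtain a' b' where ab': "h a' = a" "h b' = b" by auto
  have "h (cdet {..<n} (\<lambda>i j. (if i = j then a' else 0) + b' * G i j)) =
      det_on R {..<n} (\<lambda>i j. (if i = j then a else \<zero>) \<oplus> b \<otimes> F i j)"
    unfolding h_cdet using F G ab ab'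
    by (intro det_on_cong) (auto simp: Pi_iff h_add h_mult)
  moreover have "h (cdet {..<n} (\<lambda>i j. (if i = j then a' else 0) + b' * G i j)) =
      (\<Oplus>j\<in>{..n}. rank_coeff R n F j \<otimes> (a \<oplus> b) [^] j \<otimes> a [^] (n - j))"
    unfolding cdet_scalar_plus_graded sum_shifted_coeff h_sum
    by (simp only: h_mult h_power h_add ab' hom_shifted_coeff[OF h(1) F G])
  ultimately show ?thesis by simp
qed

text \<open>
  The substitution \<open>R(1 + X)\<close> in terms of coefficients.
\<close>

lemma minor_sum_rank_coeff:
  assumes F: "F \<in> mats R n n" and k: "k \<le> n"
  shows "minor_sum R n F k = (\<Oplus>j\<in>{..n}. add_pow R (int (j choose k)) (rank_coeff R n F j))"
proof -
  obtain h :: "((nat \<Rightarrow>\<^sub>0 nat) \<Rightarrow>\<^sub>0 int) \<Rightarrow> 'a" and G where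
    h: "hom_to_cring R h" and G: "\<forall>i<n. \<forall>j<n. h (G i j) = F i j"
    using lift_matrix[where F = F and n = n, OF F, of "{}"] by auto
  interpret hom_to_cring R h by fact
  have "minor_sum R n F k = h (\<Sum>J | J \<subseteq> {..<n} \<and> card J = k. cdet J G)"
    by (rule hom_minor_sum[OF h F G, symmetric])
  also have "\<dots> = (\<Oplus>j\<in>{..n}. add_pow R (int (j choose k)) (rank_coeff R n F j))"
    by (subst shifted_coeff_inversion[OF k])
       (simp only: h_sum h_of_int_mult hom_shifted_coeff[OF h(1) F G])
  finally show ?thesis .
qed

lemma det_one_plus_mult:
  assumes F: "F \<in> mats R n n"
    and G: "G \<in> mats R n n"
    and uv: "u \<in> carrier R" "v \<in> carrier R"
  shows "det_on R {..<n} (\<lambda>i j. (if i = j then \<one> else \<zero>) \<oplus> u \<otimes> F i j) \<otimes>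
    det_on R {..<n} (\<lambda>i j. (if i = j then \<one> else \<zero>) \<oplus> v \<otimes> G i j) =
    det_on R {..<n} (\<lambda>i j. (if i = j then \<one> else \<zero>) \<oplus>
      (u \<otimes> F i j \<oplus> (v \<otimes> G i j \<oplus> u \<otimes> v \<otimes> (\<Oplus>l\<in>{..<n}. F i l \<otimes> G l j))))"
proof -
  let ?X = "{u, v} \<union> case_prod G ` ({..<n} \<times> {..<n})"
  have "finite ?X" "?X \<subseteq> carrier R" using G uv by (auto simp: Pi_iff)
  then obtain h :: "((nat \<Rightarrow>\<^sub>0 nat) \<Rightarrow>\<^sub>0 int) \<Rightarrow> 'a" and F' where
    h: "hom_to_cring R h" "?X \<subseteq> range h" and F': "\<forall>i<n. \<forall>j<n. h (F' i j) = F i j"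
    by (rule lift_matrix[OF F])
  interpret hom_to_cring R h by fact
  from h(2) obtain u' v' where uv': "h u' = u" "h v' = v" by auto
  define G' where "G' i j = inv_into UNIV h (G i j)" for i j
  have G': "h (G' i j) = G i j" if "i < n" "j < n" for i j
    unfolding G'_def using h(2) that by (intro f_inv_into_f) auto
  have sums: "(\<Oplus>l\<in>{..<n}. h (F' i l) \<otimes> h (G' l j)) = (\<Oplus>l\<in>{..<n}. F i l \<otimes> G l j)"
    if "i < n" "j < n" for i j
    using that F G by (intro finsum_cong') (auto simp: Pi_iff F' G')
  have "h (cdet {..<n} (\<lambda>i j. (if i = j then 1 else 0) + u' * F' i j)) =
      det_on R {..<n} (\<lambda>i j. (if i = j then \<one> else \<zero>) \<oplus> u \<otimes> F i j)"
    unfolding h_cdet using F F' uv uv' by (intro det_on_cong) (auto simp: Pi_iff h_add h_mult)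
  moreover have "h (cdet {..<n} (\<lambda>i j. (if i = j then 1 else 0) + v' * G' i j)) =
      det_on R {..<n} (\<lambda>i j. (if i = j then \<one> else \<zero>) \<oplus> v \<otimes> G i j)"
    unfolding h_cdet using G G' uv uv' by (intro det_on_cong) (auto simp: Pi_iff h_add h_mult)
  moreover have "h (cdet {..<n} (\<lambda>i j. (if i = j then 1 else 0) +
        (u' * F' i j + (v' * G' i j + u' * v' * (\<Sum>l<n. F' i l * G' l j))))) =
      det_on R {..<n} (\<lambda>i j. (if i = j then \<one> else \<zero>) \<oplus>
        (u \<otimes> F i j \<oplus> (v \<otimes> G i j \<oplus> u \<otimes> v \<otimes> (\<Oplus>l\<in>{..<n}. F i l \<otimes> G l j))))"
    unfolding h_cdet using F F' G G' uv uv'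
    by (intro det_on_cong) (auto simp: Pi_iff h_add h_mult h_sum sums)
  ultimately show ?thesis
    using arg_cong[OF cdet_one_plus_mult[of n u' F' v' G'], of h] by (simp only: h_mult)
qed

lemma det_one_plus_mult_commute:
  assumes U: "U \<in> mats R n k"
    and V: "V \<in> mats R k n"
    and u: "u \<in> carrier R"
  shows "det_on R {..<n} (\<lambda>i j. (if i = j then \<one> else \<zero>) \<oplus> u \<otimes> (\<Oplus>l\<in>{..<k}. U i l \<otimes> V l j)) =
    det_on R {..<k} (\<lambda>i j. (if i = j then \<one> else \<zero>) \<oplus> u \<otimes> (\<Oplus>l\<in>{..<n}. V i l \<otimes> U l j))"
proof -
  let ?X = "insert u (case_prod U ` ({..<n} \<times> {..<k}) \<union> case_prod V ` ({..<k} \<times> {..<n}))"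
  have "finite ?X" "?X \<subseteq> carrier R" using U V u by (auto simp: Pi_iff)
  then obtain h :: "((nat \<Rightarrow>\<^sub>0 nat) \<Rightarrow>\<^sub>0 int) \<Rightarrow> 'a" where h: "hom_to_cring R h" "?X \<subseteq> range h"
    by (rule finite_subset_range_hom)
  interpret hom_to_cring R h by fact
  from h(2) obtain u' where u': "h u' = u" by auto
  define U' where "U' i j = inv_into UNIV h (U i j)" for i j
  define V' where "V' i j = inv_into UNIV h (V i j)" for i j
  have U': "h (U' i l) = U i l" if "i < n" "l < k" for i l
    unfolding U'_def using h(2) that by (intro f_inv_into_f) auto
  have V': "h (V' l i) = V l i" if "i < n" "l < k" for i l
    unfolding V'_def using h(2) that by (intro f_inv_into_f) auto
  have sums: "(\<Oplus>l\<in>{..<k}. h (U' i l) \<otimes> h (V' l j)) = (\<Oplus>l\<in>{..<k}. U i l \<otimes> V l j)"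
    if "i < n" "j < n" for i j
    using that U V by (intro finsum_cong') (auto simp: Pi_iff U' V')
  have sums': "(\<Oplus>l\<in>{..<n}. h (V' i l) \<otimes> h (U' l j)) = (\<Oplus>l\<in>{..<n}. V i l \<otimes> U l j)"
    if "i < k" "j < k" for i j
    using that U V by (intro finsum_cong') (auto simp: Pi_iff U' V')
  have "h (cdet {..<n} (\<lambda>i j. (if i = j then 1 else 0) + u' * (\<Sum>l<k. U' i l * V' l j))) =
      det_on R {..<n} (\<lambda>i j. (if i = j then \<one> else \<zero>) \<oplus> u \<otimes> (\<Oplus>l\<in>{..<k}. U i l \<otimes> V l j))"
    unfolding h_cdet using U V u u'
    by (intro det_on_cong) (auto simp: Pi_iff h_add h_mult h_sum sums)
  moreover have "h (cdet {..<k} (\<lambda>i j. (if i = j then 1 else 0) + u' * (\<Sum>l<n. V' i l * U' l j))) =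
      det_on R {..<k} (\<lambda>i j. (if i = j then \<one> else \<zero>) \<oplus> u \<otimes> (\<Oplus>l\<in>{..<n}. V i l \<otimes> U l j))"
    unfolding h_cdet using U V u u'
    by (intro det_on_cong) (auto simp: Pi_iff h_add h_mult h_sum sums')
  ultimately show ?thesis
    by (simp add: cdet_one_plus_mult_commute)
qed

lemma adjugate_ex:
  assumes F: "F \<in> mats R n n" and I: "I \<subseteq> {..<n}"
  obtains H where "\<And>i j. H i j \<in> carrier R"
    and "\<And>i j. i \<in> I \<Longrightarrow> j \<in> I \<Longrightarrow> (\<Oplus>l\<in>I. H i l \<otimes> F l j) = (if i = j then det_on R I F else \<zero>)"
proof -
  obtain h :: "((nat \<Rightarrow>\<^sub>0 nat) \<Rightarrow>\<^sub>0 int) \<Rightarrow> 'a" and G where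
    h: "hom_to_cring R h" and G: "\<forall>i<n. \<forall>j<n. h (G i j) = F i j"
    using lift_matrix[OF F, of "{}"] by auto
  interpret hom_to_cring R h by fact
  have FI: "F i j \<in> carrier R" "h (G i j) = F i j" if "i \<in> I" "j \<in> I" for i j
    using that I F G by (auto simp: Pi_iff subset_iff)
  obtain H where H: "\<And>i j. i \<in> I \<Longrightarrow> j \<in> I \<Longrightarrow>
      (\<Sum>l\<in>I. H i l * G l j) = (if i = j then cdet I G else 0)"
    using cdet_adjugate_ex[of I G] I finite_subset by blast
  have det: "h (cdet I G) = det_on R I F"
    unfolding h_cdet using FI by (intro det_on_cong) auto
  have "(\<Oplus>l\<in>I. h (H i l) \<otimes> F l j) = (if i = j then det_on R I F else \<zero>)"
    if "i \<in> I" "j \<in> I" for i j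
  proof -
    have "(\<Oplus>l\<in>I. h (H i l) \<otimes> F l j) = (\<Oplus>l\<in>I. h (H i l * G l j))"
      using that FI by (intro finsum_cong') (auto simp: h_mult)
    then show ?thesis
      using arg_cong[OF H[OF that], of h] by (simp add: h_sum det)
  qed
  then show thesis by (intro that[of "\<lambda>i j. h (H i j)"]) auto
qed

end


section \<open>Base change and polynomial coefficients\<close>

definition det_one_plus :: "('a, 'b) ring_scheme \<Rightarrow> nat \<Rightarrow> 'a \<Rightarrow> (nat \<Rightarrow> nat \<Rightarrow> 'a) \<Rightarrow> 'a" where
  "det_one_plus R n u F =
     det_on R {..<n} (\<lambda>i j. (if i = j then \<one>\<^bsub>R\<^esub> else \<zero>\<^bsub>R\<^esub>) \<oplus>\<^bsub>R\<^esub> u \<otimes>\<^bsub>R\<^esub> F i j)"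

text \<open>
  The value \<open>R(v)\<close>.
\<close>

lemma (in cring) det_one_plus_eq:
  assumes F: "F \<in> mats R n n" and v: "v \<in> carrier R"
  shows "det_one_plus R n (v \<ominus> \<one>) F = (\<Oplus>j\<in>{..n}. rank_coeff R n F j \<otimes> v [^] j)"
proof -
  have "\<one> \<oplus> (v \<ominus> \<one>) = v" using v by (simp add: minus_eq a_lcomm r_neg)
  then show ?thesis
    unfolding det_one_plus_def using v F
    by (subst det_scalar_plus) (auto intro!: finsum_cong')
qed

context ring_hom_cring
begin

lemma hom_add_pow:
  assumes "x \<in> carrier R"
  shows "h (add_pow R (z::int) x) = add_pow S z (h x)"
proof -
  have nat: "h (add_pow R (k::nat) x) = add_pow S k (h x)" for k
    by (induction k) (use assms in auto)
  show ?thesis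
    using assms by (cases "z \<ge> 0") (auto simp: add_pow_int_ge add_pow_int_lt nat)
qed

lemma hom_det_on:
  assumes "\<And>i j. i \<in> I \<Longrightarrow> j \<in> I \<Longrightarrow> F i j \<in> carrier R"
  shows "h (det_on R I F) = det_on S I (\<lambda>i j. h (F i j))"
proof -
  have prods: "(\<Otimes>i\<in>I. F i (p i)) \<in> carrier R" "h (\<Otimes>i\<in>I. F i (p i)) = (\<Otimes>\<^bsub>S\<^esub>i\<in>I. h (F i (p i)))"
    if "p permutes I" for p
  proof -
    have *: "(\<lambda>i. F i (p i)) \<in> I \<rightarrow> carrier R" using that assms by (auto simp: permutes_in_image)
    show "(\<Otimes>i\<in>I. F i (p i)) \<in> carrier R" using * by (rule R.finprod_closed)
    show "h (\<Otimes>i\<in>I. F i (p i)) = (\<Otimes>\<^bsub>S\<^esub>i\<in>I. h (F i (p i)))"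
      using hom_finprod[OF *] by (simp add: comp_def)
  qed
  then have *: "(\<lambda>p. add_pow R (sign p :: int) (\<Otimes>i\<in>I. F i (p i))) \<in> {p. p permutes I} \<rightarrow> carrier R"
    by auto
  show ?thesis
    unfolding det_on_def hom_finsum[OF *] comp_def
    using prods by (intro S.finsum_cong') (auto simp: hom_add_pow simp flip: prods(2))
qed

context
  fixes n :: nat and F :: "nat \<Rightarrow> nat \<Rightarrow> 'a"
  assumes F: "F \<in> mats R n n"
begin

lemma hom_matrix: "(\<lambda>i j. h (F i j)) \<in> mats S n n"
  using F by (auto simp: Pi_iff)

lemma hom_minor: "I \<subseteq> {..<n} \<Longrightarrow> h (det_on R I F) = det_on S I (\<lambda>i j. h (F i j))"
  using F by (intro hom_det_on) (auto simp: Pi_iff subset_iff)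

lemma hom_minor_sum: "h (minor_sum R n F k) = minor_sum S n (\<lambda>i j. h (F i j)) k"
proof -
  have *: "det_on R I F \<in> carrier R" if "I \<subseteq> {..<n}" for I
    using R.minor_closed[OF F that] .
  then have "h (minor_sum R n F k) = (\<Oplus>\<^bsub>S\<^esub>I\<in>{I. I \<subseteq> {..<n} \<and> card I = k}. h (det_on R I F))"
    unfolding minor_sum_def by (subst hom_finsum) (auto simp: comp_def)
  then show ?thesis
    unfolding minor_sum_def using *
    by (simp add: hom_minor cong: S.finsum_cong)
       (intro S.finsum_cong', auto simp flip: hom_minor)
qed

lemma hom_rank_coeff: "h (rank_coeff R n F j) = rank_coeff S n (\<lambda>i j. h (F i j)) j"
proof -
  have *: "minor_sum R n F k \<in> carrier R" for k using F by simp
  have "h (rank_coeff R n F j) =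
      (\<Oplus>\<^bsub>S\<^esub>k\<in>{..n}. h (add_pow R ((- 1) ^ (k - j) * int (k choose j)) (minor_sum R n F k)))"
    unfolding rank_coeff_def using * by (subst hom_finsum) (auto simp: comp_def)
  also have "\<dots> = rank_coeff S n (\<lambda>i j. h (F i j)) j"
    unfolding rank_coeff_def using *
    by (intro S.finsum_cong') (auto simp: hom_add_pow simp flip: hom_minor_sum)
  finally show ?thesis .
qed

lemma det_one_plus_hom:
  assumes "v \<in> carrier S"
  shows "det_one_plus S n (v \<ominus>\<^bsub>S\<^esub> \<one>\<^bsub>S\<^esub>) (\<lambda>i j. h (F i j)) =
    (\<Oplus>\<^bsub>S\<^esub>j\<in>{..n}. h (rank_coeff R n F j) \<otimes>\<^bsub>S\<^esub> v [^]\<^bsub>S\<^esub> j)"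
  using S.det_one_plus_eq[OF hom_matrix assms] by (simp add: hom_rank_coeff)

end

end

context UP_cring
begin

lemma const_hom: "ring_hom_cring R P (\<lambda>a. monom P a 0)"
  using UP_cring const_ring_hom by (intro ring_hom_cringI) (auto simp: R.is_cring)

lemma const_mult_monom:
  "a \<in> carrier R \<Longrightarrow> b \<in> carrier R \<Longrightarrow> monom P a k \<otimes>\<^bsub>P\<^esub> monom P b m = monom P (a \<otimes> b) (k + m)"
  by simp

lemma coeff_finsum_monom:
  assumes "finite J" "f \<in> J \<rightarrow> carrier R"
  shows "coeff P (\<Oplus>\<^bsub>P\<^esub>j\<in>J. monom P (f j) (d j)) k = (\<Oplus>j\<in>J. if d j = k then f j else \<zero>)"
proof -
  have "coeff P (\<Oplus>\<^bsub>P\<^esub>j\<in>J. monom P (f j) (d j)) k = (\<Oplus>j\<in>J. coeff P (monom P (f j) (d j)) k)"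
    using assms by (intro coeff_finsum) (auto simp: Pi_iff)
  also have "\<dots> = (\<Oplus>j\<in>J. if d j = k then f j else \<zero>)"
    using assms by (intro R.finsum_cong') (auto simp: Pi_iff)
  finally show ?thesis .
qed

lemma coeff_finsum_monom_inj:
  assumes "finite J" "f \<in> J \<rightarrow> carrier R" "i \<in> J" "\<And>j. j \<in> J \<Longrightarrow> d j = d i \<Longrightarrow> j = i"
  shows "coeff P (\<Oplus>\<^bsub>P\<^esub>j\<in>J. monom P (f j) (d j)) (d i) = f i"
proof -
  have "(\<Oplus>j\<in>J. if d j = d i then f j else \<zero>) = (\<Oplus>j\<in>J. if i = j then f j else \<zero>)"
    using assms by (intro R.finsum_cong') (auto simp: Pi_iff)
  also have "\<dots> = f i" using assms by (intro R.finsum_singleton) auto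
  finally show ?thesis using assms(1,2) by (simp add: coeff_finsum_monom)
qed

context
  fixes n :: nat and F :: "nat \<Rightarrow> nat \<Rightarrow> 'a"
  assumes F: "F \<in> mats R n n"
begin

text \<open>
  The polynomial \<open>R(X^N)\<close>; arbitrary exponents \<open>N\<close> serve the comparison of coefficients in
  \<open>rank_coeff_orthogonal_UP\<close>.
\<close>

lemma det_one_plus_monom:
  "det_one_plus P n (monom P \<one> N \<ominus>\<^bsub>P\<^esub> \<one>\<^bsub>P\<^esub>) (\<lambda>i j. monom P (F i j) 0) =
    (\<Oplus>\<^bsub>P\<^esub>j\<in>{..n}. monom P (rank_coeff R n F j) (N * j))"
proof -
  have rk: "rank_coeff R n F j \<in> carrier R" for j using F by simp
  have "det_one_plus P n (monom P \<one> N \<ominus>\<^bsub>P\<^esub> \<one>\<^bsub>P\<^esub>) (\<lambda>i j. monom P (F i j) 0) =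
    (\<Oplus>\<^bsub>P\<^esub>j\<in>{..n}. monom P (rank_coeff R n F j) 0 \<otimes>\<^bsub>P\<^esub> monom P \<one> N [^]\<^bsub>P\<^esub> j)"
    by (rule ring_hom_cring.det_one_plus_hom[OF const_hom F]) simp
  also have "\<dots> = (\<Oplus>\<^bsub>P\<^esub>j\<in>{..n}. monom P (rank_coeff R n F j) (N * j))"
    using rk by (intro P.finsum_cong') (auto simp: monom_pow const_mult_monom simp del: monom_mult)
  finally show ?thesis .
qed

lemma coeff_det_one_plus:
  "coeff P (det_one_plus P n (monom P \<one> 1 \<ominus>\<^bsub>P\<^esub> \<one>\<^bsub>P\<^esub>) (\<lambda>i j. monom P (F i j) 0)) k = rank_coeff R n F k"
proof -
  have rk: "rank_coeff R n F \<in> {..n} \<rightarrow> carrier R" using F by simp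
  show ?thesis
  proof (cases "k \<le> n")
    case True
    then show ?thesis
      unfolding det_one_plus_monom using coeff_finsum_monom_inj[OF _ rk, of k "\<lambda>j. 1 * j"] by simp
  next
    case False
    then have "coeff P (\<Oplus>\<^bsub>P\<^esub>j\<in>{..n}. monom P (rank_coeff R n F j) (1 * j)) k = (\<Oplus>j\<in>{..n}. \<zero>)"
      unfolding coeff_finsum_monom[OF finite_atMost rk] by (intro R.finsum_cong') auto
    then show ?thesis
      unfolding det_one_plus_monom using False R.rank_coeff_above[OF F, of k] by simp
  qed
qed

end

end


section \<open>The rank idempotents of a projection matrix\<close>

lemma (in cring) idem_matD:
  assumes "idem_mat R n F"
  shows "F \<in> mats R n n"
    and "\<And>i j. i < n \<Longrightarrow> j < n \<Longrightarrow> (\<Oplus>l\<in>{..<n}. F i l \<otimes> F l j) = F i j"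
  using assms unfolding idem_mat_def by auto

lemma (in cring) det_one_plus_closed [simp]:
  assumes "F \<in> mats R n n" "u \<in> carrier R"
  shows "det_one_plus R n u F \<in> carrier R"
  unfolding det_one_plus_def using assms by (intro det_on_closed) (auto simp: Pi_iff)

text \<open>
  \<open>R(u) R(v) = R(u v)\<close>, because idempotence of \<open>F\<close> turns the product of the two matrices into
  \<open>I + ((u - 1) + (v - 1) + (u - 1) (v - 1)) F\<close>.
\<close>

lemma (in cring) det_one_plus_idem_mult:
  assumes F: "idem_mat R n F" and uv: "u \<in> carrier R" "v \<in> carrier R"
  shows "det_one_plus R n (u \<ominus> \<one>) F \<otimes> det_one_plus R n (v \<ominus> \<one>) F = det_one_plus R n (u \<otimes> v \<ominus> \<one>) F"
proof -
  note F' = idem_matD[OF F]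
  have entry: "(u \<ominus> \<one>) \<otimes> x \<oplus> ((v \<ominus> \<one>) \<otimes> x \<oplus> (u \<ominus> \<one>) \<otimes> (v \<ominus> \<one>) \<otimes> x) = (u \<otimes> v \<ominus> \<one>) \<otimes> x"
    if "x \<in> carrier R" for x
    using that uv by algebra
  have "det_one_plus R n (u \<ominus> \<one>) F \<otimes> det_one_plus R n (v \<ominus> \<one>) F =
    det_on R {..<n} (\<lambda>i j. (if i = j then \<one> else \<zero>) \<oplus> ((u \<ominus> \<one>) \<otimes> F i j \<oplus>
      ((v \<ominus> \<one>) \<otimes> F i j \<oplus> (u \<ominus> \<one>) \<otimes> (v \<ominus> \<one>) \<otimes> (\<Oplus>l\<in>{..<n}. F i l \<otimes> F l j))))"
    unfolding det_one_plus_def using uv by (intro det_one_plus_mult[OF F'(1) F'(1)]) auto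
  also have "\<dots> = det_one_plus R n (u \<otimes> v \<ominus> \<one>) F"
    unfolding det_one_plus_def using F' uv
    by (intro det_on_cong) (auto simp: entry Pi_iff)
  finally show ?thesis .
qed

text \<open>
  The zero matrix factors through the module of rank zero, over which every determinant is \<open>1\<close>.
\<close>

lemma (in cring) det_one_plus_zero:
  assumes "u \<in> carrier R"
  shows "det_one_plus R n u (\<lambda>i j. \<zero>) = \<one>"
proof -
  have "det_one_plus R n u (\<lambda>i j. \<zero>) = det_on R {..<0} (\<lambda>i j. (if i = j then \<one> else \<zero>) \<oplus> u \<otimes> \<zero>)"
    unfolding det_one_plus_def
    using det_one_plus_mult_commute[of "\<lambda>i j. \<zero>" n 0 "\<lambda>i j. \<zero>" u] assms by simp
  also have "\<dots> = \<one>" by (simp add: det_on_def add_pow_int_ge)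
  finally show ?thesis .
qed

text \<open>
  The sum is \<open>R(1)\<close>, the determinant of the identity matrix.
\<close>

lemma (in cring) sum_rank_coeff:
  assumes F: "F \<in> mats R n n"
  shows "(\<Oplus>j\<in>{..n}. rank_coeff R n F j) = \<one>"
proof -
  have "(\<Oplus>j\<in>{..n}. rank_coeff R n F j) = (\<Oplus>j\<in>{..n}. rank_coeff R n F j \<otimes> \<one> [^] j)"
    using F by (intro finsum_cong') auto
  also have "\<dots> = det_one_plus R n (\<one> \<ominus> \<one>) F"
    using det_one_plus_eq[OF F, of \<one>] by simp
  also have "\<dots> = det_one_plus R n \<zero> (\<lambda>i j. \<zero>)"
    unfolding det_one_plus_def using F by (intro det_on_cong) (auto simp: minus_eq r_neg Pi_iff)
  also have "\<dots> = \<one>" by (rule det_one_plus_zero) simp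
  finally show ?thesis .
qed

lemma (in ring_hom_cring) hom_idem_mat:
  assumes "idem_mat R n F"
  shows "idem_mat S n (\<lambda>i j. h (F i j))"
proof -
  note F = R.idem_matD[OF assms]
  have "(\<Oplus>\<^bsub>S\<^esub>l\<in>{..<n}. h (F i l) \<otimes>\<^bsub>S\<^esub> h (F l j)) = h (F i j)" if ij: "i < n" "j < n" for i j
  proof -
    have "(\<lambda>l. F i l \<otimes> F l j) \<in> {..<n} \<rightarrow> carrier R" using F(1) ij by (auto simp: Pi_iff)
    from hom_finsum[OF this] have "h (F i j) = (\<Oplus>\<^bsub>S\<^esub>l\<in>{..<n}. h (F i l \<otimes> F l j))"
      by (simp add: F(2)[OF ij] comp_def)
    also have "\<dots> = (\<Oplus>\<^bsub>S\<^esub>l\<in>{..<n}. h (F i l) \<otimes>\<^bsub>S\<^esub> h (F l j))"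
      using F(1) ij by (intro S.finsum_cong') (auto simp: Pi_iff)
    finally show ?thesis by simp
  qed
  then show ?thesis unfolding idem_mat_def using F(1) by (auto simp: Pi_iff)
qed

text \<open>
  In \<open>R(U) R(V) = R(U V)\<close> the coefficient of \<open>U^i V^j\<close> is \<open>r_i r_j\<close> on the left, and \<open>r_i\<close> or zero on
  the right. One indeterminate suffices: with \<open>U = X\<close> and \<open>V = X^(n + 1)\<close> the exponents
  \<open>i + (n + 1) j\<close> for \<open>i, j \<le> n\<close> are distinct.
\<close>

lemma (in UP_cring) rank_coeff_orthogonal_UP:
  assumes F: "idem_mat R n F" and ij: "i \<le> n" "j \<le> n"
  shows "rank_coeff R n F i \<otimes> rank_coeff R n F j = (if i = j then rank_coeff R n F i else \<zero>)"
proof -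
  let ?r = "rank_coeff R n F" and ?N = "Suc n"
  note F' = R.idem_matD(1)[OF F]
  have r: "?r k \<in> carrier R" for k using F' by simp
  let ?FP = "\<lambda>i j. monom P (F i j) 0"
  let ?D = "\<lambda>k. \<Oplus>\<^bsub>P\<^esub>j\<in>{..n}. monom P (?r j) (k * j)"
  have "det_one_plus P n (monom P \<one> 1 \<ominus>\<^bsub>P\<^esub> \<one>\<^bsub>P\<^esub>) ?FP \<otimes>\<^bsub>P\<^esub> det_one_plus P n (monom P \<one> ?N \<ominus>\<^bsub>P\<^esub> \<one>\<^bsub>P\<^esub>) ?FP =
      det_one_plus P n (monom P \<one> 1 \<otimes>\<^bsub>P\<^esub> monom P \<one> ?N \<ominus>\<^bsub>P\<^esub> \<one>\<^bsub>P\<^esub>) ?FP"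
    by (rule P.det_one_plus_idem_mult[OF ring_hom_cring.hom_idem_mat[OF const_hom F]]) auto
  also have "monom P \<one> 1 \<otimes>\<^bsub>P\<^esub> monom P \<one> ?N = monom P \<one> (1 + ?N)"
    by (rule monom_one_mult[symmetric])
  finally have "?D 1 \<otimes>\<^bsub>P\<^esub> ?D ?N = ?D (1 + ?N)"
    unfolding det_one_plus_monom[OF F'] .
  moreover have "?D 1 \<otimes>\<^bsub>P\<^esub> ?D ?N =
      (\<Oplus>\<^bsub>P\<^esub>b\<in>{..n}. \<Oplus>\<^bsub>P\<^esub>a\<in>{..n}. monom P (?r a \<otimes> ?r b) (a + ?N * b))"
  proof -
    have "?D 1 \<otimes>\<^bsub>P\<^esub> ?D ?N = (\<Oplus>\<^bsub>P\<^esub>b\<in>{..n}. ?D 1 \<otimes>\<^bsub>P\<^esub> monom P (?r b) (?N * b))"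
      using r by (intro P.finsum_rdistr) auto
    also have "\<dots> = (\<Oplus>\<^bsub>P\<^esub>b\<in>{..n}. \<Oplus>\<^bsub>P\<^esub>a\<in>{..n}. monom P (?r a \<otimes> ?r b) (a + ?N * b))"
    proof (rule P.finsum_cong'[OF refl])
      fix b
      have "?D 1 \<otimes>\<^bsub>P\<^esub> monom P (?r b) (?N * b) =
          (\<Oplus>\<^bsub>P\<^esub>a\<in>{..n}. monom P (?r a) (1 * a) \<otimes>\<^bsub>P\<^esub> monom P (?r b) (?N * b))"
        using r by (intro P.finsum_ldistr) auto
      then show "?D 1 \<otimes>\<^bsub>P\<^esub> monom P (?r b) (?N * b) =
          (\<Oplus>\<^bsub>P\<^esub>a\<in>{..n}. monom P (?r a \<otimes> ?r b) (a + ?N * b))"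
        using r by simp
    qed (use r in auto)
    finally show ?thesis .
  qed
  ultimately have eq: "coeff P (\<Oplus>\<^bsub>P\<^esub>b\<in>{..n}. \<Oplus>\<^bsub>P\<^esub>a\<in>{..n}. monom P (?r a \<otimes> ?r b) (a + ?N * b)) (i + ?N * j) =
      coeff P (?D (1 + ?N)) (i + ?N * j)"
    by simp
  \<comment> \<open>Base-\<open>?N\<close> digits: exponents \<open>a + ?N * b\<close> with \<open>a, b \<le> n\<close> determine \<open>a\<close> and \<open>b\<close>.\<close>
  have digits: "a + ?N * b = i + ?N * j \<longleftrightarrow> a = i \<and> b = j" if "a \<le> n" for a b
  proof
    assume *: "a + ?N * b = i + ?N * j"
    then have "(a + ?N * b) mod ?N = (i + ?N * j) mod ?N" "(a + ?N * b) div ?N = (i + ?N * j) div ?N"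
      by simp_all
    then show "a = i \<and> b = j" using that ij by (simp del: mult_Suc)
  qed simp
  have "coeff P (\<Oplus>\<^bsub>P\<^esub>b\<in>{..n}. \<Oplus>\<^bsub>P\<^esub>a\<in>{..n}. monom P (?r a \<otimes> ?r b) (a + ?N * b)) (i + ?N * j) =
      (\<Oplus>b\<in>{..n}. \<Oplus>a\<in>{..n}. if a + ?N * b = i + ?N * j then ?r a \<otimes> ?r b else \<zero>)"
    using r by (subst coeff_finsum) (auto intro!: R.finsum_cong' coeff_finsum_monom simp del: monom_mult mult_Suc)
  also have "\<dots> = (\<Oplus>b\<in>{..n}. if j = b then ?r i \<otimes> ?r b else \<zero>)"
  proof (rule R.finsum_cong'[OF refl])
    fix b assume "b \<in> {..n}"
    have "(\<Oplus>a\<in>{..n}. if a + ?N * b = i + ?N * j then ?r a \<otimes> ?r b else \<zero>) =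
        (\<Oplus>a\<in>{..n}. if i = a then (if j = b then ?r a \<otimes> ?r b else \<zero>) else \<zero>)"
      using r by (intro R.finsum_cong') (auto simp: digits simp del: mult_Suc)
    also have "\<dots> = (if j = b then ?r i \<otimes> ?r b else \<zero>)"
      using r ij by (intro R.finsum_singleton) auto
    finally show "(\<Oplus>a\<in>{..n}. if a + ?N * b = i + ?N * j then ?r a \<otimes> ?r b else \<zero>) =
        (if j = b then ?r i \<otimes> ?r b else \<zero>)" .
  qed (use r in auto)
  also have "\<dots> = ?r i \<otimes> ?r j"
    using r ij by (intro R.finsum_singleton) auto
  finally have lhs: "coeff P (\<Oplus>\<^bsub>P\<^esub>b\<in>{..n}. \<Oplus>\<^bsub>P\<^esub>a\<in>{..n}. monom P (?r a \<otimes> ?r b) (a + ?N * b)) (i + ?N * j) =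
      ?r i \<otimes> ?r j" .
  have "coeff P (?D (1 + ?N)) (i + ?N * j) = (\<Oplus>k\<in>{..n}. if (1 + ?N) * k = i + ?N * j then ?r k else \<zero>)"
    using r by (intro coeff_finsum_monom) auto
  also have "\<dots> = (\<Oplus>k\<in>{..n}. if i = k then (if i = j then ?r k else \<zero>) else \<zero>)"
  proof (rule R.finsum_cong'[OF refl])
    fix k assume "k \<in> {..n}"
    then show "(if (1 + ?N) * k = i + ?N * j then ?r k else \<zero>) =
        (if i = k then (if i = j then ?r k else \<zero>) else \<zero>)"
      using digits[of k k] by (auto simp: distrib_right)
  qed (use r in auto)
  also have "\<dots> = (if i = j then ?r i else \<zero>)"
    using r ij by (intro R.finsum_singleton) auto
  finally show ?thesis using eq lhs by simp
qed

context cring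
begin

lemma UP_cring_UP: "UP_cring R"
  by (intro UP_cring.intro is_cring)

lemma rank_coeff_orthogonal:
  assumes "idem_mat R n F" "i \<le> n" "j \<le> n"
  shows "rank_coeff R n F i \<otimes> rank_coeff R n F j = (if i = j then rank_coeff R n F i else \<zero>)"
  by (rule UP_cring.rank_coeff_orthogonal_UP[OF UP_cring_UP assms])

text \<open>
  In \<open>e_k = (\<Sum>j. (j choose k) r_j)\<close> only the term for \<open>j = k\<close> survives the multiplication by \<open>r_k\<close>.
\<close>

lemma rank_coeff_mult_minor_sum:
  assumes F: "idem_mat R n F" and k: "k \<le> n"
  shows "rank_coeff R n F k \<otimes> minor_sum R n F k = rank_coeff R n F k"
proof -
  let ?r = "rank_coeff R n F"
  note F' = idem_matD(1)[OF F]
  have r: "?r j \<in> carrier R" for j using F' by simp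
  have "?r k \<otimes> minor_sum R n F k = (\<Oplus>j\<in>{..n}. ?r k \<otimes> add_pow R (int (j choose k)) (?r j))"
    unfolding minor_sum_rank_coeff[OF F' k] using r by (intro finsum_rdistr) auto
  also have "\<dots> = (\<Oplus>j\<in>{..n}. if k = j then ?r j else \<zero>)"
  proof (rule finsum_cong'[OF refl])
    fix j assume "j \<in> {..n}"
    then have "?r k \<otimes> ?r j = (if k = j then ?r k else \<zero>)"
      using k by (intro rank_coeff_orthogonal[OF F]) auto
    moreover have "?r k \<otimes> add_pow R (int (j choose k)) (?r j) = add_pow R (int (j choose k)) (?r k \<otimes> ?r j)"
      using r by (intro add_pow_rdistr_int)
    ultimately show "?r k \<otimes> add_pow R (int (j choose k)) (?r j) = (if k = j then ?r j else \<zero>)"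
      using r by (auto simp: add_pow_int_ge)
  qed (use r in auto)
  also have "\<dots> = ?r k" using r k by (intro finsum_singleton) auto
  finally show ?thesis .
qed

text \<open>
  Sylvester's identity over the polynomial ring, compared coefficientwise.
\<close>

lemma rank_coeff_mult_commute:
  assumes U: "U \<in> mats R n m" and V: "V \<in> mats R m n"
  shows "rank_coeff R n (\<lambda>i j. \<Oplus>l\<in>{..<m}. U i l \<otimes> V l j) = rank_coeff R m (\<lambda>i j. \<Oplus>l\<in>{..<n}. V i l \<otimes> U l j)"
proof -
  interpret UP: UP_cring R "UP R" by (rule UP_cring_UP)
  interpret c: ring_hom_cring R "UP R" "\<lambda>a. monom (UP R) a 0" by (rule UP.const_hom)
  define X where "X = monom (UP R) \<one> 1 \<ominus>\<^bsub>UP R\<^esub> \<one>\<^bsub>UP R\<^esub>"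
  have X: "X \<in> carrier (UP R)" unfolding X_def by auto
  let ?c = "\<lambda>a. monom (UP R) a 0"
  let ?F = "\<lambda>i j. \<Oplus>l\<in>{..<m}. U i l \<otimes> V l j" and ?G = "\<lambda>i j. \<Oplus>l\<in>{..<n}. V i l \<otimes> U l j"
  have F: "?F \<in> mats R n n" and G: "?G \<in> mats R m m"
    using U V by (auto simp: Pi_iff intro!: finsum_closed)
  have hom: "?c (\<Oplus>l\<in>{..<k}. A i l \<otimes> B l j) = (\<Oplus>\<^bsub>UP R\<^esub>l\<in>{..<k}. ?c (A i l) \<otimes>\<^bsub>UP R\<^esub> ?c (B l j))"
    if "i < a" "j < b" "A \<in> mats R a k" "B \<in> mats R k b"
    for i j k a b :: nat and A B :: "nat \<Rightarrow> nat \<Rightarrow> 'a"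
    using that by (subst c.hom_finsum) (auto simp: Pi_iff intro!: UP.P.finsum_cong')
  have Fc: "?c (?F i j) = (\<Oplus>\<^bsub>UP R\<^esub>l\<in>{..<m}. ?c (U i l) \<otimes>\<^bsub>UP R\<^esub> ?c (V l j))" if "i < n" "j < n" for i j
    using hom[OF that U V] .
  have Gc: "?c (?G i j) = (\<Oplus>\<^bsub>UP R\<^esub>l\<in>{..<n}. ?c (V i l) \<otimes>\<^bsub>UP R\<^esub> ?c (U l j))" if "i < m" "j < m" for i j
    using hom[OF that V U] .
  have Uc: "(\<lambda>i j. ?c (U i j)) \<in> mats (UP R) n m"
    and Vc: "(\<lambda>i j. ?c (V i j)) \<in> mats (UP R) m n"
    using U V by (auto simp: Pi_iff)
  have "det_one_plus (UP R) n X (\<lambda>i j. ?c (?F i j)) =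
      det_on (UP R) {..<n} (\<lambda>i j. (if i = j then \<one>\<^bsub>UP R\<^esub> else \<zero>\<^bsub>UP R\<^esub>) \<oplus>\<^bsub>UP R\<^esub>
        X \<otimes>\<^bsub>UP R\<^esub> (\<Oplus>\<^bsub>UP R\<^esub>l\<in>{..<m}. ?c (U i l) \<otimes>\<^bsub>UP R\<^esub> ?c (V l j)))"
    unfolding det_one_plus_def using Uc Vc X
    by (intro UP.P.det_on_cong) (auto simp: Fc Pi_iff intro!: UP.P.finsum_closed)
  also have "\<dots> = det_on (UP R) {..<m} (\<lambda>i j. (if i = j then \<one>\<^bsub>UP R\<^esub> else \<zero>\<^bsub>UP R\<^esub>) \<oplus>\<^bsub>UP R\<^esub>
        X \<otimes>\<^bsub>UP R\<^esub> (\<Oplus>\<^bsub>UP R\<^esub>l\<in>{..<n}. ?c (V i l) \<otimes>\<^bsub>UP R\<^esub> ?c (U l j)))"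
    by (rule UP.P.det_one_plus_mult_commute[OF Uc Vc X])
  also have "\<dots> = det_one_plus (UP R) m X (\<lambda>i j. ?c (?G i j))"
    unfolding det_one_plus_def using Uc Vc X
    by (intro UP.P.det_on_cong) (auto simp: Gc Pi_iff intro!: UP.P.finsum_closed)
  finally show ?thesis
    unfolding X_def by (intro ext) (simp only: UP.coeff_det_one_plus[OF F, symmetric] UP.coeff_det_one_plus[OF G, symmetric])
qed

text \<open>
  The substitution of \<open>1 + X\<close> for \<open>X\<close> has the substitution of \<open>X - 1\<close> as its inverse, so that the
  description of \<open>R\<close> by \<open>R(1 + X)\<close> determines it.
\<close>

lemma coeff_rank_poly:
  assumes F: "F \<in> mats R n n"
  shows "coeff (UP R) (rank_poly R n F) k = rank_coeff R n F k"
proof -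
  interpret UP: UP_cring R "UP R" by (rule UP_cring_UP)
  let ?P = "UP R" and ?c = "\<lambda>a. monom (UP R) a 0" and ?X = "monom (UP R) \<one> 1"
  interpret c: UP_pre_univ_prop R "UP R" ?c "UP R"
    using UP.const_hom UP_cring_UP by (intro UP_pre_univ_prop.intro)
  let ?r = "rank_coeff R n F"
  have r: "?r k \<in> carrier R" for k using F by simp
  have X: "?X \<in> carrier ?P" by simp
  let ?T = "eval R ?P ?c (\<one>\<^bsub>?P\<^esub> \<oplus>\<^bsub>?P\<^esub> ?X)" and ?T' = "eval R ?P ?c (?X \<ominus>\<^bsub>?P\<^esub> \<one>\<^bsub>?P\<^esub>)"
  interpret T: ring_hom_cring ?P ?P ?T
    by (intro ring_hom_cringI UP.UP_cring c.eval_ring_hom) auto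
  interpret T': ring_hom_cring ?P ?P ?T'
    by (intro ring_hom_cringI UP.UP_cring c.eval_ring_hom) auto
  have inverse: "?T' (?T p) = p" if p: "p \<in> carrier ?P" for p
  proof (rule c.UP_hom_unique[where Phi = "\<lambda>p. ?T' (?T p)" and Psi = "\<lambda>p. p" and s = ?X])
    show "ring_hom_cring ?P ?P (\<lambda>p. ?T' (?T p))"
      using ring_hom_trans[OF T.homh T'.homh] UP.UP_cring by (intro ring_hom_cringI) (auto simp: comp_def)
    show "ring_hom_cring ?P ?P (\<lambda>p. p)"
      using UP.UP_cring by (intro ring_hom_cringI) (auto intro!: ring_hom_memI)
    have "?T' (?T ?X) = ?T' (\<one>\<^bsub>?P\<^esub> \<oplus>\<^bsub>?P\<^esub> ?X)"
      using c.eval_monom1[of "\<one>\<^bsub>?P\<^esub> \<oplus>\<^bsub>?P\<^esub> ?X"] X by simp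
    also have "\<dots> = \<one>\<^bsub>?P\<^esub> \<oplus>\<^bsub>?P\<^esub> (?X \<ominus>\<^bsub>?P\<^esub> \<one>\<^bsub>?P\<^esub>)"
      using T'.hom_add[OF UP.P.one_closed X] c.eval_monom1[of "?X \<ominus>\<^bsub>?P\<^esub> \<one>\<^bsub>?P\<^esub>"] X T'.hom_one by simp
    also have "\<dots> = ?X"
      using X UP.P.one_closed by algebra
    finally show "?T' (?T (monom ?P \<one> (Suc 0))) = ?X" by simp
  qed (use p X in \<open>auto simp: c.eval_const\<close>)
  \<comment> \<open>The candidate for \<open>R\<close>.\<close>
  define Q where "Q = (\<Oplus>\<^bsub>?P\<^esub>j\<in>{..n}. monom ?P (?r j) j)"
  have Q: "Q \<in> carrier ?P" unfolding Q_def using r by auto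
  let ?det = "det_on ?P {..<n} (\<lambda>i j. (if i = j then \<one>\<^bsub>?P\<^esub> else \<zero>\<^bsub>?P\<^esub>) \<oplus>\<^bsub>?P\<^esub> ?X \<otimes>\<^bsub>?P\<^esub> ?c (F i j))"
  have "?T Q = (\<Oplus>\<^bsub>?P\<^esub>j\<in>{..n}. ?c (?r j) \<otimes>\<^bsub>?P\<^esub> (\<one>\<^bsub>?P\<^esub> \<oplus>\<^bsub>?P\<^esub> ?X) [^]\<^bsub>?P\<^esub> j)"
    unfolding Q_def using r X by (subst T.hom_finsum) (auto simp: c.eval_monom intro!: UP.P.finsum_cong')
  also have "\<dots> = det_one_plus ?P n ((\<one>\<^bsub>?P\<^esub> \<oplus>\<^bsub>?P\<^esub> ?X) \<ominus>\<^bsub>?P\<^esub> \<one>\<^bsub>?P\<^esub>) (\<lambda>i j. ?c (F i j))"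
    using c.det_one_plus_hom[OF F, of "\<one>\<^bsub>?P\<^esub> \<oplus>\<^bsub>?P\<^esub> ?X"] X by simp
  also have "(\<one>\<^bsub>?P\<^esub> \<oplus>\<^bsub>?P\<^esub> ?X) \<ominus>\<^bsub>?P\<^esub> \<one>\<^bsub>?P\<^esub> = ?X"
    using X UP.P.one_closed by algebra
  finally have TQ: "?T Q = ?det" unfolding det_one_plus_def .
  have "rank_poly R n F = Q"
    unfolding rank_poly_def
  proof (rule the_equality)
    show "Q \<in> carrier ?P \<and> ?T Q = ?det" using Q TQ by blast
  next
    fix p assume "p \<in> carrier ?P \<and> ?T p = ?det"
    then show "p = Q" using inverse[of p] inverse[OF Q] TQ by simp
  qed
  also have "Q = det_one_plus ?P n (?X \<ominus>\<^bsub>?P\<^esub> \<one>\<^bsub>?P\<^esub>) (\<lambda>i j. ?c (F i j))"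
    unfolding Q_def by (simp only: UP.det_one_plus_monom[OF F] nat_mult_1)
  finally show ?thesis by (simp only: UP.coeff_det_one_plus[OF F])
qed

text \<open>
  A polynomial in \<open>X\<close> and \<open>X - 1\<close> alone, since \<open>det (X I - F)\<close> arises from \<open>det_scalar_plus\<close> with
  \<open>a + b = X - 1\<close>.
\<close>

lemma char_poly_on_eq:
  assumes F: "F \<in> mats R n n"
  shows "char_poly_on R n F =
    (\<Oplus>\<^bsub>UP R\<^esub>j\<in>{..n}. UP_const R (rank_coeff R n F j) \<otimes>\<^bsub>UP R\<^esub>
      (UP_X R \<ominus>\<^bsub>UP R\<^esub> \<one>\<^bsub>UP R\<^esub>) [^]\<^bsub>UP R\<^esub> j \<otimes>\<^bsub>UP R\<^esub> UP_X R [^]\<^bsub>UP R\<^esub> (n - j))"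
proof -
  interpret UP: UP_cring R "UP R" by (rule UP_cring_UP)
  interpret c: ring_hom_cring R "UP R" "UP_const R" by (rule UP.const_hom)
  let ?P = "UP R"
  have "char_poly_on R n F = det_on ?P {..<n} (\<lambda>i j. (if i = j then UP_X R else \<zero>\<^bsub>?P\<^esub>) \<oplus>\<^bsub>?P\<^esub>
      (\<ominus>\<^bsub>?P\<^esub> \<one>\<^bsub>?P\<^esub>) \<otimes>\<^bsub>?P\<^esub> UP_const R (F i j))"
    unfolding char_poly_on_def using F
    by (intro UP.P.det_on_cong) (auto simp: Pi_iff UP.P.minus_eq UP.P.l_minus)
  also have "\<dots> = (\<Oplus>\<^bsub>?P\<^esub>j\<in>{..n}. UP_const R (rank_coeff R n F j) \<otimes>\<^bsub>?P\<^esub>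
      (UP_X R \<oplus>\<^bsub>?P\<^esub> \<ominus>\<^bsub>?P\<^esub> \<one>\<^bsub>?P\<^esub>) [^]\<^bsub>?P\<^esub> j \<otimes>\<^bsub>?P\<^esub> UP_X R [^]\<^bsub>?P\<^esub> (n - j))"
    unfolding c.hom_rank_coeff[OF F] by (rule UP.P.det_scalar_plus[OF c.hom_matrix[OF F]]) auto
  finally show ?thesis by (simp add: UP.P.minus_eq)
qed

end


section \<open>Matrices acting on standard modules\<close>

abbreviation vecs :: "('a, 'b) ring_scheme \<Rightarrow> nat \<Rightarrow> (nat \<Rightarrow> 'a) set" where
  "vecs R n \<equiv> {..<n} \<rightarrow>\<^sub>E carrier R"

definition mat_vec ::
    "('a, 'b) ring_scheme \<Rightarrow> nat \<Rightarrow> nat \<Rightarrow> (nat \<Rightarrow> nat \<Rightarrow> 'a) \<Rightarrow> (nat \<Rightarrow> 'a) \<Rightarrow> nat \<Rightarrow> 'a" where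
  "mat_vec R n m P x = (\<lambda>i\<in>{..<n}. \<Oplus>\<^bsub>R\<^esub>j\<in>{..<m}. P i j \<otimes>\<^bsub>R\<^esub> x j)"

lemma carrier_std_module [simp]: "carrier (std_module R n) = vecs R n"
  and add_std_module [simp]: "x \<oplus>\<^bsub>std_module R n\<^esub> y = (\<lambda>i\<in>{..<n}. x i \<oplus>\<^bsub>R\<^esub> y i)"
  and smult_std_module [simp]: "a \<odot>\<^bsub>std_module R n\<^esub> x = (\<lambda>i\<in>{..<n}. a \<otimes>\<^bsub>R\<^esub> x i)"
  and zero_std_module [simp]: "\<zero>\<^bsub>std_module R n\<^esub> = (\<lambda>i\<in>{..<n}. \<zero>\<^bsub>R\<^esub>)"
  by (simp_all add: std_module_def)

lemma carrier_mat_image: "carrier (mat_image R n F) = mat_vec R n n F ` (vecs R n)"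
  and add_mat_image [simp]: "x \<oplus>\<^bsub>mat_image R n F\<^esub> y = (\<lambda>i\<in>{..<n}. x i \<oplus>\<^bsub>R\<^esub> y i)"
  and smult_mat_image [simp]: "a \<odot>\<^bsub>mat_image R n F\<^esub> x = (\<lambda>i\<in>{..<n}. a \<otimes>\<^bsub>R\<^esub> x i)"
  and zero_mat_image [simp]: "\<zero>\<^bsub>mat_image R n F\<^esub> = (\<lambda>i\<in>{..<n}. \<zero>\<^bsub>R\<^esub>)"
  by (simp_all add: mat_image_def mat_vec_def std_module_def)

lemma mat_image_eq: "mat_image R n F = (std_module R n)\<lparr>carrier := carrier (mat_image R n F)\<rparr>"
  by (simp add: mat_image_def)

context cring
begin

lemma finsum_swap:
  assumes "finite I" "finite J" "\<And>i j. i \<in> I \<Longrightarrow> j \<in> J \<Longrightarrow> f i j \<in> carrier R"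
  shows "(\<Oplus>i\<in>I. \<Oplus>j\<in>J. f i j) = (\<Oplus>j\<in>J. \<Oplus>i\<in>I. f i j)"
  using assms(1,3)
proof (induction I)
  case empty
  then show ?case by simp
next
  case (insert a I)
  then have "(\<Oplus>i\<in>insert a I. \<Oplus>j\<in>J. f i j) = (\<Oplus>j\<in>J. f a j) \<oplus> (\<Oplus>j\<in>J. \<Oplus>i\<in>I. f i j)"
    by (subst finsum_insert) auto
  also have "\<dots> = (\<Oplus>j\<in>J. f a j \<oplus> (\<Oplus>i\<in>I. f i j))"
    using insert by (intro finsum_addf[symmetric]) auto
  also have "\<dots> = (\<Oplus>j\<in>J. \<Oplus>i\<in>insert a I. f i j)"
    using insert by (intro finsum_cong') auto
  finally show ?case .
qed

lemma std_module_module: "module R (std_module R n)"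
proof (rule moduleI)
  show "abelian_group (std_module R n)"
  proof (rule abelian_groupI)
    fix x assume "x \<in> carrier (std_module R n)"
    then show "\<exists>y\<in>carrier (std_module R n). y \<oplus>\<^bsub>std_module R n\<^esub> x = \<zero>\<^bsub>std_module R n\<^esub>"
      by (intro bexI[of _ "\<lambda>i\<in>{..<n}. \<ominus> x i"]) (auto simp: l_neg PiE_iff)
  qed (auto simp: PiE_iff extensional_def fun_eq_iff a_ac)
qed (auto simp: is_cring PiE_iff extensional_def fun_eq_iff l_distr r_distr m_assoc)

lemma mat_vec_closed [simp]:
  assumes "P \<in> mats R n m" "x \<in> vecs R m"
  shows "mat_vec R n m P x \<in> vecs R n"
  unfolding mat_vec_def using assms by (auto simp: Pi_iff PiE_iff intro!: finsum_closed)

lemma mat_vec_add: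
  assumes "P \<in> mats R n m" "x \<in> vecs R m" "y \<in> vecs R m"
  shows "mat_vec R n m P (\<lambda>i\<in>{..<m}. x i \<oplus> y i) = (\<lambda>i\<in>{..<n}. mat_vec R n m P x i \<oplus> mat_vec R n m P y i)"
  unfolding mat_vec_def
proof (rule restrict_ext)
  fix i assume i: "i \<in> {..<n}"
  have "(\<Oplus>j\<in>{..<m}. P i j \<otimes> (\<lambda>i\<in>{..<m}. x i \<oplus> y i) j) = (\<Oplus>j\<in>{..<m}. P i j \<otimes> x j \<oplus> P i j \<otimes> y j)"
    using assms i by (intro finsum_cong') (auto simp: Pi_iff PiE_iff r_distr)
  also have "\<dots> = (\<Oplus>j\<in>{..<m}. P i j \<otimes> x j) \<oplus> (\<Oplus>j\<in>{..<m}. P i j \<otimes> y j)"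
    using assms i by (intro finsum_addf) (auto simp: Pi_iff PiE_iff)
  finally show "(\<Oplus>j\<in>{..<m}. P i j \<otimes> (\<lambda>i\<in>{..<m}. x i \<oplus> y i) j) =
      (\<lambda>i\<in>{..<n}. \<Oplus>j\<in>{..<m}. P i j \<otimes> x j) i \<oplus> (\<lambda>i\<in>{..<n}. \<Oplus>j\<in>{..<m}. P i j \<otimes> y j) i"
    using i by simp
qed

lemma mat_vec_smult:
  assumes "P \<in> mats R n m" "x \<in> vecs R m" "a \<in> carrier R"
  shows "mat_vec R n m P (\<lambda>i\<in>{..<m}. a \<otimes> x i) = (\<lambda>i\<in>{..<n}. a \<otimes> mat_vec R n m P x i)"
  unfolding mat_vec_def
proof (rule restrict_ext)
  fix i assume i: "i \<in> {..<n}"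
  have "(\<Oplus>j\<in>{..<m}. P i j \<otimes> (\<lambda>i\<in>{..<m}. a \<otimes> x i) j) = (\<Oplus>j\<in>{..<m}. a \<otimes> (P i j \<otimes> x j))"
    using assms i by (intro finsum_cong') (auto simp: Pi_iff PiE_iff m_lcomm)
  also have "\<dots> = a \<otimes> (\<Oplus>j\<in>{..<m}. P i j \<otimes> x j)"
    using assms i by (intro finsum_rdistr[symmetric]) (auto simp: Pi_iff PiE_iff)
  finally show "(\<Oplus>j\<in>{..<m}. P i j \<otimes> (\<lambda>i\<in>{..<m}. a \<otimes> x i) j) =
      a \<otimes> (\<lambda>i\<in>{..<n}. \<Oplus>j\<in>{..<m}. P i j \<otimes> x j) i"
    using i by simp
qed

lemma mat_vec_cong:
  assumes "Q \<in> mats R n m" "x \<in> vecs R m"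
    and "\<And>i j. i < n \<Longrightarrow> j < m \<Longrightarrow> P i j = Q i j"
  shows "mat_vec R n m P x = mat_vec R n m Q x"
  unfolding mat_vec_def using assms
  by (intro restrict_ext finsum_cong') (auto simp: Pi_iff PiE_iff)

lemma mat_vec_mat_vec:
  assumes P: "P \<in> mats R n m" and Q: "Q \<in> mats R m k"
    and x: "x \<in> vecs R k"
  shows "mat_vec R n m P (mat_vec R m k Q x) = mat_vec R n k (\<lambda>i j. \<Oplus>l\<in>{..<m}. P i l \<otimes> Q l j) x"
  unfolding mat_vec_def
proof (rule restrict_ext)
  fix i assume i: "i \<in> {..<n}"
  have closed: "P i l \<in> carrier R" "Q l j \<in> carrier R" "x j \<in> carrier R" if "l < m" "j < k" for l j
    using that P Q x i by (auto simp: Pi_iff PiE_iff)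
  have "(\<Oplus>l\<in>{..<m}. P i l \<otimes> (\<lambda>l\<in>{..<m}. \<Oplus>j\<in>{..<k}. Q l j \<otimes> x j) l) =
      (\<Oplus>l\<in>{..<m}. \<Oplus>j\<in>{..<k}. P i l \<otimes> Q l j \<otimes> x j)"
  proof (rule finsum_cong'[OF refl])
    fix l assume l: "l \<in> {..<m}"
    have "P i l \<otimes> (\<Oplus>j\<in>{..<k}. Q l j \<otimes> x j) = (\<Oplus>j\<in>{..<k}. P i l \<otimes> (Q l j \<otimes> x j))"
      using l closed P i by (intro finsum_rdistr) (auto simp: Pi_iff)
    also have "\<dots> = (\<Oplus>j\<in>{..<k}. P i l \<otimes> Q l j \<otimes> x j)"
      using l closed by (intro finsum_cong') (auto simp: m_assoc)
    finally show "P i l \<otimes> (\<lambda>l\<in>{..<m}. \<Oplus>j\<in>{..<k}. Q l j \<otimes> x j) l = (\<Oplus>j\<in>{..<k}. P i l \<otimes> Q l j \<otimes> x j)"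
      using l by simp
  qed (use closed in \<open>auto intro!: finsum_closed\<close>)
  also have "\<dots> = (\<Oplus>j\<in>{..<k}. \<Oplus>l\<in>{..<m}. P i l \<otimes> Q l j \<otimes> x j)"
    using closed by (intro finsum_swap) auto
  also have "\<dots> = (\<Oplus>j\<in>{..<k}. (\<Oplus>l\<in>{..<m}. P i l \<otimes> Q l j) \<otimes> x j)"
  proof (rule finsum_cong'[OF refl])
    fix j assume j: "j \<in> {..<k}"
    then show "(\<Oplus>l\<in>{..<m}. P i l \<otimes> Q l j \<otimes> x j) = (\<Oplus>l\<in>{..<m}. P i l \<otimes> Q l j) \<otimes> x j"
      using closed x by (intro finsum_ldistr[symmetric]) (auto simp: PiE_iff)
  qed (use closed x in \<open>auto simp: PiE_iff intro!: finsum_closed m_closed\<close>)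
  finally show "(\<Oplus>l\<in>{..<m}. P i l \<otimes> (\<lambda>l\<in>{..<m}. \<Oplus>j\<in>{..<k}. Q l j \<otimes> x j) l) =
      (\<Oplus>j\<in>{..<k}. (\<Oplus>l\<in>{..<m}. P i l \<otimes> Q l j) \<otimes> x j)" .
qed

lemma mat_vec_one:
  assumes x: "x \<in> vecs R n"
  shows "mat_vec R n n (\<lambda>i j. if i = j then \<one> else \<zero>) x = x"
proof
  fix i
  show "mat_vec R n n (\<lambda>i j. if i = j then \<one> else \<zero>) x i = x i"
  proof (cases "i < n")
    case True
    have "(\<Oplus>j\<in>{..<n}. (if i = j then \<one> else \<zero>) \<otimes> x j) = (\<Oplus>j\<in>{..<n}. if i = j then x j else \<zero>)"
      using x by (intro finsum_cong') (auto simp: PiE_iff)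
    also have "\<dots> = x i" using x True by (intro finsum_singleton) (auto simp: PiE_iff)
    finally show ?thesis using True by (simp add: mat_vec_def)
  next
    case False
    then show ?thesis using x by (auto simp: mat_vec_def PiE_iff extensional_def)
  qed
qed

lemma mat_vec_basis:
  assumes P: "P \<in> mats R n m" and ij: "i < n" "j < m"
  shows "mat_vec R n m P (\<lambda>l\<in>{..<m}. if l = j then \<one> else \<zero>) i = P i j"
proof -
  have "mat_vec R n m P (\<lambda>l\<in>{..<m}. if l = j then \<one> else \<zero>) i = (\<Oplus>l\<in>{..<m}. if j = l then P i l else \<zero>)"
    unfolding mat_vec_def using P ij by (simp, intro finsum_cong') (auto simp: Pi_iff)
  also have "\<dots> = P i j" using P ij by (intro finsum_singleton) (auto simp: Pi_iff)
  finally show ?thesis .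
qed

lemma mat_vec_inj:
  assumes "P \<in> mats R n m" "Q \<in> mats R n m"
    and "\<And>x. x \<in> vecs R m \<Longrightarrow> mat_vec R n m P x = mat_vec R n m Q x"
    and "i < n" "j < m"
  shows "P i j = Q i j"
proof -
  have "(\<lambda>l\<in>{..<m}. if l = j then \<one> else \<zero>) \<in> vecs R m" by auto
  then show ?thesis
    using assms mat_vec_basis[of P n m i j] mat_vec_basis[of Q n m i j] by metis
qed

text \<open>
  The columns of the matrix are the images of the standard basis vectors. Linearity is applied to one
  coordinate after the other, on the vectors whose coordinates from \<open>k\<close> on vanish.
\<close>

lemma linear_mat_vec_ex:
  assumes closed: "\<And>x. x \<in> vecs R m \<Longrightarrow> f x \<in> vecs R n"
    and add: "\<And>x y. x \<in> vecs R m \<Longrightarrow> y \<in> vecs R m \<Longrightarrow>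
      f (\<lambda>i\<in>{..<m}. x i \<oplus> y i) = (\<lambda>i\<in>{..<n}. f x i \<oplus> f y i)"
    and smult: "\<And>a x. a \<in> carrier R \<Longrightarrow> x \<in> vecs R m \<Longrightarrow>
      f (\<lambda>i\<in>{..<m}. a \<otimes> x i) = (\<lambda>i\<in>{..<n}. a \<otimes> f x i)"
  obtains P where "P \<in> mats R n m"
    and "\<And>x. x \<in> vecs R m \<Longrightarrow> f x = mat_vec R n m P x"
proof
  let ?e = "\<lambda>j. \<lambda>i\<in>{..<m}. if i = j then \<one> else \<zero>"
  let ?P = "\<lambda>i j. f (?e j) i"
  have e: "?e j \<in> vecs R m" for j by auto
  show P: "?P \<in> mats R n m"
    using closed[OF e] by (auto simp: PiE_iff)
  fix x assume x: "x \<in> vecs R m"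
  have "f (\<lambda>i\<in>{..<m}. if i < k then x i else \<zero>) = (\<lambda>i\<in>{..<n}. \<Oplus>j\<in>{..<k}. ?P i j \<otimes> x j)" if "k \<le> m" for k
    using that
  proof (induction k)
    case 0
    have z: "(\<lambda>i\<in>{..<m}. \<zero>) \<in> vecs R m" by (rule restrict_PiE_iff[THEN iffD2]) simp
    have "f (\<lambda>i\<in>{..<m}. \<zero> \<otimes> (\<lambda>i\<in>{..<m}. \<zero>) i) = (\<lambda>i\<in>{..<n}. \<zero> \<otimes> f (\<lambda>i\<in>{..<m}. \<zero>) i)"
      by (rule smult[OF zero_closed z])
    moreover have "(\<lambda>i\<in>{..<m}. \<zero> \<otimes> (\<lambda>i\<in>{..<m}. \<zero>) i) = (\<lambda>i\<in>{..<m}. \<zero>)"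
      by (auto intro!: restrict_ext)
    moreover have "(\<lambda>i\<in>{..<n}. \<zero> \<otimes> f (\<lambda>i\<in>{..<m}. \<zero>) i) = (\<lambda>i\<in>{..<n}. \<zero>)"
      using closed[OF z] by (auto intro!: restrict_ext simp: PiE_iff)
    ultimately show ?case by (simp only: not_less_zero if_False lessThan_0 finsum_empty)
  next
    case (Suc k)
    let ?y = "\<lambda>i\<in>{..<m}. if i < k then x i else \<zero>"
    have y: "?y \<in> vecs R m" and xk: "x k \<in> carrier R"
      using x Suc by (auto simp: PiE_iff)
    have xe: "(\<lambda>i\<in>{..<m}. x k \<otimes> ?e k i) \<in> vecs R m" using xk by auto
    have "(\<lambda>i\<in>{..<m}. if i < Suc k then x i else \<zero>) = (\<lambda>i\<in>{..<m}. ?y i \<oplus> (\<lambda>i\<in>{..<m}. x k \<otimes> ?e k i) i)"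
      using x xk by (intro restrict_ext) (auto simp: PiE_iff less_Suc_eq)
    then have "f (\<lambda>i\<in>{..<m}. if i < Suc k then x i else \<zero>) =
        (\<lambda>i\<in>{..<n}. f ?y i \<oplus> f (\<lambda>i\<in>{..<m}. x k \<otimes> ?e k i) i)"
      using add[OF y xe] by simp
    also have "\<dots> = (\<lambda>i\<in>{..<n}. (\<Oplus>j\<in>{..<k}. ?P i j \<otimes> x j) \<oplus> x k \<otimes> ?P i k)"
    proof (rule restrict_ext)
      fix i assume i: "i \<in> {..<n}"
      have "f ?y i = (\<Oplus>j\<in>{..<k}. ?P i j \<otimes> x j)"
        using fun_cong[OF Suc.IH[OF Suc_leD[OF Suc.prems]], of i] i by (simp only: restrict_apply')
      moreover have "f (\<lambda>i\<in>{..<m}. x k \<otimes> ?e k i) i = x k \<otimes> ?P i k"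
        using fun_cong[OF smult[OF xk e[of k]], of i] i by (simp only: restrict_apply')
      ultimately show "f ?y i \<oplus> f (\<lambda>i\<in>{..<m}. x k \<otimes> ?e k i) i = (\<Oplus>j\<in>{..<k}. ?P i j \<otimes> x j) \<oplus> x k \<otimes> ?P i k"
        by (simp only:)
    qed
    also have "\<dots> = (\<lambda>i\<in>{..<n}. \<Oplus>j\<in>{..<Suc k}. ?P i j \<otimes> x j)"
    proof (rule restrict_ext)
      fix i assume i: "i \<in> {..<n}"
      have cl: "?P i j \<in> carrier R" for j using closed[OF e] i by (auto simp: PiE_iff)
      moreover have "x j \<in> carrier R" if "j < Suc k" for j using x Suc.prems that by (auto simp: PiE_iff)
      ultimately show "(\<Oplus>j\<in>{..<k}. ?P i j \<otimes> x j) \<oplus> x k \<otimes> ?P i k = (\<Oplus>j\<in>{..<Suc k}. ?P i j \<otimes> x j)"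
        unfolding lessThan_Suc using xk by (subst finsum_insert) (auto simp: a_comm m_comm intro!: finsum_closed)
    qed
    finally show ?case .
  qed
  from this[of m] have "f (\<lambda>i\<in>{..<m}. if i < m then x i else \<zero>) = mat_vec R n m ?P x"
    by (simp add: mat_vec_def)
  moreover have "(\<lambda>i\<in>{..<m}. if i < m then x i else \<zero>) = x"
    using x by (auto simp: PiE_iff extensional_def fun_eq_iff)
  ultimately show "f x = mat_vec R n m ?P x" by simp
qed

lemma mat_image_submodule:
  assumes F: "F \<in> mats R n n"
  shows "submodule (carrier (mat_image R n F)) R (std_module R n)"
proof -
  interpret M: Module.module R "std_module R n" by (rule std_module_module)
  have scal: "(\<lambda>i\<in>{..<n}. a \<otimes> x i) \<in> carrier (mat_image R n F)"
    if "a \<in> carrier R" "x \<in> carrier (mat_image R n F)" for a x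
  proof -
    from that(2) obtain y where y: "y \<in> vecs R n" "x = mat_vec R n n F y"
      by (auto simp: carrier_mat_image)
    then have "(\<lambda>i\<in>{..<n}. a \<otimes> x i) = mat_vec R n n F (\<lambda>i\<in>{..<n}. a \<otimes> y i)"
      using mat_vec_smult[OF F y(1) that(1)] by simp
    moreover have "(\<lambda>i\<in>{..<n}. a \<otimes> y i) \<in> vecs R n"
      using y(1) that(1) by (auto simp: PiE_iff)
    ultimately show ?thesis by (auto simp: carrier_mat_image)
  qed
  have sub: "carrier (mat_image R n F) \<subseteq> vecs R n"
    using mat_vec_closed[OF F] by (auto simp: carrier_mat_image simp del: mat_vec_closed)
  show ?thesis
  proof (rule M.submoduleI)
    show "carrier (mat_image R n F) \<subseteq> carrier (std_module R n)" using sub by simp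
    have "mat_vec R n n F (\<lambda>i\<in>{..<n}. \<zero>) = (\<lambda>i\<in>{..<n}. \<zero>)"
      unfolding mat_vec_def using F by (intro restrict_ext add.finprod_one_eqI) (auto simp: Pi_iff)
    then show "\<zero>\<^bsub>std_module R n\<^esub> \<in> carrier (mat_image R n F)"
      unfolding carrier_mat_image zero_std_module
      by (intro rev_image_eqI[of "\<lambda>i\<in>{..<n}. \<zero>"] restrict_PiE_iff[THEN iffD2]) simp_all
    show "a \<odot>\<^bsub>std_module R n\<^esub> x \<in> carrier (mat_image R n F)"
      if "a \<in> carrier R" "x \<in> carrier (mat_image R n F)" for a x
      using scal[OF that] by simp
    show "\<ominus>\<^bsub>std_module R n\<^esub> x \<in> carrier (mat_image R n F)" if "x \<in> carrier (mat_image R n F)" for x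
    proof -
      have "x \<in> carrier (std_module R n)" using that sub by auto
      from M.smult_l_minus[OF one_closed this] have "\<ominus>\<^bsub>std_module R n\<^esub> x = (\<ominus> \<one>) \<odot>\<^bsub>std_module R n\<^esub> x"
        using \<open>x \<in> carrier (std_module R n)\<close> M.smult_one by metis
      then show ?thesis using scal[OF _ that, of "\<ominus> \<one>"] by simp
    qed
    show "x \<oplus>\<^bsub>std_module R n\<^esub> y \<in> carrier (mat_image R n F)"
      if xy: "x \<in> carrier (mat_image R n F)" "y \<in> carrier (mat_image R n F)" for x y
    proof -
      from xy obtain v w where v: "v \<in> vecs R n" "x = mat_vec R n n F v"
        and w: "w \<in> vecs R n" "y = mat_vec R n n F w"
        by (auto simp: carrier_mat_image)
      have "(\<lambda>i\<in>{..<n}. x i \<oplus> y i) = mat_vec R n n F (\<lambda>i\<in>{..<n}. v i \<oplus> w i)"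
        using mat_vec_add[OF F v(1) w(1)] v w by simp
      moreover have "(\<lambda>i\<in>{..<n}. v i \<oplus> w i) \<in> vecs R n"
        using v w by (auto simp: PiE_iff)
      ultimately show ?thesis by (auto simp: carrier_mat_image)
    qed
  qed
qed

lemma mat_image_module:
  assumes F: "F \<in> mats R n n"
  shows "module R (mat_image R n F)"
  by (subst mat_image_eq)
     (rule submodule.submodule_is_module[OF mat_image_submodule[OF F] std_module_module])

lemma mat_image_idem:
  assumes F: "idem_mat R n F" and x: "x \<in> carrier (mat_image R n F)"
  shows "x \<in> vecs R n" "mat_vec R n n F x = x"
proof -
  note F' = idem_matD[OF F]
  from x obtain y where y: "y \<in> vecs R n" "x = mat_vec R n n F y"
    by (auto simp: carrier_mat_image)
  then show "x \<in> vecs R n" using F' by simp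
  show "mat_vec R n n F x = x"
    unfolding y(2) mat_vec_mat_vec[OF F'(1) F'(1) y(1)]
    using F' y(1) by (intro mat_vec_cong) auto
qed

lemma mat_image_idemI:
  "x \<in> vecs R n \<Longrightarrow> mat_vec R n n F x = x \<Longrightarrow> x \<in> carrier (mat_image R n F)"
  by (metis carrier_mat_image image_eqI)

end


section \<open>Isomorphic images and constant rank\<close>

text \<open>
  Used for both orders of the modules at once, so that the two maps of an isomorphism play symmetric
  roles.
\<close>

definition mutually_inverse ::
    "('a, 'b) ring_scheme \<Rightarrow> ('a, 'c, 'd) module_scheme \<Rightarrow> ('a, 'e, 'f) module_scheme \<Rightarrow> ('c \<Rightarrow> 'e) \<Rightarrow> ('e \<Rightarrow> 'c) \<Rightarrow> bool"
  where "mutually_inverse R M N h g \<longleftrightarrow>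
     (\<forall>x\<in>carrier M. h x \<in> carrier N \<and> g (h x) = x) \<and>
     (\<forall>x\<in>carrier M. \<forall>y\<in>carrier M. h (x \<oplus>\<^bsub>M\<^esub> y) = h x \<oplus>\<^bsub>N\<^esub> h y) \<and>
     (\<forall>a\<in>carrier R. \<forall>x\<in>carrier M. h (a \<odot>\<^bsub>M\<^esub> x) = a \<odot>\<^bsub>N\<^esub> h x)"

lemma mutually_inverseD:
  assumes "mutually_inverse R M N h g"
  shows "x \<in> carrier M \<Longrightarrow> h x \<in> carrier N" "x \<in> carrier M \<Longrightarrow> g (h x) = x"
    and "x \<in> carrier M \<Longrightarrow> y \<in> carrier M \<Longrightarrow> h (x \<oplus>\<^bsub>M\<^esub> y) = h x \<oplus>\<^bsub>N\<^esub> h y"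
    and "a \<in> carrier R \<Longrightarrow> x \<in> carrier M \<Longrightarrow> h (a \<odot>\<^bsub>M\<^esub> x) = a \<odot>\<^bsub>N\<^esub> h x"
  using assms unfolding mutually_inverse_def by blast+

lemma modules_isoE:
  assumes "modules_iso R M N" "Module.module R M"
  obtains h g where "mutually_inverse R M N h g" "mutually_inverse R N M g h"
proof -
  interpret M: Module.module R M by fact
  from assms(1) obtain h where h: "bij_betw h (carrier M) (carrier N)"
    and add: "\<And>x y. x \<in> carrier M \<Longrightarrow> y \<in> carrier M \<Longrightarrow> h (x \<oplus>\<^bsub>M\<^esub> y) = h x \<oplus>\<^bsub>N\<^esub> h y"
    and smult: "\<And>a x. a \<in> carrier R \<Longrightarrow> x \<in> carrier M \<Longrightarrow> h (a \<odot>\<^bsub>M\<^esub> x) = a \<odot>\<^bsub>N\<^esub> h x"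
    unfolding modules_iso_def by blast
  let ?g = "inv_into (carrier M) h"
  have hN: "h x \<in> carrier N" if "x \<in> carrier M" for x
    using h that by (auto simp: bij_betw_def)
  have g: "?g x \<in> carrier M" "h (?g x) = x" if "x \<in> carrier N" for x
    using h that by (auto simp: bij_betw_def inv_into_into f_inv_into_f)
  have gh: "?g (h x) = x" if "x \<in> carrier M" for x
    using h that by (simp add: bij_betw_def)
  have gadd: "?g (x \<oplus>\<^bsub>N\<^esub> y) = ?g x \<oplus>\<^bsub>M\<^esub> ?g y" if "x \<in> carrier N" "y \<in> carrier N" for x y
    using add[OF g(1) g(1), OF that] gh[of "?g x \<oplus>\<^bsub>M\<^esub> ?g y"] g that by simp
  have gsmult: "?g (a \<odot>\<^bsub>N\<^esub> x) = a \<odot>\<^bsub>M\<^esub> ?g x" if "a \<in> carrier R" "x \<in> carrier N" for a x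
    using smult[OF that(1) g(1)[OF that(2)]] gh[of "a \<odot>\<^bsub>M\<^esub> ?g x"] g that by simp
  show thesis
    by (rule that[of h ?g]) (use hN g gh add smult gadd gsmult in \<open>simp_all add: mutually_inverse_def\<close>)
qed

lemma modules_iso_trans:
  assumes "modules_iso R M N" "modules_iso R N L"
  shows "modules_iso R M L"
proof -
  from assms(1) obtain f where f: "bij_betw f (carrier M) (carrier N)"
    "\<forall>x\<in>carrier M. \<forall>y\<in>carrier M. f (x \<oplus>\<^bsub>M\<^esub> y) = f x \<oplus>\<^bsub>N\<^esub> f y"
    "\<forall>a\<in>carrier R. \<forall>x\<in>carrier M. f (a \<odot>\<^bsub>M\<^esub> x) = a \<odot>\<^bsub>N\<^esub> f x"
    unfolding modules_iso_def by blast
  from assms(2) obtain g where g: "bij_betw g (carrier N) (carrier L)"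
    "\<forall>x\<in>carrier N. \<forall>y\<in>carrier N. g (x \<oplus>\<^bsub>N\<^esub> y) = g x \<oplus>\<^bsub>L\<^esub> g y"
    "\<forall>a\<in>carrier R. \<forall>x\<in>carrier N. g (a \<odot>\<^bsub>N\<^esub> x) = a \<odot>\<^bsub>L\<^esub> g x"
    unfolding modules_iso_def by blast
  have "f x \<in> carrier N" if "x \<in> carrier M" for x using f(1) that by (rule bij_betwE[THEN bspec])
  then show ?thesis unfolding modules_iso_def
    using f g by (intro exI[of _ "g \<circ> f"]) (auto intro: bij_betw_trans)
qed

context cring
begin

lemma rank_coeff_cong:
  assumes "G \<in> mats R n n" "\<And>i j. i < n \<Longrightarrow> j < n \<Longrightarrow> F i j = G i j"
  shows "rank_coeff R n F = rank_coeff R n G"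
proof -
  have "det_on R I F = det_on R I G" if I: "I \<subseteq> {..<n}" for I
  proof -
    have "i < n" if "i \<in> I" for i using that I by auto
    then show ?thesis using assms by (intro det_on_cong) (auto simp: Pi_iff)
  qed
  then have "minor_sum R n F k = minor_sum R n G k" for k
    unfolding minor_sum_def using minor_closed[OF assms(1)] by (intro finsum_cong') auto
  then show ?thesis unfolding rank_coeff_def by (simp add: fun_eq_iff)
qed

text \<open>
  Composed with \<open>G\<close>, a linear map on the image of \<open>G\<close> becomes one on the whole standard module.
\<close>

lemma linear_on_image_mat_vec_ex:
  assumes G: "G \<in> mats R m m"
    and closed: "\<And>x. x \<in> carrier (mat_image R m G) \<Longrightarrow> h x \<in> vecs R n"
    and add: "\<And>x y. x \<in> carrier (mat_image R m G) \<Longrightarrow> y \<in> carrier (mat_image R m G) \<Longrightarrow>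
      h (\<lambda>i\<in>{..<m}. x i \<oplus> y i) = (\<lambda>i\<in>{..<n}. h x i \<oplus> h y i)"
    and smult: "\<And>a x. a \<in> carrier R \<Longrightarrow> x \<in> carrier (mat_image R m G) \<Longrightarrow>
      h (\<lambda>i\<in>{..<m}. a \<otimes> x i) = (\<lambda>i\<in>{..<n}. a \<otimes> h x i)"
  shows "\<exists>P \<in> mats R n m.
    \<forall>x \<in> vecs R m. h (mat_vec R m m G x) = mat_vec R n m P x"
proof -
  have im: "mat_vec R m m G x \<in> carrier (mat_image R m G)" if "x \<in> vecs R m" for x
    using that by (simp add: carrier_mat_image)
  show ?thesis
  proof (rule linear_mat_vec_ex[of m "\<lambda>x. h (mat_vec R m m G x)" n])
    show "h (mat_vec R m m G x) \<in> vecs R n" if "x \<in> vecs R m" for x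
      by (rule closed[OF im[OF that]])
    show "h (mat_vec R m m G (\<lambda>i\<in>{..<m}. x i \<oplus> y i)) =
        (\<lambda>i\<in>{..<n}. h (mat_vec R m m G x) i \<oplus> h (mat_vec R m m G y) i)"
      if "x \<in> vecs R m" "y \<in> vecs R m" for x y
      unfolding mat_vec_add[OF G that] by (rule add[OF im im, OF that])
    show "h (mat_vec R m m G (\<lambda>i\<in>{..<m}. a \<otimes> x i)) = (\<lambda>i\<in>{..<n}. a \<otimes> h (mat_vec R m m G x) i)"
      if "a \<in> carrier R" "x \<in> vecs R m" for a x
      unfolding mat_vec_smult[OF G that(2,1)] by (rule smult[OF that(1) im[OF that(2)]])
  qed blast
qed

text \<open>
  The isomorphism and its inverse, composed with \<open>G\<close> and \<open>F\<close>, are given by matrices \<open>P\<close> and \<open>Q\<close> with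
  \<open>P Q = F\<close> and \<open>Q P = G\<close>, although the two matrices may differ in size. Sylvester's identity does
  the rest.
\<close>

lemma rank_coeff_iso:
  assumes G: "idem_mat R m G" and F: "idem_mat R n F"
    and iso: "modules_iso R (mat_image R m G) (mat_image R n F)"
  shows "rank_coeff R m G = rank_coeff R n F"
proof -
  note F' = idem_matD[OF F] and G' = idem_matD[OF G]
  let ?MG = "mat_image R m G" and ?MF = "mat_image R n F"
  obtain h g where hg: "mutually_inverse R ?MG ?MF h g" "mutually_inverse R ?MF ?MG g h"
    using iso mat_image_module[OF G'(1)] by (rule modules_isoE)
  note hM = mutually_inverseD(1)[OF hg(1)] and gh = mutually_inverseD(2)[OF hg(1)]
    and add = mutually_inverseD(3)[OF hg(1)] and smult = mutually_inverseD(4)[OF hg(1)]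
    and g = mutually_inverseD(1,2)[OF hg(2)]
    and gadd = mutually_inverseD(3)[OF hg(2)] and gsmult = mutually_inverseD(4)[OF hg(2)]
  obtain P where P: "P \<in> mats R n m"
    and hP: "\<And>x. x \<in> vecs R m \<Longrightarrow> h (mat_vec R m m G x) = mat_vec R n m P x"
    using linear_on_image_mat_vec_ex[OF G'(1) mat_image_idem(1)[OF F hM] add[unfolded add_mat_image]
        smult[unfolded smult_mat_image]] by blast
  obtain Q where Q: "Q \<in> mats R m n"
    and gQ: "\<And>x. x \<in> vecs R n \<Longrightarrow> g (mat_vec R n n F x) = mat_vec R m n Q x"
    using linear_on_image_mat_vec_ex[OF F'(1) mat_image_idem(1)[OF G g(1)] gadd[unfolded add_mat_image]
        gsmult[unfolded smult_mat_image]] by blast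
  let ?PQ = "\<lambda>i j. \<Oplus>l\<in>{..<m}. P i l \<otimes> Q l j" and ?QP = "\<lambda>i j. \<Oplus>l\<in>{..<n}. Q i l \<otimes> P l j"
  have PQ: "?PQ \<in> mats R n n" and QP: "?QP \<in> mats R m m"
    using P Q by (auto simp: Pi_iff intro!: finsum_closed)
  have imF: "mat_vec R n n F x \<in> carrier ?MF" if "x \<in> vecs R n" for x
    using that by (simp add: carrier_mat_image)
  have imG: "mat_vec R m m G x \<in> carrier ?MG" if "x \<in> vecs R m" for x
    using that by (simp add: carrier_mat_image)
  have "mat_vec R n n ?PQ x = mat_vec R n n F x" if x: "x \<in> vecs R n" for x
  proof -
    have "mat_vec R n n ?PQ x = h (mat_vec R m m G (g (mat_vec R n n F x)))"
      using mat_vec_mat_vec[OF P Q x] gQ[OF x] hP[of "mat_vec R m n Q x"] Q x by simp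
    also have "\<dots> = h (g (mat_vec R n n F x))"
      using mat_image_idem(2)[OF G g(1)[OF imF[OF x]]] by simp
    finally show ?thesis using g(2)[OF imF[OF x]] by simp
  qed
  then have PQF: "?PQ i j = F i j" if "i < n" "j < n" for i j
    using that by (rule mat_vec_inj[OF PQ F'(1)])
  have "mat_vec R m m ?QP x = mat_vec R m m G x" if x: "x \<in> vecs R m" for x
  proof -
    have "mat_vec R m m ?QP x = g (mat_vec R n n F (h (mat_vec R m m G x)))"
      using mat_vec_mat_vec[OF Q P x] hP[OF x] gQ[of "mat_vec R n m P x"] P x by simp
    also have "\<dots> = g (h (mat_vec R m m G x))"
      using mat_image_idem(2)[OF F hM[OF imG[OF x]]] by simp
    finally show ?thesis using gh[OF imG[OF x]] by simp
  qed
  then have QPG: "?QP i j = G i j" if "i < m" "j < m" for i j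
    using that by (rule mat_vec_inj[OF QP G'(1)])
  have "rank_coeff R m G = rank_coeff R m ?QP" using rank_coeff_cong[OF G'(1) QPG] by simp
  also have "\<dots> = rank_coeff R n ?PQ" by (rule rank_coeff_mult_commute[OF Q P])
  also have "\<dots> = rank_coeff R n F" by (rule rank_coeff_cong[OF F'(1) PQF])
  finally show ?thesis .
qed

lemma mat_vec_complement:
  assumes F: "F \<in> mats R n n" and x: "x \<in> vecs R n" and i: "i < n"
  shows "mat_vec R n n (\<lambda>i j. (if i = j then \<one> else \<zero>) \<oplus> (\<zero> \<ominus> \<one>) \<otimes> F i j) x i = x i \<ominus> mat_vec R n n F x i"
proof -
  have c: "F i j \<in> carrier R" "x j \<in> carrier R" if "j < n" for j
    using F x i that by (auto simp: Pi_iff PiE_iff)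
  have "(\<Oplus>j\<in>{..<n}. ((if i = j then \<one> else \<zero>) \<oplus> (\<zero> \<ominus> \<one>) \<otimes> F i j) \<otimes> x j) =
      (\<Oplus>j\<in>{..<n}. (if i = j then \<one> else \<zero>) \<otimes> x j \<oplus> (\<zero> \<ominus> \<one>) \<otimes> (F i j \<otimes> x j))"
    using c by (intro finsum_cong') (auto simp: l_distr m_assoc)
  also have "\<dots> = (\<Oplus>j\<in>{..<n}. (if i = j then \<one> else \<zero>) \<otimes> x j) \<oplus> (\<Oplus>j\<in>{..<n}. (\<zero> \<ominus> \<one>) \<otimes> (F i j \<otimes> x j))"
    using c by (intro finsum_addf) auto
  also have "(\<Oplus>j\<in>{..<n}. (if i = j then \<one> else \<zero>) \<otimes> x j) = x i"
    using fun_cong[OF mat_vec_one[OF x], of i] i by (simp add: mat_vec_def)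
  also have "(\<Oplus>j\<in>{..<n}. (\<zero> \<ominus> \<one>) \<otimes> (F i j \<otimes> x j)) = (\<zero> \<ominus> \<one>) \<otimes> (\<Oplus>j\<in>{..<n}. F i j \<otimes> x j)"
    using c by (intro finsum_rdistr[symmetric]) auto
  finally show ?thesis
    using i c by (simp add: mat_vec_def minus_eq l_minus)
qed

text \<open>
  The image of \<open>I - F\<close> is the kernel of \<open>F\<close>, the complement of the image of \<open>F\<close>.
\<close>

lemma idem_mat_complement:
  assumes F: "idem_mat R n F"
  shows "x \<in> vecs R n \<Longrightarrow>
    (\<lambda>i\<in>{..<n}. x i \<ominus> mat_vec R n n F x i) \<in>
      carrier (mat_image R n (\<lambda>i j. (if i = j then \<one> else \<zero>) \<oplus> (\<zero> \<ominus> \<one>) \<otimes> F i j))"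
  and "y \<in> carrier (mat_image R n (\<lambda>i j. (if i = j then \<one> else \<zero>) \<oplus> (\<zero> \<ominus> \<one>) \<otimes> F i j)) \<Longrightarrow>
    mat_vec R n n F y = (\<lambda>i\<in>{..<n}. \<zero>)"
proof -
  note F' = idem_matD[OF F]
  let ?C = "\<lambda>i j. (if i = j then \<one> else \<zero>) \<oplus> (\<zero> \<ominus> \<one>) \<otimes> F i j"
  have C: "mat_vec R n n ?C x = (\<lambda>i\<in>{..<n}. x i \<ominus> mat_vec R n n F x i)"
    if "x \<in> vecs R n" for x
  proof
    fix i
    show "mat_vec R n n ?C x i = (\<lambda>i\<in>{..<n}. x i \<ominus> mat_vec R n n F x i) i"
      using mat_vec_complement[OF F'(1) that, of i] by (cases "i < n") (auto simp: mat_vec_def)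
  qed
  show "(\<lambda>i\<in>{..<n}. x i \<ominus> mat_vec R n n F x i) \<in> carrier (mat_image R n ?C)"
    if "x \<in> vecs R n" for x
    unfolding C[OF that, symmetric] carrier_mat_image using that by (rule imageI)
  assume "y \<in> carrier (mat_image R n ?C)"
  then obtain x where x: "x \<in> vecs R n" and y: "y = mat_vec R n n ?C x"
    by (auto simp: carrier_mat_image)
  let ?Fx = "mat_vec R n n F x"
  have Fx: "?Fx \<in> vecs R n" using F' x by simp
  have nFx: "(\<lambda>i\<in>{..<n}. (\<ominus> \<one>) \<otimes> ?Fx i) \<in> vecs R n"
    by (rule restrict_PiE_iff[THEN iffD2]) (use Fx in \<open>auto simp: PiE_iff\<close>)
  have FFx: "mat_vec R n n F ?Fx = ?Fx"
    by (rule mat_image_idem[OF F]) (use x in \<open>auto simp: carrier_mat_image\<close>)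
  have "y = (\<lambda>i\<in>{..<n}. x i \<oplus> (\<lambda>i\<in>{..<n}. (\<ominus> \<one>) \<otimes> ?Fx i) i)"
    unfolding y C[OF x] using x Fx by (intro restrict_ext) (auto simp: PiE_iff minus_eq l_minus)
  then have "mat_vec R n n F y = (\<lambda>i\<in>{..<n}. ?Fx i \<oplus> (\<lambda>i\<in>{..<n}. (\<ominus> \<one>) \<otimes> ?Fx i) i)"
    using mat_vec_add[OF F'(1) x nFx] mat_vec_smult[OF F'(1) Fx, of "\<ominus> \<one>"] FFx by simp
  also have "\<dots> = (\<lambda>i\<in>{..<n}. \<zero>)"
    using Fx by (intro restrict_ext) (auto simp: PiE_iff l_minus r_neg)
  finally show "mat_vec R n n F y = (\<lambda>i\<in>{..<n}. \<zero>)" .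
qed

text \<open>
  The standard module is the direct sum of the images of \<open>F\<close> and of \<open>I - F\<close>.
\<close>

lemma mat_image_fg_projective:
  assumes F: "idem_mat R n F"
  shows "fg_projective R (mat_image R n F)"
proof -
  note F' = idem_matD[OF F]
  let ?C = "\<lambda>i j. (if i = j then \<one> else \<zero>) \<oplus> (\<zero> \<ominus> \<one>) \<otimes> F i j"
  let ?U = "carrier (mat_image R n F)" and ?V = "carrier (mat_image R n ?C)"
  let ?S = "std_module R n"
  interpret S: Module.module R ?S by (rule std_module_module)
  have C: "?C \<in> mats R n n" using F' by (auto simp: Pi_iff)
  have U: "submodule ?U R ?S" and V: "submodule ?V R ?S"
    using mat_image_submodule[OF F'(1)] mat_image_submodule[OF C] .
  note subU = S.submoduleE(1)[OF U] and subV = S.submoduleE(1)[OF V]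
  have "?U <+>\<^bsub>?S\<^esub> ?V = carrier ?S"
  proof
    show "?U <+>\<^bsub>?S\<^esub> ?V \<subseteq> carrier ?S"
    proof
      fix z assume "z \<in> ?U <+>\<^bsub>?S\<^esub> ?V"
      then obtain u v where "u \<in> ?U" "v \<in> ?V" "z = u \<oplus>\<^bsub>?S\<^esub> v"
        unfolding set_add_def set_mult_def by auto
      then show "z \<in> carrier ?S" using subU subV S.a_closed by blast
    qed
    show "carrier ?S \<subseteq> ?U <+>\<^bsub>?S\<^esub> ?V"
    proof
      fix x assume "x \<in> carrier ?S"
      then have x: "x \<in> vecs R n" by simp
      let ?u = "mat_vec R n n F x" and ?v = "\<lambda>i\<in>{..<n}. x i \<ominus> mat_vec R n n F x i"
      have u: "?u \<in> vecs R n" using x F' by simp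
      have "x i = (?u \<oplus>\<^bsub>?S\<^esub> ?v) i" for i
      proof (cases "i < n")
        case True
        then have "x i \<in> carrier R" "?u i \<in> carrier R" using x u by (auto simp: PiE_iff)
        then have "x i = ?u i \<oplus> (x i \<ominus> ?u i)" by algebra
        then show ?thesis using True by simp
      next
        case False
        then show ?thesis using x by (auto simp: PiE_iff extensional_def)
      qed
      then have "x = ?u \<oplus>\<^bsub>?S\<^esub> ?v" by (rule ext)
      moreover have "?u \<in> ?U" using x by (auto simp: carrier_mat_image)
      moreover have "?v \<in> ?V" by (rule idem_mat_complement(1)[OF F x])
      ultimately show "x \<in> ?U <+>\<^bsub>?S\<^esub> ?V"
        by (auto simp: set_add_def set_mult_def simp del: add_std_module)
    qed
  qed
  moreover have "?U \<inter> ?V = {\<zero>\<^bsub>?S\<^esub>}"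
  proof
    show "?U \<inter> ?V \<subseteq> {\<zero>\<^bsub>?S\<^esub>}"
    proof
      fix x assume "x \<in> ?U \<inter> ?V"
      then have "mat_vec R n n F x = x" "mat_vec R n n F x = \<zero>\<^bsub>?S\<^esub>"
        using mat_image_idem(2)[OF F, of x] idem_mat_complement(2)[OF F, of x] by auto
      then show "x \<in> {\<zero>\<^bsub>?S\<^esub>}" by simp
    qed
    show "{\<zero>\<^bsub>?S\<^esub>} \<subseteq> ?U \<inter> ?V"
      using subgroup.one_closed[OF submodule.axioms(1)[OF U]] subgroup.one_closed[OF submodule.axioms(1)[OF V]] by simp
  qed
  moreover have "modules_iso R (mat_image R n F) (?S\<lparr>carrier := ?U\<rparr>)"
    unfolding mat_image_eq[symmetric] modules_iso_def by (intro exI[of _ id]) auto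
  ultimately show ?thesis
    unfolding fg_projective_def using U V mat_image_module[OF F'(1)] by blast
qed

lemma char_poly_on_rank:
  assumes F: "F \<in> mats R n n" and k: "k \<le> n"
    and r: "\<And>j. rank_coeff R n F j = (if j = k then \<one> else \<zero>)"
  shows "char_poly_on R n F = (UP_X R \<ominus>\<^bsub>UP R\<^esub> \<one>\<^bsub>UP R\<^esub>) [^]\<^bsub>UP R\<^esub> k \<otimes>\<^bsub>UP R\<^esub> UP_X R [^]\<^bsub>UP R\<^esub> (n - k)"
proof -
  interpret UP: UP_cring R "UP R" by (rule UP_cring_UP)
  let ?t = "\<lambda>j. (UP_X R \<ominus>\<^bsub>UP R\<^esub> \<one>\<^bsub>UP R\<^esub>) [^]\<^bsub>UP R\<^esub> j \<otimes>\<^bsub>UP R\<^esub> UP_X R [^]\<^bsub>UP R\<^esub> (n - j)"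
  have t: "?t j \<in> carrier (UP R)" for j by simp
  have "char_poly_on R n F = (\<Oplus>\<^bsub>UP R\<^esub>j\<in>{..n}. if k = j then ?t j else \<zero>\<^bsub>UP R\<^esub>)"
    unfolding char_poly_on_eq[OF F] by (intro UP.P.finsum_cong') (auto simp: r UP.P.m_assoc)
  also have "\<dots> = ?t k" using k t by (intro UP.P.finsum_singleton) auto
  finally show ?thesis .
qed

text \<open>
  An idempotent matrix with isomorphic image has the same coefficients, hence the required
  characteristic polynomial, without any nilpotent deviation. Its size is at least \<open>k\<close> because the
  coefficients beyond the size vanish, whereas the one at \<open>k\<close> is \<open>1\<close>.
\<close>

lemma mat_image_projective_of_rank:
  assumes F: "idem_mat R n F" and r: "\<And>j. rank_coeff R n F j = (if j = k then \<one> else \<zero>)"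
  shows "projective_of_rank R (mat_image R n F) k"
  unfolding projective_of_rank_def
proof (intro conjI impI allI)
  show "fg_projective R (mat_image R n F)" by (rule mat_image_fg_projective[OF F])
next
  fix m G
  assume nontriv: "\<one> \<noteq> \<zero>" and "idem_mat R m G \<and> modules_iso R (mat_image R m G) (mat_image R n F)"
  then have G: "idem_mat R m G" and rG: "rank_coeff R m G j = (if j = k then \<one> else \<zero>)" for j
    using rank_coeff_iso[OF _ F] r by auto
  note G' = idem_matD(1)[OF G]
  show k: "k \<le> m"
    using rG[of k] rank_coeff_above[OF G', of k] nontriv by (auto simp: not_le[symmetric])
  interpret UP: UP_cring R "UP R" by (rule UP_cring_UP)
  have "coeff (UP R) (char_poly_on R m G) i \<in> carrier R" for i
    unfolding char_poly_on_rank[OF G' k rG] by (intro UP.coeff_closed) simp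
  then have "(coeff (UP R) (char_poly_on R m G) i \<ominus> coeff (UP R) (char_poly_on R m G) i) [^] (1::nat) = \<zero>" for i
    by (simp add: minus_eq r_neg)
  then show "eq_mod_nilpotents R (char_poly_on R m G)
      ((UP_X R \<ominus>\<^bsub>UP R\<^esub> \<one>\<^bsub>UP R\<^esub>) [^]\<^bsub>UP R\<^esub> k \<otimes>\<^bsub>UP R\<^esub> UP_X R [^]\<^bsub>UP R\<^esub> (m - k))"
    unfolding eq_mod_nilpotents_def char_poly_on_rank[OF G' k rG, symmetric] by blast
qed

end


section \<open>Local freeness at an invertible minor\<close>

lemma (in ring_hom_cring) hom_mat_mult:
  assumes "A \<in> mats R n k" "B \<in> mats R k m" "i < n" "j < m"
  shows "h (\<Oplus>l\<in>{..<k}. A i l \<otimes> B l j) = (\<Oplus>\<^bsub>S\<^esub>l\<in>{..<k}. h (A i l) \<otimes>\<^bsub>S\<^esub> h (B l j))"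
  using assms by (subst hom_finsum) (auto simp: Pi_iff intro!: S.finsum_cong')

context cring
begin

lemma mat_mult_assoc:
  fixes n m k p i j :: nat
  assumes P: "P \<in> mats R n m" and Q: "Q \<in> mats R m k"
    and T: "T \<in> mats R k p" and ij: "i < n" "j < p"
  shows "(\<Oplus>l\<in>{..<m}. P i l \<otimes> (\<Oplus>a\<in>{..<k}. Q l a \<otimes> T a j)) = (\<Oplus>a\<in>{..<k}. (\<Oplus>l\<in>{..<m}. P i l \<otimes> Q l a) \<otimes> T a j)"
proof -
  let ?x = "\<lambda>a\<in>{..<k}. T a j"
  have x: "?x \<in> vecs R k"
    by (rule restrict_PiE_iff[THEN iffD2]) (use T ij in \<open>auto simp: Pi_iff\<close>)
  have c: "P i l \<in> carrier R" "Q l a \<in> carrier R" "T a j \<in> carrier R" if "l < m" "a < k" for l a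
    using that P Q T ij by (auto simp: Pi_iff)
  have c': "P i l \<in> carrier R" if "l < m" for l using that P ij by (auto simp: Pi_iff)
  have "(\<Oplus>l\<in>{..<m}. P i l \<otimes> (\<Oplus>a\<in>{..<k}. Q l a \<otimes> T a j)) = mat_vec R n m P (mat_vec R m k Q ?x) i"
    unfolding mat_vec_def using ij c c'
    by (simp, intro finsum_cong' refl)
       (auto intro!: finsum_closed arg_cong[of _ _ "\<lambda>y. _ \<otimes> y"] finsum_cong')
  also have "\<dots> = mat_vec R n k (\<lambda>i j. \<Oplus>l\<in>{..<m}. P i l \<otimes> Q l j) ?x i"
    by (simp only: mat_vec_mat_vec[OF P Q x])
  also have "\<dots> = (\<Oplus>a\<in>{..<k}. (\<Oplus>l\<in>{..<m}. P i l \<otimes> Q l a) \<otimes> T a j)"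
    unfolding mat_vec_def using ij c T
    by (simp, intro finsum_cong') (auto simp: Pi_iff intro!: finsum_closed m_closed)
  finally show ?thesis .
qed

lemma mat_vec_zero:
  "P \<in> mats R n m \<Longrightarrow> mat_vec R n m P (\<lambda>i\<in>{..<m}. \<zero>) = (\<lambda>i\<in>{..<n}. \<zero>)"
  unfolding mat_vec_def by (intro restrict_ext add.finprod_one_eqI) (auto simp: Pi_iff)

lemma mat_vec_minus:
  assumes P: "P \<in> mats R n m"
    and x: "x \<in> vecs R m" and y: "y \<in> vecs R m"
  shows "mat_vec R n m P (\<lambda>i\<in>{..<m}. x i \<ominus> y i) = (\<lambda>i\<in>{..<n}. mat_vec R n m P x i \<ominus> mat_vec R n m P y i)"
proof -
  let ?z = "\<lambda>i\<in>{..<m}. (\<ominus> \<one>) \<otimes> y i"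
  have z: "?z \<in> vecs R m"
    by (rule restrict_PiE_iff[THEN iffD2]) (use y in \<open>auto simp: PiE_iff\<close>)
  have "(\<lambda>i\<in>{..<m}. x i \<ominus> y i) = (\<lambda>i\<in>{..<m}. x i \<oplus> ?z i)"
    using x y by (intro restrict_ext) (auto simp: PiE_iff minus_eq l_minus)
  then have "mat_vec R n m P (\<lambda>i\<in>{..<m}. x i \<ominus> y i) =
      (\<lambda>i\<in>{..<n}. mat_vec R n m P x i \<oplus> mat_vec R n m P ?z i)"
    by (simp only: mat_vec_add[OF P x z])
  also have "mat_vec R n m P ?z = (\<lambda>i\<in>{..<n}. (\<ominus> \<one>) \<otimes> mat_vec R n m P y i)"
    by (rule mat_vec_smult[OF P y]) simp
  also have "(\<lambda>i\<in>{..<n}. mat_vec R n m P x i \<oplus> (\<lambda>i\<in>{..<n}. (\<ominus> \<one>) \<otimes> mat_vec R n m P y i) i) =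
      (\<lambda>i\<in>{..<n}. mat_vec R n m P x i \<ominus> mat_vec R n m P y i)"
    using mat_vec_closed[OF P y] by (intro restrict_ext) (auto simp: PiE_iff minus_eq l_minus)
  finally show ?thesis .
qed

lemma mat_vec_minus_left:
  assumes P: "P \<in> mats R n m" and Q: "Q \<in> mats R n m"
    and x: "x \<in> vecs R m" and i: "i < n"
  shows "mat_vec R n m (\<lambda>i j. P i j \<ominus> Q i j) x i = mat_vec R n m P x i \<ominus> mat_vec R n m Q x i"
proof -
  have c: "P i j \<in> carrier R" "Q i j \<in> carrier R" "x j \<in> carrier R" if "j < m" for j
    using that i P Q x by (auto simp: Pi_iff PiE_iff)
  have "(\<Oplus>j\<in>{..<m}. (P i j \<ominus> Q i j) \<otimes> x j) = (\<Oplus>j\<in>{..<m}. P i j \<otimes> x j \<oplus> (\<ominus> \<one>) \<otimes> (Q i j \<otimes> x j))"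
    using c by (intro finsum_cong') (auto simp: minus_eq l_distr l_minus)
  also have "\<dots> = (\<Oplus>j\<in>{..<m}. P i j \<otimes> x j) \<oplus> (\<Oplus>j\<in>{..<m}. (\<ominus> \<one>) \<otimes> (Q i j \<otimes> x j))"
    using c by (intro finsum_addf) auto
  also have "(\<Oplus>j\<in>{..<m}. (\<ominus> \<one>) \<otimes> (Q i j \<otimes> x j)) = (\<ominus> \<one>) \<otimes> (\<Oplus>j\<in>{..<m}. Q i j \<otimes> x j)"
    using c by (intro finsum_rdistr[symmetric]) auto
  finally show ?thesis
    using i c by (simp add: mat_vec_def minus_eq l_minus)
qed

text \<open>
  The zero matrix in \<open>det_scalar_plus\<close> leaves \<open>v^k\<close> times the sum of its coefficients, which is \<open>1\<close>.
\<close>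

lemma det_scalar:
  assumes v: "v \<in> carrier R"
  shows "det_on R {..<k} (\<lambda>i j. if i = j then v else \<zero>) = v [^] k"
proof -
  let ?Z = "\<lambda>i j::nat. \<zero>"
  have r: "rank_coeff R k ?Z j \<in> carrier R" for j by simp
  have "det_on R {..<k} (\<lambda>i j. if i = j then v else \<zero>) =
      det_on R {..<k} (\<lambda>i j. (if i = j then v else \<zero>) \<oplus> \<zero> \<otimes> ?Z i j)"
    using v by (intro det_on_cong) auto
  also have "\<dots> = (\<Oplus>j\<in>{..k}. rank_coeff R k ?Z j \<otimes> (v \<oplus> \<zero>) [^] j \<otimes> v [^] (k - j))"
    using v by (intro det_scalar_plus) auto
  also have "\<dots> = (\<Oplus>j\<in>{..k}. rank_coeff R k ?Z j \<otimes> v [^] k)"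
    using v r by (intro finsum_cong') (auto simp: m_assoc nat_pow_mult)
  also have "\<dots> = (\<Oplus>j\<in>{..k}. rank_coeff R k ?Z j) \<otimes> v [^] k"
    using v r by (intro finsum_ldistr[symmetric]) auto
  finally show ?thesis using sum_rank_coeff[of ?Z k] v by simp
qed

text \<open>
  With \<open>W = U V\<close>, the conditions give \<open>W Q = 0\<close>, so that \<open>I + (v - 1) F\<close> is the product of
  \<open>I + (v - 1) W\<close> and \<open>I + (v - 1) Q\<close>. Sylvester's identity turns the first factor into the scalar
  matrix \<open>v\<close> of size \<open>k\<close>.
\<close>

lemma det_one_plus_split:
  fixes n k :: nat
  assumes U: "U \<in> mats R n k" and V: "V \<in> mats R k n"
    and Q: "Q \<in> mats R n n" and v: "v \<in> carrier R"
    and VU: "\<And>a b. a < k \<Longrightarrow> b < k \<Longrightarrow> (\<Oplus>l\<in>{..<n}. V a l \<otimes> U l b) = (if a = b then \<one> else \<zero>)"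
    and VQ: "\<And>a j. a < k \<Longrightarrow> j < n \<Longrightarrow> (\<Oplus>l\<in>{..<n}. V a l \<otimes> Q l j) = \<zero>"
    and F: "\<And>i j. i < n \<Longrightarrow> j < n \<Longrightarrow> F i j = (\<Oplus>a\<in>{..<k}. U i a \<otimes> V a j) \<oplus> Q i j"
  shows "det_one_plus R n (v \<ominus> \<one>) F = v [^] k \<otimes> det_one_plus R n (v \<ominus> \<one>) Q"
proof -
  let ?W = "\<lambda>i j. \<Oplus>a\<in>{..<k}. U i a \<otimes> V a j" and ?u = "v \<ominus> \<one>"
  have u: "?u \<in> carrier R" using v by simp
  have W: "?W \<in> mats R n n" using U V by (auto simp: Pi_iff intro!: finsum_closed)
  have WQ: "(\<Oplus>l\<in>{..<n}. ?W i l \<otimes> Q l j) = \<zero>" if "i < n" "j < n" for i j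
  proof -
    have "(\<Oplus>l\<in>{..<n}. ?W i l \<otimes> Q l j) = (\<Oplus>a\<in>{..<k}. U i a \<otimes> (\<Oplus>l\<in>{..<n}. V a l \<otimes> Q l j))"
      by (rule mat_mult_assoc[OF U V Q that, symmetric])
    also have "\<dots> = \<zero>"
      using U that by (intro add.finprod_one_eqI) (auto simp: VQ Pi_iff)
    finally show ?thesis .
  qed
  have "det_one_plus R n ?u ?W =
      det_on R {..<k} (\<lambda>i j. (if i = j then \<one> else \<zero>) \<oplus> ?u \<otimes> (\<Oplus>l\<in>{..<n}. V i l \<otimes> U l j))"
    unfolding det_one_plus_def by (rule det_one_plus_mult_commute[OF U V u])
  also have "\<dots> = det_on R {..<k} (\<lambda>i j. if i = j then v else \<zero>)"
    using v by (intro det_on_cong) (auto simp: VU minus_eq a_lcomm r_neg)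
  also have "\<dots> = v [^] k" by (rule det_scalar[OF v])
  finally have "v [^] k \<otimes> det_one_plus R n ?u Q = det_one_plus R n ?u ?W \<otimes> det_one_plus R n ?u Q" by simp
  also have "\<dots> = det_on R {..<n} (\<lambda>i j. (if i = j then \<one> else \<zero>) \<oplus>
      (?u \<otimes> ?W i j \<oplus> (?u \<otimes> Q i j \<oplus> ?u \<otimes> ?u \<otimes> (\<Oplus>l\<in>{..<n}. ?W i l \<otimes> Q l j))))"
    unfolding det_one_plus_def by (rule det_one_plus_mult[OF W Q u u])
  also have "\<dots> = det_one_plus R n ?u F"
    unfolding det_one_plus_def
  proof (rule det_on_cong)
    fix i j assume ij: "i \<in> {..<n}" "j \<in> {..<n}"
    then have "?W i j \<in> carrier R" "Q i j \<in> carrier R" using W Q by (auto simp: Pi_iff)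
    then show "(if i = j then \<one> else \<zero>) \<oplus>
        (?u \<otimes> ?W i j \<oplus> (?u \<otimes> Q i j \<oplus> ?u \<otimes> ?u \<otimes> (\<Oplus>l\<in>{..<n}. ?W i l \<otimes> Q l j))) =
        (if i = j then \<one> else \<zero>) \<oplus> ?u \<otimes> F i j"
      "(if i = j then \<one> else \<zero>) \<oplus> ?u \<otimes> F i j \<in> carrier R"
      using ij u by (auto simp: WQ F r_distr)
  qed
  finally show ?thesis by simp
qed

text \<open>
  A fixed vector lies in the kernel of \<open>I - Q\<close>, which is invertible by its adjugate.
\<close>

lemma mat_vec_fixed_zero:
  assumes Q: "Q \<in> mats R n n" and det: "det_one_plus R n (\<zero> \<ominus> \<one>) Q = \<one>"
    and z: "z \<in> vecs R n" "mat_vec R n n Q z = z"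
  shows "z = (\<lambda>i\<in>{..<n}. \<zero>)"
proof -
  let ?C = "\<lambda>i j. (if i = j then \<one> else \<zero>) \<oplus> (\<zero> \<ominus> \<one>) \<otimes> Q i j"
  have C: "?C \<in> mats R n n" using Q by (auto simp: Pi_iff)
  obtain H where H: "\<And>i j. H i j \<in> carrier R"
    and HC: "\<And>i j. i \<in> {..<n} \<Longrightarrow> j \<in> {..<n} \<Longrightarrow>
      (\<Oplus>l\<in>{..<n}. H i l \<otimes> ?C l j) = (if i = j then det_on R {..<n} ?C else \<zero>)"
    using adjugate_ex[OF C order_refl] by blast
  have H': "H \<in> mats R n n" using H by simp
  have Cz: "mat_vec R n n ?C z = (\<lambda>i\<in>{..<n}. \<zero>)"
  proof
    fix i
    show "mat_vec R n n ?C z i = (\<lambda>i\<in>{..<n}. \<zero>) i"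
    proof (cases "i < n")
      case True
      then have "mat_vec R n n ?C z i = z i \<ominus> z i"
        using mat_vec_complement[OF Q z(1)] z(2) by simp
      then show ?thesis using True z(1) by (auto simp: PiE_iff minus_eq r_neg)
    qed (simp add: mat_vec_def)
  qed
  have "z = mat_vec R n n (\<lambda>i j. if i = j then \<one> else \<zero>) z"
    by (rule mat_vec_one[OF z(1), symmetric])
  also have "\<dots> = mat_vec R n n (\<lambda>i j. \<Oplus>l\<in>{..<n}. H i l \<otimes> ?C l j) z"
    using z(1) det HC unfolding det_one_plus_def
    by (intro mat_vec_cong[symmetric]) auto
  also have "\<dots> = mat_vec R n n H (mat_vec R n n ?C z)"
    by (rule mat_vec_mat_vec[OF H' C z(1), symmetric])
  finally show ?thesis unfolding Cz mat_vec_zero[OF H'] .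
qed

text \<open>
  The matrices \<open>V\<close> and \<open>U\<close> are mutually inverse isomorphisms between the image of \<open>F\<close> and the standard
  module. The nontrivial half is that \<open>V\<close> is injective on the image. A vector of the image killed by
  \<open>V\<close> is fixed by \<open>Q = F - U V\<close>, and \<open>det (I - Q) = 1\<close> because \<open>r = \<delta>_k\<close> makes
  \<open>det (I + (X - 1) F)\<close> equal to \<open>X^k\<close>, which \<open>det_one_plus_split\<close> divides by \<open>X^k\<close>.
\<close>

lemma mat_image_free:
  assumes F: "idem_mat R n F" and r: "\<And>j. rank_coeff R n F j = (if j = k then \<one> else \<zero>)"
    and U: "U \<in> mats R n k" and V: "V \<in> mats R k n"
    and VU: "\<And>a b. a < k \<Longrightarrow> b < k \<Longrightarrow> (\<Oplus>l\<in>{..<n}. V a l \<otimes> U l b) = (if a = b then \<one> else \<zero>)"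
    and VF: "\<And>a j. a < k \<Longrightarrow> j < n \<Longrightarrow> (\<Oplus>l\<in>{..<n}. V a l \<otimes> F l j) = V a j"
    and FU: "\<And>i a. i < n \<Longrightarrow> a < k \<Longrightarrow> (\<Oplus>l\<in>{..<n}. F i l \<otimes> U l a) = U i a"
  shows "modules_iso R (mat_image R n F) (std_module R k)"
proof -
  note F' = idem_matD[OF F]
  let ?W = "\<lambda>i j. \<Oplus>a\<in>{..<k}. U i a \<otimes> V a j"
  have W: "?W \<in> mats R n n" using U V by (auto simp: Pi_iff intro!: finsum_closed)
  define Q where "Q i j = F i j \<ominus> ?W i j" for i j
  have Q: "Q \<in> mats R n n" unfolding Q_def using F'(1) W by (auto simp: Pi_iff)
  have FWQ: "F i j = ?W i j \<oplus> Q i j" if "i < n" "j < n" for i j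
  proof -
    have "x = y \<oplus> (x \<ominus> y)" if "x \<in> carrier R" "y \<in> carrier R" for x y
      using that by algebra
    then show ?thesis unfolding Q_def using that F'(1) W by (auto simp: Pi_iff)
  qed
  have VW: "(\<Oplus>l\<in>{..<n}. V a l \<otimes> ?W l j) = V a j" if "a < k" "j < n" for a j
  proof -
    have "(\<Oplus>l\<in>{..<n}. V a l \<otimes> ?W l j) = (\<Oplus>b\<in>{..<k}. (\<Oplus>l\<in>{..<n}. V a l \<otimes> U l b) \<otimes> V b j)"
      by (rule mat_mult_assoc[OF V U V that])
    also have "\<dots> = (\<Oplus>b\<in>{..<k}. if a = b then V b j else \<zero>)"
      using that V by (intro finsum_cong') (auto simp: VU Pi_iff)
    also have "\<dots> = V a j" using that V by (intro finsum_singleton) (auto simp: Pi_iff)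
    finally show ?thesis .
  qed
  have VQ: "(\<Oplus>l\<in>{..<n}. V a l \<otimes> Q l j) = \<zero>" if aj: "a < k" "j < n" for a j
  proof -
    have c: "V a l \<in> carrier R" "?W l j \<in> carrier R" "Q l j \<in> carrier R" if "l < n" for l
      using that aj V W Q by (auto simp: Pi_iff)
    have "V a j = (\<Oplus>l\<in>{..<n}. V a l \<otimes> F l j)" by (rule VF[OF aj, symmetric])
    also have "\<dots> = (\<Oplus>l\<in>{..<n}. V a l \<otimes> ?W l j \<oplus> V a l \<otimes> Q l j)"
      using c aj by (intro finsum_cong') (auto simp: FWQ r_distr)
    also have "\<dots> = (\<Oplus>l\<in>{..<n}. V a l \<otimes> ?W l j) \<oplus> (\<Oplus>l\<in>{..<n}. V a l \<otimes> Q l j)"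
      using c by (intro finsum_addf) auto
    finally have *: "V a j = V a j \<oplus> (\<Oplus>l\<in>{..<n}. V a l \<otimes> Q l j)" unfolding VW[OF aj] .
    have cancel: "y = \<zero>" if "x = x \<oplus> y" "x \<in> carrier R" "y \<in> carrier R" for x y
      using that r_neg1[of x y] l_neg[of x] by simp
    show ?thesis
    proof (rule cancel[OF *])
      show "V a j \<in> carrier R" using V aj by (auto simp: Pi_iff)
      show "(\<Oplus>l\<in>{..<n}. V a l \<otimes> Q l j) \<in> carrier R" using c by (intro finsum_closed) auto
    qed
  qed
  \<comment> \<open>The constant coefficient of \<open>det (I + (X - 1) Q)\<close> is its value at zero, \<open>det (I - Q)\<close>.\<close>
  have detQ: "det_one_plus R n (\<zero> \<ominus> \<one>) Q = \<one>"
  proof -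
    interpret UP: UP_cring R "UP R" by (rule UP_cring_UP)
    interpret c: ring_hom_cring R "UP R" "UP_const R" by (rule UP.const_hom)
    let ?c = "UP_const R" and ?D = "det_one_plus (UP R) n (UP_X R \<ominus>\<^bsub>UP R\<^esub> \<one>\<^bsub>UP R\<^esub>)"
    have cU: "(\<lambda>i a. ?c (U i a)) \<in> mats (UP R) n k"
      and cV: "(\<lambda>a i. ?c (V a i)) \<in> mats (UP R) k n"
      and cQ: "(\<lambda>i j. ?c (Q i j)) \<in> mats (UP R) n n"
      using U V Q by (auto simp: Pi_iff)
    have D: "?D (\<lambda>i j. ?c (F i j)) = UP_X R [^]\<^bsub>UP R\<^esub> k \<otimes>\<^bsub>UP R\<^esub> ?D (\<lambda>i j. ?c (Q i j))"
    proof (rule UP.P.det_one_plus_split[OF cU cV cQ])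
      show "UP_X R \<in> carrier (UP R)" by simp
      show "(\<Oplus>\<^bsub>UP R\<^esub>l\<in>{..<n}. ?c (V a l) \<otimes>\<^bsub>UP R\<^esub> ?c (U l b)) = (if a = b then \<one>\<^bsub>UP R\<^esub> else \<zero>\<^bsub>UP R\<^esub>)"
        if "a < k" "b < k" for a b
        using c.hom_mat_mult[OF V U that] VU[OF that] by (cases "a = b") simp_all
      show "(\<Oplus>\<^bsub>UP R\<^esub>l\<in>{..<n}. ?c (V a l) \<otimes>\<^bsub>UP R\<^esub> ?c (Q l j)) = \<zero>\<^bsub>UP R\<^esub>" if "a < k" "j < n" for a j
        using c.hom_mat_mult[OF V Q that] VQ[OF that] by simp
      show "?c (F i j) = (\<Oplus>\<^bsub>UP R\<^esub>a\<in>{..<k}. ?c (U i a) \<otimes>\<^bsub>UP R\<^esub> ?c (V a j)) \<oplus>\<^bsub>UP R\<^esub> ?c (Q i j)"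
        if "i < n" "j < n" for i j
        using c.hom_mat_mult[OF U V that] FWQ[OF that] that W Q by (simp add: Pi_iff)
    qed
    have "\<one> = coeff (UP R) (?D (\<lambda>i j. ?c (F i j))) (0 + k)"
      using UP.coeff_det_one_plus[OF F'(1), of k] r by simp
    also have "\<dots> = coeff (UP R) (monom (UP R) \<one> k \<otimes>\<^bsub>UP R\<^esub> ?D (\<lambda>i j. ?c (Q i j))) (0 + k)"
      unfolding D by (simp add: UP.monom_pow)
    also have "\<dots> = \<one> \<otimes> coeff (UP R) (?D (\<lambda>i j. ?c (Q i j))) 0"
      using cQ by (intro UP.coeff_monom_mult) (auto intro!: UP.P.det_one_plus_closed)
    also have "\<dots> = rank_coeff R n Q 0"
      using UP.coeff_det_one_plus[OF Q, of 0] rank_coeff_closed[OF Q, of 0] by simp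
    finally have r0: "rank_coeff R n Q 0 = \<one>" by simp
    have "det_one_plus R n (\<zero> \<ominus> \<one>) Q = (\<Oplus>j\<in>{..n}. rank_coeff R n Q j \<otimes> \<zero> [^] j)"
      by (rule det_one_plus_eq[OF Q]) simp
    also have "\<dots> = (\<Oplus>j\<in>{..n}. if 0 = j then rank_coeff R n Q j else \<zero>)"
      using Q by (intro finsum_cong') (auto simp: nat_pow_zero)
    also have "\<dots> = \<one>" using Q r0 by (subst finsum_singleton) auto
    finally show ?thesis .
  qed
  have kernel: "z = (\<lambda>i\<in>{..<n}. \<zero>)"
    if z: "z \<in> vecs R n" "mat_vec R n n F z = z" "mat_vec R k n V z = (\<lambda>a\<in>{..<k}. \<zero>)" for z
  proof (rule mat_vec_fixed_zero[OF Q detQ z(1)])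
    have "mat_vec R n n ?W z = (\<lambda>i\<in>{..<n}. \<zero>)"
      using mat_vec_mat_vec[OF U V z(1)] mat_vec_zero[OF U] z(3) by simp
    then have "mat_vec R n n Q z i = z i" if "i < n" for i
      unfolding Q_def using mat_vec_minus_left[OF F'(1) W z(1) that] that z by (auto simp: PiE_iff minus_eq)
    then show "mat_vec R n n Q z = z"
      using z(1) by (auto simp: fun_eq_iff mat_vec_def PiE_iff extensional_def)
  qed
  let ?f = "mat_vec R k n V" and ?g = "mat_vec R n k U" and ?M = "mat_image R n F"
  have M: "x \<in> vecs R n" "mat_vec R n n F x = x" if "x \<in> carrier ?M" for x
    using mat_image_idem[OF F that] .
  have f: "?f x \<in> vecs R k" if "x \<in> vecs R n" for x
    using V that by simp
  have Fg: "mat_vec R n n F (?g y) = ?g y" if "y \<in> vecs R k" for y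
    unfolding mat_vec_mat_vec[OF F'(1) U that] using U that FU by (intro mat_vec_cong) auto
  have g: "?g y \<in> vecs R n" if "y \<in> vecs R k" for y
    using U that by simp
  have fg: "?f (?g y) = y" if "y \<in> vecs R k" for y
  proof -
    have "?f (?g y) = mat_vec R k k (\<lambda>i j. if i = j then \<one> else \<zero>) y"
      unfolding mat_vec_mat_vec[OF V U that] using that VU by (intro mat_vec_cong) auto
    then show ?thesis using mat_vec_one[OF that] by simp
  qed
  have gf: "?g (?f x) = x" if x: "x \<in> carrier ?M" for x
  proof -
    let ?z = "\<lambda>i\<in>{..<n}. x i \<ominus> ?g (?f x) i"
    note x' = M[OF x] and gfx = g[OF f[OF M(1)[OF x]]]
    have zero: "?z = (\<lambda>i\<in>{..<n}. \<zero>)"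
    proof (rule kernel)
      show "?z \<in> vecs R n"
        by (rule restrict_PiE_iff[THEN iffD2]) (use x'(1) gfx in \<open>auto simp: PiE_iff\<close>)
      show "mat_vec R n n F ?z = ?z"
        unfolding mat_vec_minus[OF F'(1) x'(1) gfx] x'(2) Fg[OF f[OF x'(1)]] ..
      show "?f ?z = (\<lambda>a\<in>{..<k}. \<zero>)"
        unfolding mat_vec_minus[OF V x'(1) gfx] fg[OF f[OF x'(1)]]
        using f[OF x'(1)] by (intro restrict_ext) (auto simp: PiE_iff minus_eq r_neg)
    qed
    have z: "x i \<ominus> ?g (?f x) i = \<zero>" if "i < n" for i
      using fun_cong[OF zero, of i] that by (simp only: restrict_apply' lessThan_iff)
    show ?thesis
    proof
      fix i
      show "?g (?f x) i = x i"
      proof (cases "i < n")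
        case True
        then show ?thesis using z[OF True] x'(1) gfx by (auto simp: PiE_iff minus_eq dest!: minus_equality)
      next
        case False
        then show ?thesis using x'(1) by (auto simp: mat_vec_def PiE_iff extensional_def)
      qed
    qed
  qed
  show ?thesis
    unfolding modules_iso_def
  proof (intro exI[of _ ?f] conjI ballI)
    show "bij_betw ?f (carrier ?M) (carrier (std_module R k))"
    proof (rule bij_betw_byWitness[where f' = ?g])
      show "?f ` carrier ?M \<subseteq> carrier (std_module R k)" using f M(1) by auto
      show "?g ` carrier (std_module R k) \<subseteq> carrier ?M"
        using mat_image_idemI[OF g Fg] by auto
    qed (use gf fg in auto)
  next
    fix x y assume "x \<in> carrier ?M" "y \<in> carrier ?M"
    then show "?f (x \<oplus>\<^bsub>?M\<^esub> y) = ?f x \<oplus>\<^bsub>std_module R k\<^esub> ?f y"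
      using mat_vec_add[OF V M(1) M(1)] by simp
  next
    fix a x assume "a \<in> carrier R" "x \<in> carrier ?M"
    then show "?f (a \<odot>\<^bsub>?M\<^esub> x) = a \<odot>\<^bsub>std_module R k\<^esub> ?f x"
      using mat_vec_smult[OF V M(1)] by simp
  qed
qed

text \<open>
  \<open>U\<close> consists of the columns of \<open>F\<close> in \<open>I\<close>, and \<open>Z\<close> of the rows in \<open>I\<close>. With \<open>T\<close> the inverse of the
  block of \<open>F\<close> on \<open>I\<close> and \<open>V = T Z\<close>, idempotence of \<open>F\<close> makes \<open>Z U\<close> that block, hence \<open>V U = 1\<close>.
\<close>

lemma mat_image_free_unit_minor:
  assumes F: "idem_mat R n F" and r: "\<And>j. rank_coeff R n F j = (if j = k then \<one> else \<zero>)"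
    and I: "I \<subseteq> {..<n}" "card I = k" and t: "t \<in> carrier R" "t \<otimes> det_on R I F = \<one>"
  shows "modules_iso R (mat_image R n F) (std_module R k)"
proof -
  note F' = idem_matD[OF F]
  have "finite I" using I(1) finite_subset by blast
  \<comment> \<open>A numbering of \<open>I\<close>, as standard modules are indexed by initial segments.\<close>
  then obtain \<sigma> where \<sigma>: "bij_betw \<sigma> {..<k} I"
    using ex_bij_betw_nat_finite[of I] I(2) by (auto simp: atLeast0LessThan)
  then have \<sigma>I: "\<sigma> a \<in> I" if "a < k" for a using that by (auto simp: bij_betw_def)
  then have \<sigma>n: "\<sigma> a < n" if "a < k" for a using that I(1) by auto
  obtain H where H: "\<And>i j. H i j \<in> carrier R"
    and HF: "\<And>i j. i \<in> I \<Longrightarrow> j \<in> I \<Longrightarrow> (\<Oplus>l\<in>I. H i l \<otimes> F l j) = (if i = j then det_on R I F else \<zero>)"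
    using adjugate_ex[OF F'(1) I(1)] by blast
  define T where "T a b = t \<otimes> H (\<sigma> a) (\<sigma> b)" for a b
  define U where "U i a = F i (\<sigma> a)" for i a
  define Z where "Z a j = F (\<sigma> a) j" for a j
  define V where "V a j = (\<Oplus>b\<in>{..<k}. T a b \<otimes> Z b j)" for a j
  have T: "T \<in> mats R k k" unfolding T_def using H t by auto
  have U: "U \<in> mats R n k" unfolding U_def using F'(1) \<sigma>n by (auto simp: Pi_iff)
  have Z: "Z \<in> mats R k n" unfolding Z_def using F'(1) \<sigma>n by (auto simp: Pi_iff)
  have V: "V \<in> mats R k n" unfolding V_def using T Z by (auto simp: Pi_iff intro!: finsum_closed)
  have ZF: "(\<Oplus>l\<in>{..<n}. Z a l \<otimes> F l j) = Z a j" if "a < k" "j < n" for a j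
    unfolding Z_def using F'(2)[OF \<sigma>n[OF that(1)] that(2)] .
  have VF: "(\<Oplus>l\<in>{..<n}. V a l \<otimes> F l j) = V a j" if "a < k" "j < n" for a j
  proof -
    have "(\<Oplus>l\<in>{..<n}. V a l \<otimes> F l j) = (\<Oplus>b\<in>{..<k}. T a b \<otimes> (\<Oplus>l\<in>{..<n}. Z b l \<otimes> F l j))"
      unfolding V_def by (rule mat_mult_assoc[OF T Z F'(1) that, symmetric])
    also have "\<dots> = V a j"
      unfolding V_def using that T Z by (intro finsum_cong') (auto simp: ZF Pi_iff)
    finally show ?thesis .
  qed
  have FU: "(\<Oplus>l\<in>{..<n}. F i l \<otimes> U l a) = U i a" if "i < n" "a < k" for i a
    unfolding U_def using F'(2)[OF that(1) \<sigma>n[OF that(2)]] .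
  have VU: "(\<Oplus>l\<in>{..<n}. V a l \<otimes> U l b) = (if a = b then \<one> else \<zero>)" if ab: "a < k" "b < k" for a b
  proof -
    have c: "H (\<sigma> a) l \<otimes> F l (\<sigma> b) \<in> carrier R" if "l \<in> I" for l
      using that I(1) F'(1) \<sigma>n[OF ab(2)] H by (auto simp: Pi_iff)
    have "(\<Oplus>l\<in>{..<n}. V a l \<otimes> U l b) = V a (\<sigma> b)"
      unfolding U_def by (rule VF[OF ab(1) \<sigma>n[OF ab(2)]])
    also have "\<dots> = (\<Oplus>c\<in>{..<k}. t \<otimes> (H (\<sigma> a) (\<sigma> c) \<otimes> F (\<sigma> c) (\<sigma> b)))"
      unfolding V_def T_def Z_def using H t F'(1) \<sigma>n ab
      by (intro finsum_cong') (auto simp: m_assoc Pi_iff)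
    also have "\<dots> = t \<otimes> (\<Oplus>c\<in>{..<k}. H (\<sigma> a) (\<sigma> c) \<otimes> F (\<sigma> c) (\<sigma> b))"
      using t c \<sigma>I by (intro finsum_rdistr[symmetric]) auto
    also have "(\<Oplus>c\<in>{..<k}. H (\<sigma> a) (\<sigma> c) \<otimes> F (\<sigma> c) (\<sigma> b)) = (\<Oplus>l\<in>I. H (\<sigma> a) l \<otimes> F l (\<sigma> b))"
      using finsum_reindex[of "\<lambda>l. H (\<sigma> a) l \<otimes> F l (\<sigma> b)" \<sigma> "{..<k}"] \<sigma> c by (auto simp: bij_betw_def)
    also have "\<dots> = (if \<sigma> a = \<sigma> b then det_on R I F else \<zero>)"
      by (rule HF[OF \<sigma>I \<sigma>I, OF ab])
    also have "t \<otimes> \<dots> = (if a = b then \<one> else \<zero>)"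
      using t \<sigma> ab by (auto simp: bij_betw_def inj_on_def)
    finally show ?thesis .
  qed
  show ?thesis by (rule mat_image_free[OF F r U V VU VF FU])
qed

end


section \<open>Localization of rings and modules\<close>

text \<open>
  The operations on fractions are unions over all representatives; they can be computed with any
  representatives once the result does not depend on the choice.
\<close>

lemma UN_const2:
  assumes "p \<noteq> {}" "q \<noteq> {}" "\<And>x s y t. (x, s) \<in> p \<Longrightarrow> (y, t) \<in> q \<Longrightarrow> g x s y t = C"
  shows "(\<Union>(x, s)\<in>p. \<Union>(y, t)\<in>q. g x s y t) = C"
  using assms by fastforce

locale localization = cring R for R :: "('a, 'b) ring_scheme" (structure) +
  fixes S :: "'a set"
  assumes S_closed: "S \<subseteq> carrier R" and S_one [simp]: "\<one> \<in> S"
    and S_mult [simp]: "s \<in> S \<Longrightarrow> t \<in> S \<Longrightarrow> s \<otimes> t \<in> S"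

lemma (in localization) S_carrier: "s \<in> S \<Longrightarrow> s \<in> carrier R"
  using S_closed by blast

locale localization_module = localization R S + Module.module R M
  for R :: "('a, 'b) ring_scheme" (structure) and S and M :: "('a, 'c, 'd) module_scheme" (structure)
begin

abbreviation act :: "'a \<Rightarrow> 'c \<Rightarrow> 'c" (infixr "\<star>" 75) where
  "a \<star> x \<equiv> a \<odot>\<^bsub>M\<^esub> x"

abbreviation frac :: "'c \<Rightarrow> 'a \<Rightarrow> ('c \<times> 'a) set" where
  "frac x s \<equiv> loc_frac R S M x s"

text \<open>
  The multiplier \<open>u\<close> in the relation is what makes it transitive when \<open>S\<close> contains zero divisors; the
  multiplier of the composite is the product of the two multipliers and the middle denominator.
\<close>

lemma loc_rel_equiv: "equiv (carrier M \<times> S) (loc_rel R S M)"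
proof (rule equivI)
  show "loc_rel R S M \<subseteq> (carrier M \<times> S) \<times> carrier M \<times> S"
    unfolding loc_rel_def by auto
  show "refl_on (carrier M \<times> S) (loc_rel R S M)"
    unfolding loc_rel_def by (auto simp: refl_on_def)
  show "sym (loc_rel R S M)" unfolding loc_rel_def sym_def by force
  show "trans (loc_rel R S M)"
  proof (rule transI)
    fix p q r assume pq: "(p, q) \<in> loc_rel R S M" "(q, r) \<in> loc_rel R S M"
    obtain x s y t z w where *: "p = (x, s)" "q = (y, t)" "r = (z, w)" by (metis surj_pair)
    from pq obtain u v where c: "x \<in> carrier M" "y \<in> carrier M" "z \<in> carrier M" "s \<in> S" "t \<in> S" "w \<in> S" "u \<in> S" "v \<in> S"
      and u: "u \<star> (t \<star> x) = u \<star> (s \<star> y)" and v: "v \<star> (w \<star> y) = v \<star> (t \<star> z)"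
      unfolding loc_rel_def * by auto
    note c = c S_carrier[OF \<open>s \<in> S\<close>] S_carrier[OF \<open>t \<in> S\<close>] S_carrier[OF \<open>w \<in> S\<close>]
      S_carrier[OF \<open>u \<in> S\<close>] S_carrier[OF \<open>v \<in> S\<close>]
    have "(u \<otimes> v \<otimes> t) \<star> (w \<star> x) = (v \<otimes> w) \<star> (u \<star> (t \<star> x))"
      using c by (simp add: smult_assoc1[symmetric] m_ac)
    also have "\<dots> = (u \<otimes> s) \<star> (v \<star> (w \<star> y))"
      unfolding u using c by (simp add: smult_assoc1[symmetric] m_ac)
    also have "\<dots> = (u \<otimes> v \<otimes> t) \<star> (s \<star> z)"
      unfolding v using c by (simp add: smult_assoc1[symmetric] m_ac)
    finally show "(p, r) \<in> loc_rel R S M"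
      unfolding loc_rel_def * using c S_mult by blast
  qed
qed

lemma frac_eq_iff:
  assumes "x \<in> carrier M" "y \<in> carrier M" "s \<in> S" "t \<in> S"
  shows "frac x s = frac y t \<longleftrightarrow> (\<exists>u\<in>S. u \<star> (t \<star> x) = u \<star> (s \<star> y))"
  unfolding loc_frac_def using assms
  by (subst eq_equiv_class_iff[OF loc_rel_equiv]) (auto simp: loc_rel_def)

lemma frac_eqI:
  assumes "x \<in> carrier M" "y \<in> carrier M" "s \<in> S" "t \<in> S" "t \<star> x = s \<star> y"
  shows "frac x s = frac y t"
  using assms by (auto simp: frac_eq_iff intro!: bexI[of _ \<one>])

lemma frac_self: "x \<in> carrier M \<Longrightarrow> s \<in> S \<Longrightarrow> (x, s) \<in> frac x s"
  unfolding loc_frac_def using equiv_class_self[OF loc_rel_equiv] by auto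

lemma frac_memD:
  assumes "(y, t) \<in> frac x s"
  shows "y \<in> carrier M" "t \<in> S" "frac y t = frac x s" "t \<in> carrier R"
proof -
  have *: "((x, s), (y, t)) \<in> loc_rel R S M" using assms unfolding loc_frac_def by auto
  then show "y \<in> carrier M" "t \<in> S" unfolding loc_rel_def by auto
  then show "t \<in> carrier R" by (simp add: S_carrier)
  show "frac y t = frac x s"
    unfolding loc_frac_def using equiv_class_eq[OF loc_rel_equiv *] by simp
qed

lemma frac_closed: "x \<in> carrier M \<Longrightarrow> s \<in> S \<Longrightarrow> frac x s \<in> carrier (loc_module R S M)"
  unfolding loc_module_def loc_frac_def by (auto intro: quotientI)

lemma loc_module_cases:
  assumes "p \<in> carrier (loc_module R S M)"
  obtains x s where "x \<in> carrier M" "s \<in> S" "p = frac x s" "s \<in> carrier R"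
  using assms unfolding loc_module_def loc_frac_def by (auto elim!: quotientE simp: S_carrier)

lemma add_frac:
  assumes "x \<in> carrier M" "y \<in> carrier M" "s \<in> S" "t \<in> S"
  shows "frac x s \<oplus>\<^bsub>loc_module R S M\<^esub> frac y t = frac (t \<star> x \<oplus>\<^bsub>M\<^esub> s \<star> y) (s \<otimes> t)"
proof -
  have "(\<Union>(x, s)\<in>frac x s. \<Union>(y, t)\<in>frac y t. frac (t \<star> x \<oplus>\<^bsub>M\<^esub> s \<star> y) (s \<otimes> t)) =
      frac (t \<star> x \<oplus>\<^bsub>M\<^esub> s \<star> y) (s \<otimes> t)"
  proof (rule UN_const2)
    fix x' s' y' t' assume x': "(x', s') \<in> frac x s" and y': "(y', t') \<in> frac y t"
    note c = assms frac_memD(1,2,4)[OF x'] frac_memD(1,2,4)[OF y'] S_carrier[OF assms(3)] S_carrier[OF assms(4)]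
    obtain u where u: "u \<in> S" "u \<star> (s \<star> x') = u \<star> (s' \<star> x)"
      using frac_memD(3)[OF x'] frac_eq_iff c by auto
    obtain v where v: "v \<in> S" "v \<star> (t \<star> y') = v \<star> (t' \<star> y)"
      using frac_memD(3)[OF y'] frac_eq_iff c by auto
    note c = c u(1) v(1) S_carrier[OF u(1)] S_carrier[OF v(1)]
    have 1: "(u \<otimes> v) \<star> ((s \<otimes> t) \<star> (t' \<star> x')) = (v \<otimes> t \<otimes> t') \<star> (u \<star> (s \<star> x'))"
      using c by (simp add: smult_assoc1[symmetric] m_ac)
    have 2: "(u \<otimes> v) \<star> ((s' \<otimes> t') \<star> (t \<star> x)) = (v \<otimes> t \<otimes> t') \<star> (u \<star> (s' \<star> x))"
      using c by (simp add: smult_assoc1[symmetric] m_ac)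
    have 3: "(u \<otimes> v) \<star> ((s \<otimes> t) \<star> (s' \<star> y')) = (u \<otimes> s \<otimes> s') \<star> (v \<star> (t \<star> y'))"
      using c by (simp add: smult_assoc1[symmetric] m_ac)
    have 4: "(u \<otimes> v) \<star> ((s' \<otimes> t') \<star> (s \<star> y)) = (u \<otimes> s \<otimes> s') \<star> (v \<star> (t' \<star> y))"
      using c by (simp add: smult_assoc1[symmetric] m_ac)
    have "(u \<otimes> v) \<star> ((s \<otimes> t) \<star> (t' \<star> x' \<oplus>\<^bsub>M\<^esub> s' \<star> y')) =
        (u \<otimes> v) \<star> ((s' \<otimes> t') \<star> (t \<star> x \<oplus>\<^bsub>M\<^esub> s \<star> y))"
      using c 1 2 3 4 unfolding u(2) v(2) by (simp add: smult_r_distr)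
    then show "frac (t' \<star> x' \<oplus>\<^bsub>M\<^esub> s' \<star> y') (s' \<otimes> t') = frac (t \<star> x \<oplus>\<^bsub>M\<^esub> s \<star> y) (s \<otimes> t)"
      using c by (subst frac_eq_iff) (auto intro!: bexI[of _ "u \<otimes> v"])
  qed (use frac_self assms in blast)+
  then show ?thesis by (simp add: loc_module_def)
qed

lemma abelian_group_loc_module: "abelian_group (loc_module R S M)"
proof (rule abelian_groupI)
  let ?L = "loc_module R S M"
  have zero: "\<zero>\<^bsub>?L\<^esub> = frac \<zero>\<^bsub>M\<^esub> \<one>" by (simp add: loc_module_def)
  show "\<zero>\<^bsub>?L\<^esub> \<in> carrier ?L" unfolding zero by (intro frac_closed) auto
  fix p assume p: "p \<in> carrier ?L"
  then obtain x s where x: "x \<in> carrier M" "s \<in> S" "p = frac x s" "s \<in> carrier R" by (rule loc_module_cases)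
  show "\<zero>\<^bsub>?L\<^esub> \<oplus>\<^bsub>?L\<^esub> p = p"
    unfolding zero x(3) using x by (simp add: add_frac)
  show "\<exists>q\<in>carrier ?L. q \<oplus>\<^bsub>?L\<^esub> p = \<zero>\<^bsub>?L\<^esub>"
  proof (rule bexI[of _ "frac (\<ominus>\<^bsub>M\<^esub> x) s"])
    have "frac (\<ominus>\<^bsub>M\<^esub> x) s \<oplus>\<^bsub>?L\<^esub> p = frac \<zero>\<^bsub>M\<^esub> (s \<otimes> s)"
      unfolding x(3) using x by (simp add: add_frac smult_r_minus M.l_neg)
    also have "\<dots> = \<zero>\<^bsub>?L\<^esub>"
      unfolding zero using x by (intro frac_eqI) auto
    finally show "frac (\<ominus>\<^bsub>M\<^esub> x) s \<oplus>\<^bsub>?L\<^esub> p = \<zero>\<^bsub>?L\<^esub>" .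
  qed (use x in \<open>auto intro: frac_closed\<close>)
  fix q assume "q \<in> carrier ?L"
  then obtain y t where y: "y \<in> carrier M" "t \<in> S" "q = frac y t" "t \<in> carrier R" by (rule loc_module_cases)
  show "p \<oplus>\<^bsub>?L\<^esub> q \<in> carrier ?L"
    unfolding x(3) y(3) using x y by (auto simp: add_frac intro!: frac_closed)
  show "p \<oplus>\<^bsub>?L\<^esub> q = q \<oplus>\<^bsub>?L\<^esub> p"
    unfolding x(3) y(3) using x y by (simp add: add_frac M.a_comm m_comm)
  fix r assume "r \<in> carrier ?L"
  then obtain z w where z: "z \<in> carrier M" "w \<in> S" "r = frac z w" "w \<in> carrier R" by (rule loc_module_cases)
  show "p \<oplus>\<^bsub>?L\<^esub> q \<oplus>\<^bsub>?L\<^esub> r = p \<oplus>\<^bsub>?L\<^esub> (q \<oplus>\<^bsub>?L\<^esub> r)"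
    unfolding x(3) y(3) z(3) using x y z
    by (simp add: add_frac smult_r_distr smult_assoc1[symmetric] M.a_ac m_ac)
qed

end

context localization
begin

lemma self_module_simps [simp]:
  "carrier (self_module R) = carrier R" "x \<oplus>\<^bsub>self_module R\<^esub> y = x \<oplus> y"
  "a \<odot>\<^bsub>self_module R\<^esub> x = a \<otimes> x" "\<zero>\<^bsub>self_module R\<^esub> = \<zero>"
  by (simp_all add: self_module_def)

lemma module_self_module: "Module.module R (self_module R)"
proof (rule moduleI)
  show "abelian_group (self_module R)"
  proof (rule abelian_groupI)
    fix x assume "x \<in> carrier (self_module R)"
    then show "\<exists>y\<in>carrier (self_module R). y \<oplus>\<^bsub>self_module R\<^esub> x = \<zero>\<^bsub>self_module R\<^esub>"
      by (intro bexI[of _ "\<ominus> x"]) (auto simp: l_neg)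
  qed (auto simp: a_ac)
qed (auto simp: is_cring l_distr r_distr m_assoc)

sublocale self: localization_module R S "self_module R"
  by (intro localization_module.intro localization_axioms module_self_module)

abbreviation rfrac :: "'a \<Rightarrow> 'a \<Rightarrow> ('a \<times> 'a) set" where
  "rfrac a s \<equiv> ring_frac R S a s"

text \<open>
  Fractions of ring elements are fractions of the ring as a module over itself, with scalar
  multiplication as product. So the results on modules of fractions cover the additive structure of
  the ring of fractions.
\<close>

lemma loc_ring_simps:
  "carrier (loc_ring R S) = carrier (loc_module R S (self_module R))"
  "add (loc_ring R S) = add (loc_module R S (self_module R))"
  "zero (loc_ring R S) = zero (loc_module R S (self_module R))"
  "mult (loc_ring R S) = smult (loc_module R S (self_module R))"
  "\<one>\<^bsub>loc_ring R S\<^esub> = rfrac \<one> \<one>"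
  by (simp_all add: loc_ring_def loc_module_def self_module_def)

end

context localization_module
begin

lemma smult_frac:
  assumes "a \<in> carrier R" "x \<in> carrier M" "s \<in> S" "t \<in> S"
  shows "rfrac a s \<odot>\<^bsub>loc_module R S M\<^esub> frac x t = frac (a \<star> x) (s \<otimes> t)"
proof -
  have "(\<Union>(a, s)\<in>rfrac a s. \<Union>(x, t)\<in>frac x t. frac (a \<star> x) (s \<otimes> t)) = frac (a \<star> x) (s \<otimes> t)"
  proof (rule UN_const2)
    fix a' s' x' t' assume a': "(a', s') \<in> rfrac a s" and x': "(x', t') \<in> frac x t"
    have "a' \<in> carrier R" using self.frac_memD(1)[OF a'] by simp
    note c = this assms self.frac_memD(2,4)[OF a'] frac_memD(1,2,4)[OF x'] S_carrier[OF assms(3)] S_carrier[OF assms(4)]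
    obtain u where u: "u \<in> S" "u \<otimes> (s \<otimes> a') = u \<otimes> (s' \<otimes> a)"
      using self.frac_memD(3)[OF a'] self.frac_eq_iff[of a' a s' s] c by auto
    obtain v where v: "v \<in> S" "v \<star> (t \<star> x') = v \<star> (t' \<star> x)"
      using frac_memD(3)[OF x'] frac_eq_iff[of x' x t' t] c by auto
    note c = c u(1) v(1) S_carrier[OF u(1)] S_carrier[OF v(1)]
    have "(u \<otimes> v) \<star> ((s \<otimes> t) \<star> (a' \<star> x')) = (u \<otimes> (s \<otimes> a')) \<star> (v \<star> (t \<star> x'))"
      using c by (simp add: smult_assoc1[symmetric] m_ac)
    also have "\<dots> = (u \<otimes> v) \<star> ((s' \<otimes> t') \<star> (a \<star> x))"
      unfolding u(2) v(2) using c by (simp add: smult_assoc1[symmetric] m_ac)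
    finally show "frac (a' \<star> x') (s' \<otimes> t') = frac (a \<star> x) (s \<otimes> t)"
      using c by (subst frac_eq_iff) (auto intro!: bexI[of _ "u \<otimes> v"])
  qed (use frac_self[of x t] self.frac_self[of a s] assms in auto)
  then show ?thesis by (simp add: loc_module_def)
qed

end

context localization
begin

lemma add_rfrac:
  "a \<in> carrier R \<Longrightarrow> b \<in> carrier R \<Longrightarrow> s \<in> S \<Longrightarrow> t \<in> S \<Longrightarrow>
    rfrac a s \<oplus>\<^bsub>loc_ring R S\<^esub> rfrac b t = rfrac (t \<otimes> a \<oplus> s \<otimes> b) (s \<otimes> t)"
  using self.add_frac[of a b s t] by (simp add: loc_ring_simps)

lemma mult_rfrac:
  "a \<in> carrier R \<Longrightarrow> b \<in> carrier R \<Longrightarrow> s \<in> S \<Longrightarrow> t \<in> S \<Longrightarrow>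
    rfrac a s \<otimes>\<^bsub>loc_ring R S\<^esub> rfrac b t = rfrac (a \<otimes> b) (s \<otimes> t)"
  using self.smult_frac[of a b s t] by (simp add: loc_ring_simps)

lemma rfrac_closed: "a \<in> carrier R \<Longrightarrow> s \<in> S \<Longrightarrow> rfrac a s \<in> carrier (loc_ring R S)"
  using self.frac_closed[of a s] by (simp add: loc_ring_simps)

lemma loc_ring_cases:
  assumes "p \<in> carrier (loc_ring R S)"
  obtains a s where "a \<in> carrier R" "s \<in> S" "p = rfrac a s" "s \<in> carrier R"
proof -
  have "p \<in> carrier (loc_module R S (self_module R))" using assms by (simp add: loc_ring_simps)
  then show thesis
  proof (rule self.loc_module_cases)
    fix a s assume "a \<in> carrier (self_module R)" "s \<in> S" "p = rfrac a s" "s \<in> carrier R"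
    then show thesis by (intro that[of a s]) simp_all
  qed
qed

lemma rfrac_eqI:
  "a \<in> carrier R \<Longrightarrow> b \<in> carrier R \<Longrightarrow> s \<in> S \<Longrightarrow> t \<in> S \<Longrightarrow> t \<otimes> a = s \<otimes> b \<Longrightarrow> rfrac a s = rfrac b t"
  using self.frac_eqI[of a b s t] by simp

lemma cring_loc_ring: "cring (loc_ring R S)"
proof (rule cringI)
  let ?L = "loc_ring R S"
  interpret L: abelian_group "loc_module R S (self_module R)" by (rule self.abelian_group_loc_module)
  show "abelian_group ?L"
  proof (rule abelian_groupI)
    fix x assume "x \<in> carrier ?L"
    then show "\<exists>y\<in>carrier ?L. y \<oplus>\<^bsub>?L\<^esub> x = \<zero>\<^bsub>?L\<^esub>"
      using L.l_neg L.a_inv_closed unfolding loc_ring_simps by blast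
  qed (simp_all add: loc_ring_simps L.a_ac)
  show "comm_monoid ?L"
  proof (rule comm_monoidI)
    show "\<one>\<^bsub>?L\<^esub> \<in> carrier ?L" by (auto simp: loc_ring_simps(5) intro!: rfrac_closed)
    fix p assume "p \<in> carrier ?L"
    then obtain a s where a: "a \<in> carrier R" "s \<in> S" "p = rfrac a s" "s \<in> carrier R" by (rule loc_ring_cases)
    show "\<one>\<^bsub>?L\<^esub> \<otimes>\<^bsub>?L\<^esub> p = p" using a by (simp add: mult_rfrac loc_ring_simps(5))
    fix q assume "q \<in> carrier ?L"
    then obtain b t where b: "b \<in> carrier R" "t \<in> S" "q = rfrac b t" "t \<in> carrier R" by (rule loc_ring_cases)
    show "p \<otimes>\<^bsub>?L\<^esub> q \<in> carrier ?L" using a b by (auto simp: mult_rfrac intro!: rfrac_closed)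
    show "p \<otimes>\<^bsub>?L\<^esub> q = q \<otimes>\<^bsub>?L\<^esub> p" using a b by (simp add: mult_rfrac m_comm)
    fix r assume "r \<in> carrier ?L"
    then obtain c w where c: "c \<in> carrier R" "w \<in> S" "r = rfrac c w" "w \<in> carrier R" by (rule loc_ring_cases)
    show "p \<otimes>\<^bsub>?L\<^esub> q \<otimes>\<^bsub>?L\<^esub> r = p \<otimes>\<^bsub>?L\<^esub> (q \<otimes>\<^bsub>?L\<^esub> r)"
      using a b c by (simp add: mult_rfrac m_assoc)
  qed
  fix p q r assume pqr: "p \<in> carrier ?L" "q \<in> carrier ?L" "r \<in> carrier ?L"
  from pqr(1) obtain a s where a: "a \<in> carrier R" "s \<in> S" "p = rfrac a s" "s \<in> carrier R" by (rule loc_ring_cases)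
  from pqr(2) obtain b t where b: "b \<in> carrier R" "t \<in> S" "q = rfrac b t" "t \<in> carrier R" by (rule loc_ring_cases)
  from pqr(3) obtain c w where c: "c \<in> carrier R" "w \<in> S" "r = rfrac c w" "w \<in> carrier R" by (rule loc_ring_cases)
  have eq: "(s \<otimes> w) \<otimes> (t \<otimes> w) \<otimes> ((t \<otimes> a \<oplus> s \<otimes> b) \<otimes> c) =
      (s \<otimes> t \<otimes> w) \<otimes> ((t \<otimes> w) \<otimes> (a \<otimes> c) \<oplus> (s \<otimes> w) \<otimes> (b \<otimes> c))"
    using a(1,4) b(1,4) c(1,4) by algebra
  have "(p \<oplus>\<^bsub>?L\<^esub> q) \<otimes>\<^bsub>?L\<^esub> r = rfrac ((t \<otimes> a \<oplus> s \<otimes> b) \<otimes> c) (s \<otimes> t \<otimes> w)"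
    unfolding a(3) b(3) c(3) using a(1,2,4) b(1,2,4) c(1,2,4) by (simp add: mult_rfrac add_rfrac)
  also have "\<dots> = rfrac ((t \<otimes> w) \<otimes> (a \<otimes> c) \<oplus> (s \<otimes> w) \<otimes> (b \<otimes> c)) ((s \<otimes> w) \<otimes> (t \<otimes> w))"
    using a(1,2,4) b(1,2,4) c(1,2,4) eq by (intro rfrac_eqI) simp_all
  also have "\<dots> = p \<otimes>\<^bsub>?L\<^esub> r \<oplus>\<^bsub>?L\<^esub> q \<otimes>\<^bsub>?L\<^esub> r"
    unfolding a(3) b(3) c(3) using a(1,2,4) b(1,2,4) c(1,2,4) by (simp add: mult_rfrac add_rfrac)
  finally show "(p \<oplus>\<^bsub>?L\<^esub> q) \<otimes>\<^bsub>?L\<^esub> r = p \<otimes>\<^bsub>?L\<^esub> r \<oplus>\<^bsub>?L\<^esub> q \<otimes>\<^bsub>?L\<^esub> r" .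
qed

lemma loc_ring_hom: "ring_hom_cring R (loc_ring R S) (\<lambda>a. rfrac a \<one>)"
  by (intro ring_hom_cringI is_cring cring_loc_ring ring_hom_memI)
    (auto simp: rfrac_closed mult_rfrac add_rfrac loc_ring_simps(5))

lemma rfrac_eq_mult: "a \<in> carrier R \<Longrightarrow> s \<in> S \<Longrightarrow> rfrac a s = rfrac a \<one> \<otimes>\<^bsub>loc_ring R S\<^esub> rfrac \<one> s"
  by (simp add: mult_rfrac S_carrier)

end

context localization_module
begin

lemma module_loc_module: "Module.module (loc_ring R S) (loc_module R S M)"
proof (rule moduleI)
  let ?L = "loc_module R S M"
  show "cring (loc_ring R S)" by (rule cring_loc_ring)
  show "abelian_group ?L" by (rule abelian_group_loc_module)
  show "\<one>\<^bsub>loc_ring R S\<^esub> \<odot>\<^bsub>?L\<^esub> p = p" if "p \<in> carrier ?L" for p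
    using that by (auto elim!: loc_module_cases simp: smult_frac loc_ring_simps(5))
  fix a p assume ap: "a \<in> carrier (loc_ring R S)" "p \<in> carrier ?L"
  from ap(1) obtain b s where a: "b \<in> carrier R" "s \<in> S" "a = rfrac b s" "s \<in> carrier R" by (rule loc_ring_cases)
  from ap(2) obtain x t where p: "x \<in> carrier M" "t \<in> S" "p = frac x t" "t \<in> carrier R" by (rule loc_module_cases)
  show "a \<odot>\<^bsub>?L\<^esub> p \<in> carrier ?L" using a p by (auto simp: smult_frac intro!: frac_closed)
  { fix q assume "q \<in> carrier ?L"
    then obtain y w where q: "y \<in> carrier M" "w \<in> S" "q = frac y w" "w \<in> carrier R" by (rule loc_module_cases)
    have "frac (b \<star> (w \<star> x \<oplus>\<^bsub>M\<^esub> t \<star> y)) (s \<otimes> (t \<otimes> w)) =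
        frac ((s \<otimes> w) \<star> (b \<star> x) \<oplus>\<^bsub>M\<^esub> (s \<otimes> t) \<star> (b \<star> y)) ((s \<otimes> t) \<otimes> (s \<otimes> w))"
      using a p q
      by (intro frac_eqI) (simp_all add: smult_r_distr smult_assoc1[symmetric] m_ac)
    then show "a \<odot>\<^bsub>?L\<^esub> (p \<oplus>\<^bsub>?L\<^esub> q) = a \<odot>\<^bsub>?L\<^esub> p \<oplus>\<^bsub>?L\<^esub> a \<odot>\<^bsub>?L\<^esub> q"
      using a p q by (simp add: smult_frac add_frac) }
  fix a' assume "a' \<in> carrier (loc_ring R S)"
  then obtain b' s' where a': "b' \<in> carrier R" "s' \<in> S" "a' = rfrac b' s'" "s' \<in> carrier R" by (rule loc_ring_cases)
  have "frac ((s' \<otimes> b \<oplus> s \<otimes> b') \<star> x) ((s \<otimes> s') \<otimes> t) =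
      frac ((s' \<otimes> t) \<star> (b \<star> x) \<oplus>\<^bsub>M\<^esub> (s \<otimes> t) \<star> (b' \<star> x)) ((s \<otimes> t) \<otimes> (s' \<otimes> t))"
    using a p a'
    by (intro frac_eqI) (simp_all add: smult_r_distr smult_l_distr smult_assoc1[symmetric] m_ac)
  then show "(a \<oplus>\<^bsub>loc_ring R S\<^esub> a') \<odot>\<^bsub>?L\<^esub> p = a \<odot>\<^bsub>?L\<^esub> p \<oplus>\<^bsub>?L\<^esub> a' \<odot>\<^bsub>?L\<^esub> p"
    using a p a' by (simp add: smult_frac add_frac add_rfrac)
  show "(a \<otimes>\<^bsub>loc_ring R S\<^esub> a') \<odot>\<^bsub>?L\<^esub> p = a \<odot>\<^bsub>?L\<^esub> (a' \<odot>\<^bsub>?L\<^esub> p)"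
    using a p a' by (simp add: smult_frac mult_rfrac smult_assoc1 m_assoc)
qed

text \<open>
  A map on pairs that identifies exactly equal fractions induces a map on fractions, here by choosing
  a representative. The isomorphisms out of a module of fractions below are all of this form.
\<close>

lemma loc_module_isoI:
  assumes eq: "\<And>x y s t. x \<in> carrier M \<Longrightarrow> y \<in> carrier M \<Longrightarrow> s \<in> S \<Longrightarrow> t \<in> S \<Longrightarrow>
      frac x s = frac y t \<longleftrightarrow> f x s = f y t"
    and range: "case_prod f ` (carrier M \<times> S) = carrier N"
    and add: "\<And>x y s t. x \<in> carrier M \<Longrightarrow> y \<in> carrier M \<Longrightarrow> s \<in> S \<Longrightarrow> t \<in> S \<Longrightarrow>
      f (t \<star> x \<oplus>\<^bsub>M\<^esub> s \<star> y) (s \<otimes> t) = f x s \<oplus>\<^bsub>N\<^esub> f y t"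
    and smult: "\<And>a x s t. a \<in> carrier R \<Longrightarrow> x \<in> carrier M \<Longrightarrow> s \<in> S \<Longrightarrow> t \<in> S \<Longrightarrow>
      f (a \<star> x) (s \<otimes> t) = rfrac a s \<odot>\<^bsub>N\<^esub> f x t"
  shows "modules_iso (loc_ring R S) (loc_module R S M) N"
proof -
  let ?L = "loc_module R S M"
  define H where "H p = case_prod f (SOME z. z \<in> p)" for p
  have H: "H (frac x s) = f x s" if x: "x \<in> carrier M" "s \<in> S" for x s
  proof -
    obtain y t where yt: "(SOME z. z \<in> frac x s) = (y, t)" by (metis surj_pair)
    have "(y, t) \<in> frac x s"
      using someI[of "\<lambda>z. z \<in> frac x s", OF frac_self[OF x]] unfolding yt .
    note yt' = frac_memD[OF this]
    have "f y t = f x s"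
      using yt'(3) eq[OF yt'(1) x(1) yt'(2) x(2)] by blast
    then show ?thesis unfolding H_def yt by (simp only: prod.case)
  qed
  have carrier_eq: "carrier ?L = case_prod frac ` (carrier M \<times> S)"
  proof
    show "carrier ?L \<subseteq> case_prod frac ` (carrier M \<times> S)"
    proof
      fix p assume "p \<in> carrier ?L"
      then obtain x s where "x \<in> carrier M" "s \<in> S" "p = frac x s" by (rule loc_module_cases)
      then show "p \<in> case_prod frac ` (carrier M \<times> S)" by (intro rev_image_eqI[of "(x, s)"]) simp_all
    qed
  next
    show "case_prod frac ` (carrier M \<times> S) \<subseteq> carrier ?L"
      by (intro image_subsetI) (clarsimp simp: frac_closed)
  qed
  show ?thesis
    unfolding modules_iso_def
  proof (intro exI[of _ H] conjI ballI)
    have "H ` carrier ?L = case_prod f ` (carrier M \<times> S)"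
      unfolding carrier_eq image_image by (intro image_cong refl) (clarsimp simp: H)
    moreover have "inj_on H (carrier ?L)"
    proof (rule inj_onI)
      fix p q assume pq: "p \<in> carrier ?L" "q \<in> carrier ?L" "H p = H q"
      from pq(1) obtain x s where x: "x \<in> carrier M" "s \<in> S" "p = frac x s" by (rule loc_module_cases)
      from pq(2) obtain y t where y: "y \<in> carrier M" "t \<in> S" "q = frac y t" by (rule loc_module_cases)
      show "p = q"
        using pq(3) eq[OF x(1) y(1) x(2) y(2)] unfolding x(3) y(3) H[OF x(1,2)] H[OF y(1,2)] by blast
    qed
    ultimately show "bij_betw H (carrier ?L) (carrier N)"
      unfolding bij_betw_def range[symmetric] by blast
  next
    fix p q assume pq: "p \<in> carrier ?L" "q \<in> carrier ?L"
    from pq(1) obtain x s where x: "x \<in> carrier M" "s \<in> S" "p = frac x s" "s \<in> carrier R" by (rule loc_module_cases)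
    from pq(2) obtain y t where y: "y \<in> carrier M" "t \<in> S" "q = frac y t" "t \<in> carrier R" by (rule loc_module_cases)
    have z: "t \<star> x \<oplus>\<^bsub>M\<^esub> s \<star> y \<in> carrier M" by (intro M.add.m_closed smult_closed x y)
    show "H (p \<oplus>\<^bsub>?L\<^esub> q) = H p \<oplus>\<^bsub>N\<^esub> H q"
      unfolding x(3) y(3) add_frac[OF x(1) y(1) x(2) y(2)] H[OF z S_mult[OF x(2) y(2)]] H[OF x(1,2)] H[OF y(1,2)]
      by (rule add[OF x(1) y(1) x(2) y(2)])
  next
    fix a p assume ap: "a \<in> carrier (loc_ring R S)" "p \<in> carrier ?L"
    from ap(1) obtain b s where a: "b \<in> carrier R" "s \<in> S" "a = rfrac b s" by (rule loc_ring_cases)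
    from ap(2) obtain x t where x: "x \<in> carrier M" "t \<in> S" "p = frac x t" by (rule loc_module_cases)
    show "H (a \<odot>\<^bsub>?L\<^esub> p) = a \<odot>\<^bsub>N\<^esub> H p"
      unfolding a(3) x(3) smult_frac[OF a(1) x(1) a(2) x(2)] H[OF smult_closed[OF a(1) x(1)] S_mult[OF a(2) x(2)]] H[OF x(1,2)]
      by (rule smult[OF a(1) x(1) a(2) x(2)])
  qed
qed

end


section \<open>Localization of isomorphisms and of images of matrices\<close>

lemma restrict_eq_iff: "restrict f A = restrict g A \<longleftrightarrow> (\<forall>i\<in>A. f i = g i)"
  by (metis restrict_apply' restrict_ext)

text \<open>
  Localization is functorial: \<open>x / s \<mapsto> h x / s\<close>.
\<close>

lemma (in localization) loc_module_iso:
  assumes M: "Module.module R M" and N: "Module.module R N" and iso: "modules_iso R M N"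
  shows "modules_iso (loc_ring R S) (loc_module R S M) (loc_module R S N)"
proof -
  interpret M: localization_module R S M by (intro localization_module.intro localization_axioms M)
  interpret N: localization_module R S N by (intro localization_module.intro localization_axioms N)
  from iso obtain h where h: "bij_betw h (carrier M) (carrier N)"
    and add: "\<And>x y. x \<in> carrier M \<Longrightarrow> y \<in> carrier M \<Longrightarrow> h (x \<oplus>\<^bsub>M\<^esub> y) = h x \<oplus>\<^bsub>N\<^esub> h y"
    and smult: "\<And>a x. a \<in> carrier R \<Longrightarrow> x \<in> carrier M \<Longrightarrow> h (a \<odot>\<^bsub>M\<^esub> x) = a \<odot>\<^bsub>N\<^esub> h x"
    unfolding modules_iso_def by blast
  have hN: "h x \<in> carrier N" if "x \<in> carrier M" for x using h that by (auto simp: bij_betw_def)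
  have inj: "h x = h y \<longleftrightarrow> x = y" if "x \<in> carrier M" "y \<in> carrier M" for x y
    using h that by (auto simp: bij_betw_def inj_on_def)
  have eq: "M.frac x s = M.frac y t \<longleftrightarrow> N.frac (h x) s = N.frac (h y) t"
    if "x \<in> carrier M" "y \<in> carrier M" "s \<in> S" "t \<in> S" for x y s t
  proof -
    have "u \<odot>\<^bsub>M\<^esub> (t \<odot>\<^bsub>M\<^esub> x) = u \<odot>\<^bsub>M\<^esub> (s \<odot>\<^bsub>M\<^esub> y) \<longleftrightarrow> u \<odot>\<^bsub>N\<^esub> (t \<odot>\<^bsub>N\<^esub> h x) = u \<odot>\<^bsub>N\<^esub> (s \<odot>\<^bsub>N\<^esub> h y)"
      if "u \<in> S" for u
      using that \<open>x \<in> carrier M\<close> \<open>y \<in> carrier M\<close> \<open>s \<in> S\<close> \<open>t \<in> S\<close>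
        inj[of "u \<odot>\<^bsub>M\<^esub> (t \<odot>\<^bsub>M\<^esub> x)" "u \<odot>\<^bsub>M\<^esub> (s \<odot>\<^bsub>M\<^esub> y)"]
      by (simp add: smult S_carrier)
    then show ?thesis
      using that by (simp add: M.frac_eq_iff N.frac_eq_iff hN)
  qed
  show ?thesis
  proof (rule M.loc_module_isoI[where f = "\<lambda>x s. N.frac (h x) s"])
    fix x y s t assume "x \<in> carrier M" "y \<in> carrier M" "s \<in> S" "t \<in> S"
    then show "M.frac x s = M.frac y t \<longleftrightarrow> N.frac (h x) s = N.frac (h y) t" by (rule eq)
  next
    show "(\<lambda>(x, s). N.frac (h x) s) ` (carrier M \<times> S) = carrier (loc_module R S N)"
    proof
      show "(\<lambda>(x, s). N.frac (h x) s) ` (carrier M \<times> S) \<subseteq> carrier (loc_module R S N)"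
        by (intro image_subsetI) (clarsimp simp: N.frac_closed hN)
      show "carrier (loc_module R S N) \<subseteq> (\<lambda>(x, s). N.frac (h x) s) ` (carrier M \<times> S)"
      proof
        fix q assume "q \<in> carrier (loc_module R S N)"
        then obtain y t where y: "y \<in> carrier N" "t \<in> S" "q = N.frac y t" by (rule N.loc_module_cases)
        from y(1) h obtain x where x: "x \<in> carrier M" "y = h x" by (auto simp: bij_betw_def)
        show "q \<in> (\<lambda>(x, s). N.frac (h x) s) ` (carrier M \<times> S)"
          by (rule rev_image_eqI[of "(x, t)"]) (use x y in simp_all)
      qed
    qed
  next
    fix x y s t assume x: "x \<in> carrier M" "s \<in> S" and y: "y \<in> carrier M" "t \<in> S"
    have z: "t \<odot>\<^bsub>M\<^esub> x \<in> carrier M" "s \<odot>\<^bsub>M\<^esub> y \<in> carrier M"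
      using x y by (auto intro!: M.smult_closed S_carrier)
    show "N.frac (h (t \<odot>\<^bsub>M\<^esub> x \<oplus>\<^bsub>M\<^esub> s \<odot>\<^bsub>M\<^esub> y)) (s \<otimes> t) = N.frac (h x) s \<oplus>\<^bsub>loc_module R S N\<^esub> N.frac (h y) t"
      unfolding add[OF z] smult[OF S_carrier[OF y(2)] x(1)] smult[OF S_carrier[OF x(2)] y(1)]
      by (rule N.add_frac[OF hN[OF x(1)] hN[OF y(1)] x(2) y(2), symmetric])
  next
    fix a x s t assume a: "a \<in> carrier R" "s \<in> S" and x: "x \<in> carrier M" "t \<in> S"
    show "N.frac (h (a \<odot>\<^bsub>M\<^esub> x)) (s \<otimes> t) = rfrac a s \<odot>\<^bsub>loc_module R S N\<^esub> N.frac (h x) t"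
      unfolding smult[OF a(1) x(1)] by (rule N.smult_frac[OF a(1) hN[OF x(1)] a(2) x(2), symmetric])
  qed
qed

context localization
begin

text \<open>
  Finitely many fractions have a common denominator, so that a vector of fractions is a fraction of
  vectors.
\<close>

lemma common_denominator:
  fixes n :: nat
  assumes "w \<in> {..<n} \<rightarrow> carrier (loc_ring R S)"
  obtains s b where "s \<in> S" "b \<in> {..<n} \<rightarrow> carrier R" "\<forall>i<n. w i = rfrac (b i) s"
proof -
  have "\<exists>s\<in>S. \<exists>b. \<forall>i<n. b i \<in> carrier R \<and> w i = rfrac (b i) s"
    using assms
  proof (induction n)
    case 0
    then show ?case using S_one by blast
  next
    case (Suc n)
    have "w \<in> {..<n} \<rightarrow> carrier (loc_ring R S)" using Suc.prems by (auto simp: Pi_iff)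
    from Suc.IH[OF this] obtain s b where s: "s \<in> S" and
      sb: "\<forall>i<n. b i \<in> carrier R \<and> w i = rfrac (b i) s" by blast
    then have b: "b i \<in> carrier R" "w i = rfrac (b i) s" if "i < n" for i using that by auto
    have "w n \<in> carrier (loc_ring R S)" using Suc.prems by auto
    then obtain a t where a: "a \<in> carrier R" "t \<in> S" "w n = rfrac a t" "t \<in> carrier R" by (rule loc_ring_cases)
    have sc: "s \<in> carrier R" using s by (rule S_carrier)
    let ?b = "\<lambda>i. if i < n then t \<otimes> b i else s \<otimes> a"
    have "?b i \<in> carrier R \<and> w i = rfrac (?b i) (s \<otimes> t)" if i: "i < Suc n" for i
    proof (cases "i < n")
      case True
      have "rfrac (b i) s = rfrac (t \<otimes> b i) (s \<otimes> t)"
        using b(1)[OF True] a s sc by (intro rfrac_eqI) (simp_all add: m_assoc)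
      then show ?thesis using b[OF True] a True by simp
    next
      case False
      have "rfrac a t = rfrac (s \<otimes> a) (s \<otimes> t)"
        using a s sc by (intro rfrac_eqI) (simp_all add: m_ac)
      moreover have "i = n" using i False by simp
      ultimately show ?thesis using a sc by simp
    qed
    then show ?case using s a(2) by (intro bexI[of _ "s \<otimes> t"] exI[of _ ?b]) simp_all
  qed
  then obtain s b where "s \<in> S" "\<forall>i<n. b i \<in> carrier R \<and> w i = rfrac (b i) s" by blast
  then show thesis by (intro that[of s b]) auto
qed

text \<open>
  Equality of finitely many fractions is witnessed by one multiplier, the product of the individual
  ones.
\<close>

lemma common_multiplier:
  fixes n :: nat
  assumes "f \<in> {..<n} \<rightarrow> carrier R" "g \<in> {..<n} \<rightarrow> carrier R"
    and "\<And>i. i < n \<Longrightarrow> \<exists>u\<in>S. u \<otimes> f i = u \<otimes> g i"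
  obtains u where "u \<in> S" "\<And>i. i < n \<Longrightarrow> u \<otimes> f i = u \<otimes> g i"
proof -
  have "\<exists>u\<in>S. \<forall>i<n. u \<otimes> f i = u \<otimes> g i"
    using assms
  proof (induction n)
    case 0
    then show ?case using S_one by blast
  next
    case (Suc n)
    then obtain u where u: "u \<in> S" "\<And>i. i < n \<Longrightarrow> u \<otimes> f i = u \<otimes> g i" by (auto simp: Pi_iff)
    obtain v where v: "v \<in> S" "v \<otimes> f n = v \<otimes> g n" using Suc.prems(3)[of n] by auto
    have uv: "u \<in> carrier R" "v \<in> carrier R" using u v S_carrier by auto
    have fg: "f i \<in> carrier R" "g i \<in> carrier R" if "i < Suc n" for i
      using that Suc.prems(1,2) by (auto simp: Pi_iff)
    have "(u \<otimes> v) \<otimes> f i = (u \<otimes> v) \<otimes> g i" if i: "i < Suc n" for i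
    proof (cases "i < n")
      case True
      have "(u \<otimes> v) \<otimes> f i = v \<otimes> (u \<otimes> f i)" using uv fg[OF i] by (simp add: m_ac)
      also have "\<dots> = (u \<otimes> v) \<otimes> g i" unfolding u(2)[OF True] using uv fg[OF i] by (simp add: m_ac)
      finally show ?thesis .
    next
      case False
      then have "i = n" using i by simp
      then show ?thesis using uv fg[of n] v(2) by (simp add: m_assoc)
    qed
    then show ?case using u(1) v(1) by (intro bexI[of _ "u \<otimes> v"]) auto
  qed
  then show thesis using that by blast
qed

text \<open>
  A fraction \<open>x / s\<close> of vectors goes to the vector of fractions \<open>x i / s\<close>. Injectivity needs a common
  multiplier, surjectivity a common denominator \<open>b / s\<close>; the vector \<open>b\<close> may be replaced by \<open>F b\<close>, since
  a vector in the image of the localized matrix is fixed by it.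
\<close>

lemma loc_module_mat_image_iso:
  assumes F: "idem_mat R n F"
  shows "modules_iso (loc_ring R S) (loc_module R S (mat_image R n F))
    (mat_image (loc_ring R S) n (\<lambda>i j. rfrac (F i j) \<one>))"
proof -
  let ?L = "loc_ring R S" and ?M = "mat_image R n F" and ?F = "\<lambda>i j. rfrac (F i j) \<one>"
  let ?N = "mat_image ?L n ?F"
  note F' = idem_matD[OF F]
  interpret M: localization_module R S ?M
    by (intro localization_module.intro localization_axioms mat_image_module F')
  interpret L: cring ?L by (rule cring_loc_ring)
  interpret hom: ring_hom_cring R ?L "\<lambda>a. rfrac a \<one>" by (rule loc_ring_hom)
  have FL: "idem_mat ?L n ?F" by (rule hom.hom_idem_mat[OF F])
  note FL' = L.idem_matD[OF FL]
  have M: "x i \<in> carrier R" if "x \<in> carrier ?M" "i < n" for x i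
    using mat_image_idem(1)[OF F that(1)] that(2) by (auto simp: PiE_iff)
  define vec where "vec x s = (\<lambda>i\<in>{..<n}. rfrac (x i) s)" for x s
  have vec_closed: "vec x s \<in> vecs ?L n" if "x \<in> {..<n} \<rightarrow> carrier R" "s \<in> S" for x s
    unfolding vec_def by (rule restrict_PiE_iff[THEN iffD2]) (use that in \<open>auto intro: rfrac_closed\<close>)
  have vec_mult: "mat_vec ?L n n ?F (vec x s) = vec (mat_vec R n n F x) s"
    if x: "x \<in> {..<n} \<rightarrow> carrier R" and s: "s \<in> S" for x s
    unfolding mat_vec_def[of ?L] vec_def
  proof (rule restrict_ext)
    fix i assume i: "i \<in> {..<n}"
    have s': "rfrac \<one> s \<in> carrier ?L" using s by (intro rfrac_closed) auto
    have c: "F i j \<in> carrier R" "x j \<in> carrier R" if "j < n" for j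
      using that i x F'(1) by (auto simp: Pi_iff)
    have "(\<Oplus>\<^bsub>?L\<^esub>j\<in>{..<n}. ?F i j \<otimes>\<^bsub>?L\<^esub> (\<lambda>i\<in>{..<n}. rfrac (x i) s) j) =
        (\<Oplus>\<^bsub>?L\<^esub>j\<in>{..<n}. rfrac (F i j \<otimes> x j) \<one> \<otimes>\<^bsub>?L\<^esub> rfrac \<one> s)"
    proof (rule L.finsum_cong'[OF refl])
      fix j assume j: "j \<in> {..<n}"
      have "?F i j \<otimes>\<^bsub>?L\<^esub> rfrac (x j) s = rfrac (F i j \<otimes> x j) s"
        using c j s S_carrier[OF s] by (simp add: mult_rfrac)
      also have "\<dots> = rfrac (F i j \<otimes> x j) \<one> \<otimes>\<^bsub>?L\<^esub> rfrac \<one> s"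
        using c j s by (intro rfrac_eq_mult) auto
      finally show "?F i j \<otimes>\<^bsub>?L\<^esub> (\<lambda>i\<in>{..<n}. rfrac (x i) s) j = rfrac (F i j \<otimes> x j) \<one> \<otimes>\<^bsub>?L\<^esub> rfrac \<one> s"
        using j by simp
    qed (use c s' in \<open>auto intro!: rfrac_closed\<close>)
    also have "\<dots> = (\<Oplus>\<^bsub>?L\<^esub>j\<in>{..<n}. rfrac (F i j \<otimes> x j) \<one>) \<otimes>\<^bsub>?L\<^esub> rfrac \<one> s"
      using c s' by (intro L.finsum_ldistr[symmetric]) (auto intro!: rfrac_closed)
    also have "(\<Oplus>\<^bsub>?L\<^esub>j\<in>{..<n}. rfrac (F i j \<otimes> x j) \<one>) = rfrac (\<Oplus>j\<in>{..<n}. F i j \<otimes> x j) \<one>"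
      using c by (subst hom.hom_finsum) (auto simp: comp_def)
    also have "\<dots> \<otimes>\<^bsub>?L\<^esub> rfrac \<one> s = rfrac (\<Oplus>j\<in>{..<n}. F i j \<otimes> x j) s"
      using c s by (intro rfrac_eq_mult[symmetric] finsum_closed) auto
    finally show "(\<Oplus>\<^bsub>?L\<^esub>j\<in>{..<n}. ?F i j \<otimes>\<^bsub>?L\<^esub> (\<lambda>i\<in>{..<n}. rfrac (x i) s) j) = rfrac (mat_vec R n n F x i) s"
      using i by (simp add: mat_vec_def)
  qed
  have eq: "M.frac x s = M.frac y t \<longleftrightarrow> vec x s = vec y t"
    if x: "x \<in> carrier ?M" and y: "y \<in> carrier ?M" and s: "s \<in> S" and t: "t \<in> S" for x y s t
  proof -
    have st: "s \<in> carrier R" "t \<in> carrier R" using s t S_carrier by auto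
    have coord: "rfrac (x i) s = rfrac (y i) t \<longleftrightarrow> (\<exists>u\<in>S. u \<otimes> (t \<otimes> x i) = u \<otimes> (s \<otimes> y i))" if "i < n" for i
      using self.frac_eq_iff[of "x i" "y i" s t] M[OF x that] M[OF y that] s t by simp
    have "vec x s = vec y t \<longleftrightarrow> (\<forall>i<n. rfrac (x i) s = rfrac (y i) t)"
      unfolding vec_def restrict_eq_iff by (simp only: Ball_def lessThan_iff)
    also have "\<dots> \<longleftrightarrow> (\<exists>u\<in>S. \<forall>i<n. u \<otimes> (t \<otimes> x i) = u \<otimes> (s \<otimes> y i))"
    proof
      assume *: "\<forall>i<n. rfrac (x i) s = rfrac (y i) t"
      obtain u where "u \<in> S" "\<And>i. i < n \<Longrightarrow> u \<otimes> (t \<otimes> x i) = u \<otimes> (s \<otimes> y i)"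
      proof (rule common_multiplier[of "\<lambda>i. t \<otimes> x i" n "\<lambda>i. s \<otimes> y i"])
        show "\<exists>u\<in>S. u \<otimes> (t \<otimes> x i) = u \<otimes> (s \<otimes> y i)" if "i < n" for i
          using * coord that by blast
      qed (use M[OF x] M[OF y] st in auto)
      then show "\<exists>u\<in>S. \<forall>i<n. u \<otimes> (t \<otimes> x i) = u \<otimes> (s \<otimes> y i)" by blast
    next
      assume "\<exists>u\<in>S. \<forall>i<n. u \<otimes> (t \<otimes> x i) = u \<otimes> (s \<otimes> y i)"
      then show "\<forall>i<n. rfrac (x i) s = rfrac (y i) t" using coord by blast
    qed
    also have "\<dots> \<longleftrightarrow> (\<exists>u\<in>S. u \<odot>\<^bsub>?M\<^esub> (t \<odot>\<^bsub>?M\<^esub> x) = u \<odot>\<^bsub>?M\<^esub> (s \<odot>\<^bsub>?M\<^esub> y))"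
      unfolding smult_mat_image restrict_eq_iff by (simp add: Ball_def)
    also have "\<dots> \<longleftrightarrow> M.frac x s = M.frac y t"
      using x y s t by (rule M.frac_eq_iff[symmetric])
    finally show ?thesis by simp
  qed
  have vecN: "vec x s \<in> carrier ?N" if x: "x \<in> carrier ?M" and s: "s \<in> S" for x s
  proof (rule L.mat_image_idemI)
    have x': "x \<in> {..<n} \<rightarrow> carrier R" using M[OF x] by auto
    show "vec x s \<in> vecs ?L n" by (rule vec_closed[OF x' s])
    show "mat_vec ?L n n ?F (vec x s) = vec x s"
      unfolding vec_mult[OF x' s] mat_image_idem(2)[OF F x] ..
  qed
  show ?thesis
  proof (rule M.loc_module_isoI[where f = vec])
    fix x y s t assume "x \<in> carrier ?M" "y \<in> carrier ?M" "s \<in> S" "t \<in> S"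
    then show "M.frac x s = M.frac y t \<longleftrightarrow> vec x s = vec y t" by (rule eq)
  next
    show "case_prod vec ` (carrier ?M \<times> S) = carrier ?N"
    proof
      show "case_prod vec ` (carrier ?M \<times> S) \<subseteq> carrier ?N"
        by (intro image_subsetI) (clarsimp simp: vecN)
      show "carrier ?N \<subseteq> case_prod vec ` (carrier ?M \<times> S)"
      proof
        fix v assume v: "v \<in> carrier ?N"
        note v' = L.mat_image_idem[OF FL v]
        from v'(1) have "v \<in> {..<n} \<rightarrow> carrier ?L" by (simp add: PiE_iff Pi_iff)
        then obtain s b where s: "s \<in> S" and b: "b \<in> {..<n} \<rightarrow> carrier R"
          and vb: "\<forall>i<n. v i = rfrac (b i) s"
          by (rule common_denominator)
        have "v = vec b s"
          using v'(1) vb by (auto simp: vec_def fun_eq_iff PiE_iff extensional_def)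
        then have "v = vec (mat_vec R n n F b) s"
          using v'(2) vec_mult[OF b s] by simp
        also have "mat_vec R n n F b = mat_vec R n n F (restrict b {..<n})"
          unfolding mat_vec_def using F'(1) b by (intro restrict_ext finsum_cong') (auto simp: Pi_iff)
        finally have v_eq: "v = vec (mat_vec R n n F (restrict b {..<n})) s" .
        have "restrict b {..<n} \<in> vecs R n"
          by (rule restrict_PiE_iff[THEN iffD2]) (use b in auto)
        then have x: "mat_vec R n n F (restrict b {..<n}) \<in> carrier ?M"
          unfolding carrier_mat_image by (rule imageI)
        show "v \<in> case_prod vec ` (carrier ?M \<times> S)"
          by (rule rev_image_eqI[of "(mat_vec R n n F (restrict b {..<n}), s)"]) (use x s v_eq in simp_all)
      qed
    qed
  next
    fix x y s t assume x: "x \<in> carrier ?M" "s \<in> S" and y: "y \<in> carrier ?M" "t \<in> S"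
    show "vec (t \<odot>\<^bsub>?M\<^esub> x \<oplus>\<^bsub>?M\<^esub> s \<odot>\<^bsub>?M\<^esub> y) (s \<otimes> t) = vec x s \<oplus>\<^bsub>?N\<^esub> vec y t"
      unfolding vec_def add_mat_image using x y M[OF x(1)] M[OF y(1)] by (intro restrict_ext) (simp add: add_rfrac)
  next
    fix a x s t assume a: "a \<in> carrier R" "s \<in> S" and x: "x \<in> carrier ?M" "t \<in> S"
    show "vec (a \<odot>\<^bsub>?M\<^esub> x) (s \<otimes> t) = rfrac a s \<odot>\<^bsub>?N\<^esub> vec x t"
      unfolding vec_def smult_mat_image using a x M[OF x(1)] by (intro restrict_ext) (simp add: mult_rfrac)
  qed
qed

end

lemma (in cring) localization_powers_of:
  assumes "s \<in> carrier R"
  shows "localization R (powers_of R s)"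
proof
  show "powers_of R s \<subseteq> carrier R" using assms by (auto simp: powers_of_def)
  show "\<one> \<in> powers_of R s" by (auto simp: powers_of_def intro: exI[of _ "0::nat"])
  show "a \<otimes> b \<in> powers_of R s" if "a \<in> powers_of R s" "b \<in> powers_of R s" for a b
    using that assms by (auto simp: powers_of_def nat_pow_mult)
qed


section \<open>The localizations of the image of a projection matrix\<close>

text \<open>
  By orthogonality, \<open>r_j = r_j * 1 = r_j r_k = 0\<close> for \<open>j \<noteq> k\<close> as soon as \<open>r_k\<close> is \<open>1\<close>.
\<close>

lemma (in ring_hom_cring) hom_rank_coeff_eq:
  assumes F: "idem_mat R n F" and k: "k \<le> n" and one: "h (rank_coeff R n F k) = \<one>\<^bsub>S\<^esub>"
  shows "rank_coeff S n (\<lambda>i j. h (F i j)) j = (if j = k then \<one>\<^bsub>S\<^esub> else \<zero>\<^bsub>S\<^esub>)"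
proof -
  let ?r = "rank_coeff R n F"
  note F' = R.idem_matD(1)[OF F]
  have r: "?r j \<in> carrier R" for j using F' by simp
  have "h (?r j) = \<zero>\<^bsub>S\<^esub>" if "j \<noteq> k"
  proof (cases "j \<le> n")
    case True
    have "h (?r j) = h (?r j \<otimes> ?r k)" using one r by simp
    also have "?r j \<otimes> ?r k = \<zero>" using R.rank_coeff_orthogonal[OF F True k] that by simp
    finally show ?thesis by simp
  next
    case False
    then show ?thesis using R.rank_coeff_above[OF F'] by simp
  qed
  then show ?thesis using one hom_rank_coeff[OF F', of j] by auto
qed

context cring
begin

lemma idem_mat_smult:
  assumes F: "idem_mat R n F" and r: "r \<in> carrier R" "r \<otimes> r = r"
  shows "idem_mat R n (\<lambda>i j. r \<otimes> F i j)"
proof -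
  note F' = idem_matD[OF F]
  have "(\<Oplus>l\<in>{..<n}. (r \<otimes> F i l) \<otimes> (r \<otimes> F l j)) = r \<otimes> F i j" if ij: "i < n" "j < n" for i j
  proof -
    have c: "F i l \<in> carrier R" "F l j \<in> carrier R" if "l < n" for l
      using that ij F'(1) by (auto simp: Pi_iff)
    have "(r \<otimes> F i l) \<otimes> (r \<otimes> F l j) = r \<otimes> (F i l \<otimes> F l j)" if "l < n" for l
    proof -
      have "(r \<otimes> F i l) \<otimes> (r \<otimes> F l j) = (r \<otimes> r) \<otimes> (F i l \<otimes> F l j)"
        using c[OF that] r(1) by (simp add: m_ac)
      then show ?thesis by (simp only: r(2))
    qed
    then have "(\<Oplus>l\<in>{..<n}. (r \<otimes> F i l) \<otimes> (r \<otimes> F l j)) = (\<Oplus>l\<in>{..<n}. r \<otimes> (F i l \<otimes> F l j))"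
      using c r(1) by (intro finsum_cong') auto
    also have "\<dots> = r \<otimes> (\<Oplus>l\<in>{..<n}. F i l \<otimes> F l j)"
      using c r(1) by (intro finsum_rdistr[symmetric]) auto
    finally show ?thesis using F'(2)[OF ij] by simp
  qed
  then show ?thesis unfolding idem_mat_def using F'(1) r(1) by (auto simp: Pi_iff)
qed

text \<open>
  For an idempotent \<open>r\<close>, multiplication by \<open>r\<close> is a homomorphism onto the ideal with unit \<open>r\<close>.
\<close>

lemma idem_ring_hom:
  assumes r: "r \<in> carrier R" "r \<otimes> r = r"
  shows "ring_hom_cring R (idem_ring R r) (\<lambda>x. r \<otimes> x)"
proof -
  let ?B = "idem_ring R r"
  have sel: "carrier ?B = (\<lambda>x. x \<otimes> r) ` carrier R" "\<one>\<^bsub>?B\<^esub> = r" "\<zero>\<^bsub>?B\<^esub> = \<zero>"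
    "x \<otimes>\<^bsub>?B\<^esub> y = x \<otimes> y" "x \<oplus>\<^bsub>?B\<^esub> y = x \<oplus> y" for x y
    by (auto simp: idem_ring_def cgenideal_def)
  \<comment> \<open>Elements of the ideal are recognized as the fixed points of \<open>r\<close>.\<close>
  have carr: "a \<in> carrier ?B \<longleftrightarrow> a \<in> carrier R \<and> r \<otimes> a = a" for a
  proof
    assume "a \<in> carrier ?B"
    then obtain x where x: "x \<in> carrier R" "a = x \<otimes> r" unfolding sel by auto
    have "r \<otimes> a = x \<otimes> (r \<otimes> r)" using x r(1) by (simp add: m_ac)
    then show "a \<in> carrier R \<and> r \<otimes> a = a" using x r by simp
  next
    assume "a \<in> carrier R \<and> r \<otimes> a = a"
    then show "a \<in> carrier ?B" unfolding sel using r(1) by (metis image_eqI m_comm)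
  qed
  have "cring ?B"
  proof (rule cringI)
    show "abelian_group ?B"
    proof (rule abelian_groupI)
      fix x assume "x \<in> carrier ?B"
      then show "\<exists>y\<in>carrier ?B. y \<oplus>\<^bsub>?B\<^esub> x = \<zero>\<^bsub>?B\<^esub>"
        using r(1) by (intro bexI[of _ "\<ominus> x"]) (simp_all add: carr sel(2-5) r_minus l_neg)
    qed (use r(1) in \<open>simp_all add: carr sel(2-5) r_distr a_ac\<close>)
    show "comm_monoid ?B"
    proof (rule comm_monoidI)
      fix x y assume "x \<in> carrier ?B" "y \<in> carrier ?B"
      then show "x \<otimes>\<^bsub>?B\<^esub> y \<in> carrier ?B"
        using r(1) by (simp add: carr sel(2-5) m_assoc[symmetric])
    qed (use r in \<open>simp_all add: carr sel(2-5) m_ac\<close>)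
  qed (simp add: carr sel(2-5) l_distr)
  moreover have "(\<lambda>x. r \<otimes> x) \<in> ring_hom R ?B"
  proof (rule ring_hom_memI)
    fix x y assume xy: "x \<in> carrier R" "y \<in> carrier R"
    have "r \<otimes> (r \<otimes> x) = (r \<otimes> r) \<otimes> x" using xy r(1) by (simp add: m_assoc)
    then show "r \<otimes> x \<in> carrier ?B" using xy r by (simp add: carr)
    have "(r \<otimes> x) \<otimes> (r \<otimes> y) = (r \<otimes> r) \<otimes> (x \<otimes> y)" using xy r(1) by (simp add: m_ac)
    then show "r \<otimes> (x \<otimes> y) = (r \<otimes> x) \<otimes>\<^bsub>?B\<^esub> (r \<otimes> y)" using r by (simp add: sel(2-5))
    show "r \<otimes> (x \<oplus> y) = r \<otimes> x \<oplus>\<^bsub>?B\<^esub> r \<otimes> y" using xy r(1) by (simp add: sel(2-5) r_distr)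
  qed (use r(1) in \<open>simp add: sel(2-5)\<close>)
  ultimately show ?thesis by (intro ring_hom_cringI is_cring)
qed

lemma rank_coeff_idem:
  assumes F: "idem_mat R n F" and k: "k \<le> n"
  shows "rank_coeff R n F k \<otimes> rank_coeff R n F k = rank_coeff R n F k"
  using rank_coeff_orthogonal[OF F k k] by simp

lemma projective_of_rank_idem_ring:
  assumes F: "idem_mat R n F" and k: "k \<le> n"
  defines "r \<equiv> rank_coeff R n F k"
  shows "projective_of_rank (idem_ring R r) (mat_image (idem_ring R r) n (\<lambda>i j. r \<otimes> F i j)) k"
proof -
  have r: "r \<in> carrier R" "r \<otimes> r = r"
    unfolding r_def using idem_matD(1)[OF F] rank_coeff_idem[OF F k] by simp_all
  interpret h: ring_hom_cring R "idem_ring R r" "\<lambda>x. r \<otimes> x" by (rule idem_ring_hom[OF r])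
  have "r \<otimes> rank_coeff R n F k = \<one>\<^bsub>idem_ring R r\<^esub>"
    using r(2) unfolding r_def by (simp add: idem_ring_def)
  then show ?thesis
    by (intro h.S.mat_image_projective_of_rank h.hom_idem_mat[OF F] h.hom_rank_coeff_eq[OF F k])
qed

text \<open>
  The factor \<open>r\<close> in the entries disappears over the ring of fractions, where \<open>r\<close> is \<open>1\<close> because
  \<open>r * r = r * 1\<close>.
\<close>

lemma projective_of_rank_loc_ring:
  assumes F: "idem_mat R n F" and k: "k \<le> n"
  defines "r \<equiv> rank_coeff R n F k"
  shows "projective_of_rank (loc_ring_at R r)
    (mat_image (loc_ring_at R r) n (\<lambda>i j. ring_frac R (powers_of R r) (r \<otimes> F i j) \<one>)) k"
proof -
  note F' = idem_matD(1)[OF F]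
  have r: "r \<in> carrier R" "r \<otimes> r = r"
    unfolding r_def using F' rank_coeff_idem[OF F k] by simp_all
  interpret loc: localization R "powers_of R r" by (rule localization_powers_of[OF r(1)])
  interpret h: ring_hom_cring R "loc_ring_at R r" "\<lambda>a. ring_frac R (powers_of R r) a \<one>"
    by (rule loc.loc_ring_hom)
  let ?L = "loc_ring_at R r" and ?h = "\<lambda>a. ring_frac R (powers_of R r) a \<one>"
  have "r \<in> powers_of R r" using r(1) by (auto simp: powers_of_def intro!: exI[of _ "1::nat"])
  then have "?h r = \<one>\<^bsub>?L\<^esub>"
    unfolding loc.loc_ring_simps(5) using r
    by (subst loc.self.frac_eq_iff) (auto intro!: bexI[of _ r])
  then have hr: "?h (rank_coeff R n F k) = \<one>\<^bsub>?L\<^esub>" unfolding r_def .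
  have "rank_coeff ?L n (\<lambda>i j. ?h (r \<otimes> F i j)) = rank_coeff ?L n (\<lambda>i j. ?h (F i j))"
    using F' r(1) \<open>?h r = \<one>\<^bsub>?L\<^esub>\<close> by (intro h.S.rank_coeff_cong[OF h.hom_matrix[OF F']]) (auto simp: Pi_iff)
  then show ?thesis
    using h.hom_rank_coeff_eq[OF F k hr]
    by (intro h.S.mat_image_projective_of_rank h.hom_idem_mat idem_mat_smult[OF F r]) simp
qed

text \<open>
  The product \<open>s\<close> of \<open>r_k\<close> and the minor becomes invertible. An invertible idempotent is \<open>1\<close>, so \<open>r_k\<close>
  becomes \<open>1\<close>, and the minor becomes invertible.
\<close>

lemma minor_localization_free:
  assumes F: "idem_mat R n F" and I: "I \<subseteq> {..<n}" "card I = k"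
  defines "s \<equiv> rank_coeff R n F k \<otimes> det_on R I F"
  shows "free_of_rank (loc_ring_at R s) (loc_module_at R s (mat_image R n F)) k"
    and "modules_iso (loc_ring_at R s) (loc_module_at R s (mat_image R n F)) (std_module (loc_ring_at R s) k)"
proof -
  note F' = idem_matD(1)[OF F]
  let ?r = "rank_coeff R n F k" and ?t = "det_on R I F"
  have "card I \<le> card {..<n}" using I(1) by (intro card_mono) auto
  then have k: "k \<le> n" using I(2) by simp
  have rt: "?r \<in> carrier R" "?t \<in> carrier R" using F' minor_closed[OF F' I(1)] by simp_all
  then have s: "s \<in> carrier R" unfolding s_def by simp
  interpret loc: localization R "powers_of R s" by (rule localization_powers_of[OF s])
  interpret h: ring_hom_cring R "loc_ring_at R s" "\<lambda>a. ring_frac R (powers_of R s) a \<one>"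
    by (rule loc.loc_ring_hom)
  interpret M: localization_module R "powers_of R s" "mat_image R n F"
    by (intro localization_module.intro loc.localization_axioms mat_image_module F')
  let ?L = "loc_ring_at R s" and ?h = "\<lambda>a. ring_frac R (powers_of R s) a \<one>"
  let ?y = "ring_frac R (powers_of R s) \<one> s"
  have sS: "s \<in> powers_of R s" using s by (auto simp: powers_of_def intro!: exI[of _ "1::nat"])
  have y: "?y \<in> carrier ?L" by (rule loc.rfrac_closed[OF one_closed sS])
  have "?h s \<otimes>\<^bsub>?L\<^esub> ?y = ring_frac R (powers_of R s) s s"
    by (rule loc.rfrac_eq_mult[OF s sS, symmetric])
  also have "\<dots> = \<one>\<^bsub>?L\<^esub>"
    unfolding loc.loc_ring_simps(5) using s sS by (intro loc.rfrac_eqI) auto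
  finally have hsy: "?h s \<otimes>\<^bsub>?L\<^esub> ?y = \<one>\<^bsub>?L\<^esub>" .
  have "?h (?r \<otimes> ?t) = ?h ?r \<otimes>\<^bsub>?L\<^esub> ?h ?t" by (rule h.hom_mult[OF rt])
  then have "?h s = ?h ?r \<otimes>\<^bsub>?L\<^esub> ?h ?t" by (simp only: s_def)
  with hsy have hs: "?h ?r \<otimes>\<^bsub>?L\<^esub> ?h ?t \<otimes>\<^bsub>?L\<^esub> ?y = \<one>\<^bsub>?L\<^esub>" by (simp only:)
  have hc: "?h ?r \<in> carrier ?L" "?h ?t \<in> carrier ?L" using rt by (simp_all only: h.hom_closed)
  have "?h ?r = ?h ?r \<otimes>\<^bsub>?L\<^esub> (?h ?r \<otimes>\<^bsub>?L\<^esub> ?h ?t \<otimes>\<^bsub>?L\<^esub> ?y)"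
    unfolding hs by (rule h.S.r_one[OF hc(1), symmetric])
  also have "\<dots> = (?h ?r \<otimes>\<^bsub>?L\<^esub> ?h ?r) \<otimes>\<^bsub>?L\<^esub> ?h ?t \<otimes>\<^bsub>?L\<^esub> ?y"
    using hc y by (simp only: h.S.m_assoc h.S.m_closed)
  also have "?h ?r \<otimes>\<^bsub>?L\<^esub> ?h ?r = ?h ?r"
    using h.hom_mult[OF rt(1) rt(1)] rank_coeff_idem[OF F k] by simp
  finally have hr: "?h ?r = \<one>\<^bsub>?L\<^esub>" unfolding hs .
  have "?y \<otimes>\<^bsub>?L\<^esub> ?h ?t = \<one>\<^bsub>?L\<^esub>"
    using hs hc y unfolding hr by (simp only: h.S.l_one h.S.m_comm)
  then have "?y \<otimes>\<^bsub>?L\<^esub> det_on ?L I (\<lambda>i j. ?h (F i j)) = \<one>\<^bsub>?L\<^esub>"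
    by (simp only: h.hom_minor[OF F' I(1)])
  then have "modules_iso ?L (mat_image ?L n (\<lambda>i j. ?h (F i j))) (std_module ?L k)"
    by (rule h.S.mat_image_free_unit_minor[OF h.hom_idem_mat[OF F] h.hom_rank_coeff_eq[OF F k hr] I y])
  with loc.loc_module_mat_image_iso[OF F]
  show iso: "modules_iso ?L (loc_module_at R s (mat_image R n F)) (std_module ?L k)"
    by (rule modules_iso_trans)
  then show "free_of_rank ?L (loc_module_at R s (mat_image R n F)) k"
    unfolding free_of_rank_def using M.module_loc_module by blast
qed

lemma sum_minors:
  assumes F: "idem_mat R n F" and k: "k \<le> n"
  shows "(\<Oplus>I\<in>{I. I \<subseteq> {..<n} \<and> card I = k}. rank_coeff R n F k \<otimes> det_on R I F) = rank_coeff R n F k"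
proof -
  note F' = idem_matD(1)[OF F]
  have "rank_coeff R n F k \<otimes> minor_sum R n F k =
      (\<Oplus>I\<in>{I. I \<subseteq> {..<n} \<and> card I = k}. rank_coeff R n F k \<otimes> det_on R I F)"
    unfolding minor_sum_def using F' minor_closed[OF F'] by (intro finsum_rdistr) auto
  then show ?thesis using rank_coeff_mult_minor_sum[OF F k] by simp
qed


section \<open>Projective modules and idempotent matrices\<close>

text \<open>
  Used with values in an arbitrary module, where no matrix describes the maps.
\<close>

lemma linear_eq_on_basis:
  fixes m :: nat
  assumes N: "Module.module R N"
    and f: "\<And>x. x \<in> vecs R m \<Longrightarrow> f x \<in> carrier N"
      "\<And>x y. x \<in> vecs R m \<Longrightarrow> y \<in> vecs R m \<Longrightarrow>
        f (\<lambda>i\<in>{..<m}. x i \<oplus> y i) = f x \<oplus>\<^bsub>N\<^esub> f y"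
      "\<And>a x. a \<in> carrier R \<Longrightarrow> x \<in> vecs R m \<Longrightarrow> f (\<lambda>i\<in>{..<m}. a \<otimes> x i) = a \<odot>\<^bsub>N\<^esub> f x"
    and g: "\<And>x. x \<in> vecs R m \<Longrightarrow> g x \<in> carrier N"
      "\<And>x y. x \<in> vecs R m \<Longrightarrow> y \<in> vecs R m \<Longrightarrow>
        g (\<lambda>i\<in>{..<m}. x i \<oplus> y i) = g x \<oplus>\<^bsub>N\<^esub> g y"
      "\<And>a x. a \<in> carrier R \<Longrightarrow> x \<in> vecs R m \<Longrightarrow> g (\<lambda>i\<in>{..<m}. a \<otimes> x i) = a \<odot>\<^bsub>N\<^esub> g x"
    and eq: "\<And>j. j < m \<Longrightarrow> f (\<lambda>i\<in>{..<m}. if i = j then \<one> else \<zero>) = g (\<lambda>i\<in>{..<m}. if i = j then \<one> else \<zero>)"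
    and x: "x \<in> vecs R m"
  shows "f x = g x"
proof -
  interpret N: Module.module R N by fact
  have "f (\<lambda>i\<in>{..<m}. if i < k then x i else \<zero>) = g (\<lambda>i\<in>{..<m}. if i < k then x i else \<zero>)" if "k \<le> m" for k :: nat
    using that
  proof (induction k)
    case 0
    let ?z = "\<lambda>i\<in>{..<m}. \<zero>"
    have z: "?z \<in> vecs R m" by (rule restrict_PiE_iff[THEN iffD2]) simp
    have "(\<lambda>i\<in>{..<m}. \<zero> \<otimes> ?z i) = ?z" by (rule restrict_ext) simp
    then have "f ?z = g ?z"
      using f(3)[OF zero_closed z] g(3)[OF zero_closed z] N.smult_l_null[OF f(1)[OF z]] N.smult_l_null[OF g(1)[OF z]]
      by (simp only:)
    then show ?case by (simp only: not_less_zero if_False)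
  next
    case (Suc k)
    let ?y = "\<lambda>i\<in>{..<m}. if i < k then x i else \<zero>" and ?e = "\<lambda>i\<in>{..<m}. if i = k then \<one> else \<zero>"
    have k: "k < m" and xk: "x k \<in> carrier R" using x Suc.prems by (auto simp: PiE_iff)
    have y: "?y \<in> vecs R m"
      by (rule restrict_PiE_iff[THEN iffD2]) (use x in \<open>auto simp: PiE_iff\<close>)
    have e: "?e \<in> vecs R m" by (rule restrict_PiE_iff[THEN iffD2]) simp
    have xe: "(\<lambda>i\<in>{..<m}. x k \<otimes> ?e i) \<in> vecs R m"
      by (rule restrict_PiE_iff[THEN iffD2]) (use xk in simp)
    have "(\<lambda>i\<in>{..<m}. if i < Suc k then x i else \<zero>) = (\<lambda>i\<in>{..<m}. ?y i \<oplus> (\<lambda>i\<in>{..<m}. x k \<otimes> ?e i) i)"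
      using x xk by (intro restrict_ext) (auto simp: PiE_iff less_Suc_eq)
    then show ?case
      using f(2)[OF y xe] g(2)[OF y xe] f(3)[OF xk e] g(3)[OF xk e] eq[OF k] Suc.IH[OF Suc_leD[OF Suc.prems]]
      by (simp only:)
  qed
  moreover have "(\<lambda>i\<in>{..<m}. if i < m then x i else \<zero>) = x"
    using x by (auto simp: PiE_iff extensional_def fun_eq_iff)
  ultimately show ?thesis by (metis order_refl)
qed

text \<open>
  The summand in \<open>U\<close> of the decomposition of a vector along \<open>U\<close> and \<open>V\<close>, which is unique because the
  intersection is zero.
\<close>

lemma direct_summand_projection:
  assumes U: "submodule U R (std_module R m)" and V: "submodule V R (std_module R m)"
    and sum: "U <+>\<^bsub>std_module R m\<^esub> V = carrier (std_module R m)"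
    and inter: "U \<inter> V = {\<zero>\<^bsub>std_module R m\<^esub>}"
  obtains \<pi> where "\<And>w. w \<in> vecs R m \<Longrightarrow> \<pi> w \<in> U" "\<And>w. w \<in> U \<Longrightarrow> \<pi> w = w"
    and "\<And>v w. v \<in> vecs R m \<Longrightarrow> w \<in> vecs R m \<Longrightarrow>
      \<pi> (\<lambda>i\<in>{..<m}. v i \<oplus> w i) = \<pi> v \<oplus>\<^bsub>std_module R m\<^esub> \<pi> w"
    and "\<And>a w. a \<in> carrier R \<Longrightarrow> w \<in> vecs R m \<Longrightarrow>
      \<pi> (\<lambda>i\<in>{..<m}. a \<otimes> w i) = a \<odot>\<^bsub>std_module R m\<^esub> \<pi> w"
proof -
  let ?S = "std_module R m"
  interpret S: Module.module R ?S by (rule std_module_module)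
  note U' = S.submoduleE[OF U] and V' = S.submoduleE[OF V]
  have UV: "u \<in> carrier ?S" if "u \<in> U \<or> u \<in> V" for u using that U'(1) V'(1) by blast
  define \<pi> where "\<pi> w = (SOME u. u \<in> U \<and> (\<exists>v\<in>V. w = u \<oplus>\<^bsub>?S\<^esub> v))" for w
  have unique: "u = u'" if "u \<in> U" "u' \<in> U" "v \<in> V" "v' \<in> V" "u \<oplus>\<^bsub>?S\<^esub> v = u' \<oplus>\<^bsub>?S\<^esub> v'" for u u' v v'
  proof -
    have c: "u \<in> carrier ?S" "u' \<in> carrier ?S" "v \<in> carrier ?S" "v' \<in> carrier ?S" using that UV by blast+
    have "u \<ominus>\<^bsub>?S\<^esub> u' = (u \<oplus>\<^bsub>?S\<^esub> v) \<ominus>\<^bsub>?S\<^esub> v \<ominus>\<^bsub>?S\<^esub> u'"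
      using c by (simp del: add_std_module carrier_std_module zero_std_module add: S.M.minus_eq S.M.a_assoc S.M.r_neg)
    also have "\<dots> = v' \<oplus>\<^bsub>?S\<^esub> (u' \<oplus>\<^bsub>?S\<^esub> (\<ominus>\<^bsub>?S\<^esub> u' \<oplus>\<^bsub>?S\<^esub> \<ominus>\<^bsub>?S\<^esub> v))"
      unfolding that(5) using c
      by (simp del: add_std_module carrier_std_module zero_std_module add: S.M.minus_eq S.M.a_ac)
    also have "\<dots> = v' \<ominus>\<^bsub>?S\<^esub> v"
      using c by (simp del: add_std_module carrier_std_module zero_std_module add: S.M.minus_eq S.M.r_neg2)
    finally have uv: "u \<ominus>\<^bsub>?S\<^esub> u' = v' \<ominus>\<^bsub>?S\<^esub> v" .
    have "u \<ominus>\<^bsub>?S\<^esub> u' \<in> U" unfolding S.M.minus_eq by (rule U'(5)[OF that(1) U'(3)[OF that(2)]])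
    moreover have "v' \<ominus>\<^bsub>?S\<^esub> v \<in> V" unfolding S.M.minus_eq by (rule V'(5)[OF that(4) V'(3)[OF that(3)]])
    then have "u \<ominus>\<^bsub>?S\<^esub> u' \<in> V" by (simp only: uv)
    ultimately have "u \<ominus>\<^bsub>?S\<^esub> u' \<in> U \<inter> V" by blast
    then have "u \<ominus>\<^bsub>?S\<^esub> u' = \<zero>\<^bsub>?S\<^esub>" using inter by blast
    then have "\<ominus>\<^bsub>?S\<^esub> (\<ominus>\<^bsub>?S\<^esub> u') = u"
      unfolding S.M.minus_eq using c by (intro S.M.minus_equality S.M.a_inv_closed)
    then show ?thesis using S.M.minus_minus[OF c(2)] by (simp only:)
  qed
  have ex: "\<exists>u. u \<in> U \<and> (\<exists>v\<in>V. w = u \<oplus>\<^bsub>?S\<^esub> v)" if "w \<in> carrier ?S" for w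
  proof -
    have "w \<in> U <+>\<^bsub>?S\<^esub> V" using that by (simp only: sum)
    then show ?thesis by (auto simp: set_add_def set_mult_def simp del: add_std_module)
  qed
  have \<pi>: "\<pi> w \<in> U \<and> (\<exists>v\<in>V. w = \<pi> w \<oplus>\<^bsub>?S\<^esub> v)" if "w \<in> carrier ?S" for w
    unfolding \<pi>_def using ex[OF that] by (rule someI_ex)
  have \<pi>_eq: "\<pi> (u \<oplus>\<^bsub>?S\<^esub> v) = u" if "u \<in> U" "v \<in> V" for u v
  proof -
    have "u \<oplus>\<^bsub>?S\<^esub> v \<in> carrier ?S" using UV that S.M.a_closed by blast
    from \<pi>[OF this] obtain v' where "\<pi> (u \<oplus>\<^bsub>?S\<^esub> v) \<in> U" "v' \<in> V" "u \<oplus>\<^bsub>?S\<^esub> v = \<pi> (u \<oplus>\<^bsub>?S\<^esub> v) \<oplus>\<^bsub>?S\<^esub> v'" by blast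
    from unique[OF that(1) this(1) that(2) this(2,3)] show ?thesis by (rule sym)
  qed
  show thesis
  proof (rule that[of \<pi>])
    show "\<pi> w \<in> U" if "w \<in> vecs R m" for w using \<pi>[of w] that by simp
    show "\<pi> w = w" if "w \<in> U" for w
    proof -
      have "\<zero>\<^bsub>?S\<^esub> \<in> V" using inter by blast
      then have "\<pi> (w \<oplus>\<^bsub>?S\<^esub> \<zero>\<^bsub>?S\<^esub>) = w" by (rule \<pi>_eq[OF that])
      moreover have "w \<oplus>\<^bsub>?S\<^esub> \<zero>\<^bsub>?S\<^esub> = w" using UV that by (intro S.M.r_zero) blast
      ultimately show ?thesis by (simp only:)
    qed
    show "\<pi> (\<lambda>i\<in>{..<m}. v i \<oplus> w i) = \<pi> v \<oplus>\<^bsub>?S\<^esub> \<pi> w"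
      if "v \<in> vecs R m" "w \<in> vecs R m" for v w
    proof -
      from that have "v \<in> carrier ?S" "w \<in> carrier ?S" by simp_all
      then obtain v' w' where v': "v' \<in> V" "v = \<pi> v \<oplus>\<^bsub>?S\<^esub> v'" "\<pi> v \<in> U" and w': "w' \<in> V" "w = \<pi> w \<oplus>\<^bsub>?S\<^esub> w'" "\<pi> w \<in> U"
        using \<pi> by meson
      have "v \<oplus>\<^bsub>?S\<^esub> w = (\<pi> v \<oplus>\<^bsub>?S\<^esub> v') \<oplus>\<^bsub>?S\<^esub> (\<pi> w \<oplus>\<^bsub>?S\<^esub> w')" using v'(2) w'(2) by (simp only:)
      also have "\<dots> = (\<pi> v \<oplus>\<^bsub>?S\<^esub> \<pi> w) \<oplus>\<^bsub>?S\<^esub> (v' \<oplus>\<^bsub>?S\<^esub> w')"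
        using UV[of "\<pi> v"] UV[of "\<pi> w"] UV[of v'] UV[of w'] v'(1,3) w'(1,3)
        by (simp del: add_std_module carrier_std_module zero_std_module add: S.M.a_ac)
      finally have "\<pi> (v \<oplus>\<^bsub>?S\<^esub> w) = \<pi> v \<oplus>\<^bsub>?S\<^esub> \<pi> w"
        using \<pi>_eq[OF U'(5)[OF v'(3) w'(3)] V'(5)[OF v'(1) w'(1)]] by (simp only:)
      then show ?thesis by (simp only: add_std_module)
    qed
    show "\<pi> (\<lambda>i\<in>{..<m}. a \<otimes> w i) = a \<odot>\<^bsub>?S\<^esub> \<pi> w"
      if a: "a \<in> carrier R" and w: "w \<in> vecs R m" for a w
    proof -
      from w have "w \<in> carrier ?S" by simp
      then obtain w' where w': "w' \<in> V" "w = \<pi> w \<oplus>\<^bsub>?S\<^esub> w'" "\<pi> w \<in> U" using \<pi> by meson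
      have "a \<odot>\<^bsub>?S\<^esub> w = a \<odot>\<^bsub>?S\<^esub> (\<pi> w \<oplus>\<^bsub>?S\<^esub> w')" using w'(2) by (simp only:)
      also have "\<dots> = a \<odot>\<^bsub>?S\<^esub> \<pi> w \<oplus>\<^bsub>?S\<^esub> a \<odot>\<^bsub>?S\<^esub> w'"
        using UV w' a by (intro S.smult_r_distr) blast+
      finally have "\<pi> (a \<odot>\<^bsub>?S\<^esub> w) = a \<odot>\<^bsub>?S\<^esub> \<pi> w"
        using \<pi>_eq[OF U'(4)[OF a w'(3)] V'(4)[OF a w'(1)]] by (simp only:)
      then show ?thesis by (simp only: smult_std_module)
    qed
  qed
qed

text \<open>
  The generators give a surjection \<open>g\<close> from the standard module of rank \<open>n\<close> onto \<open>N\<close>. Since \<open>N\<close> is a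
  direct summand of a standard module of some rank \<open>m\<close>, the projection onto it lifts through \<open>g\<close> on
  the standard basis, which yields a section \<open>\<sigma>\<close> of \<open>g\<close>. Then \<open>F = \<sigma> g\<close> is idempotent and
  \<open>\<sigma>\<close> is an isomorphism onto its image. The size of \<open>F\<close> is the number \<open>n\<close> of generators,
  whatever \<open>m\<close> is.
\<close>

lemma fg_projective_idem_mat:
  assumes proj: "fg_projective R N" and gen: "generated_by R N n"
  obtains F where "idem_mat R n F" "modules_iso R N (mat_image R n F)"
proof -
  from proj have "Module.module R N" unfolding fg_projective_def by blast
  then interpret N: Module.module R N .
  from proj obtain m U V where U: "submodule U R (std_module R m)" and V: "submodule V R (std_module R m)"
    and UV: "U <+>\<^bsub>std_module R m\<^esub> V = carrier (std_module R m)" "U \<inter> V = {\<zero>\<^bsub>std_module R m\<^esub>}"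
    and iso: "modules_iso R N ((std_module R m)\<lparr>carrier := U\<rparr>)"
    unfolding fg_projective_def by blast
  let ?S = "std_module R m" and ?X = "\<lambda>k::nat. vecs R k" and ?SU = "(std_module R m)\<lparr>carrier := U\<rparr>"
  interpret S: Module.module R ?S by (rule std_module_module)
  have Usub: "U \<subseteq> ?X m" using S.submoduleE(1)[OF U] by simp
  obtain \<pi> where \<pi>U: "\<And>w. w \<in> ?X m \<Longrightarrow> \<pi> w \<in> U" and \<pi>id: "\<And>w. w \<in> U \<Longrightarrow> \<pi> w = w"
    and \<pi>add: "\<And>v w. v \<in> ?X m \<Longrightarrow> w \<in> ?X m \<Longrightarrow> \<pi> (\<lambda>i\<in>{..<m}. v i \<oplus> w i) = \<pi> v \<oplus>\<^bsub>?S\<^esub> \<pi> w"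
    and \<pi>smult: "\<And>a w. a \<in> carrier R \<Longrightarrow> w \<in> ?X m \<Longrightarrow> \<pi> (\<lambda>i\<in>{..<m}. a \<otimes> w i) = a \<odot>\<^bsub>?S\<^esub> \<pi> w"
    using direct_summand_projection[OF U V UV] by blast
  obtain h k where hk: "mutually_inverse R N ?SU h k" "mutually_inverse R ?SU N k h"
    using iso \<open>Module.module R N\<close> by (rule modules_isoE)
  have hU: "h x \<in> U" if "x \<in> carrier N" for x using mutually_inverseD(1)[OF hk(1) that] by simp
  note kh = mutually_inverseD(2)[OF hk(1)]
  have hadd: "h (x \<oplus>\<^bsub>N\<^esub> y) = h x \<oplus>\<^bsub>?S\<^esub> h y" if "x \<in> carrier N" "y \<in> carrier N" for x y
    using mutually_inverseD(3)[OF hk(1) that] by simp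
  have hsmult: "h (a \<odot>\<^bsub>N\<^esub> x) = a \<odot>\<^bsub>?S\<^esub> h x" if "a \<in> carrier R" "x \<in> carrier N" for a x
    using mutually_inverseD(4)[OF hk(1) that] by simp
  have k: "k w \<in> carrier N" if "w \<in> U" for w using mutually_inverseD(1)[OF hk(2)] that by simp
  have kadd: "k (v \<oplus>\<^bsub>?S\<^esub> w) = k v \<oplus>\<^bsub>N\<^esub> k w" if "v \<in> U" "w \<in> U" for v w
    using mutually_inverseD(3)[OF hk(2)] that by simp
  have ksmult: "k (a \<odot>\<^bsub>?S\<^esub> w) = a \<odot>\<^bsub>N\<^esub> k w" if "a \<in> carrier R" "w \<in> U" for a w
    using mutually_inverseD(4)[OF hk(2)] that by simp
  have hX: "h x \<in> ?X m" if "x \<in> carrier N" for x using hU[OF that] Usub by blast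
  from gen obtain e where e: "e \<in> {..<n} \<rightarrow> carrier N"
    and e_gen: "\<And>x. x \<in> carrier N \<Longrightarrow> \<exists>a \<in> {..<n} \<rightarrow> carrier R. x = (\<Oplus>\<^bsub>N\<^esub>i\<in>{..<n}. a i \<odot>\<^bsub>N\<^esub> e i)"
    unfolding generated_by_def by blast
  define g where "g a = (\<Oplus>\<^bsub>N\<^esub>i\<in>{..<n}. a i \<odot>\<^bsub>N\<^esub> e i)" for a
  have e': "e i \<in> carrier N" if "i < n" for i using e that by auto
  have gN: "g a \<in> carrier N" if "a \<in> ?X n" for a
    unfolding g_def using that e' by (intro N.M.finsum_closed) (auto simp: PiE_iff)
  have gadd: "g (\<lambda>i\<in>{..<n}. a i \<oplus> b i) = g a \<oplus>\<^bsub>N\<^esub> g b" if "a \<in> ?X n" "b \<in> ?X n" for a b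
  proof -
    have "g (\<lambda>i\<in>{..<n}. a i \<oplus> b i) = (\<Oplus>\<^bsub>N\<^esub>i\<in>{..<n}. a i \<odot>\<^bsub>N\<^esub> e i \<oplus>\<^bsub>N\<^esub> b i \<odot>\<^bsub>N\<^esub> e i)"
      unfolding g_def using that e' by (intro N.M.finsum_cong') (auto simp: PiE_iff N.smult_l_distr)
    also have "\<dots> = g a \<oplus>\<^bsub>N\<^esub> g b"
      unfolding g_def using that e' by (intro N.M.finsum_addf) (auto simp: PiE_iff)
    finally show ?thesis .
  qed
  have gsmult: "g (\<lambda>i\<in>{..<n}. c \<otimes> a i) = c \<odot>\<^bsub>N\<^esub> g a" if "c \<in> carrier R" "a \<in> ?X n" for c a
  proof -
    have "g (\<lambda>i\<in>{..<n}. c \<otimes> a i) = (\<Oplus>\<^bsub>N\<^esub>i\<in>{..<n}. c \<odot>\<^bsub>N\<^esub> (a i \<odot>\<^bsub>N\<^esub> e i))"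
      unfolding g_def using that e' by (intro N.M.finsum_cong') (auto simp: PiE_iff N.smult_assoc1)
    also have "\<dots> = c \<odot>\<^bsub>N\<^esub> g a"
      unfolding g_def using that e' by (intro N.finsum_smult_ldistr[symmetric]) (auto simp: PiE_iff)
    finally show ?thesis .
  qed
  have gsurj: "\<exists>a\<in>?X n. g a = x" if x: "x \<in> carrier N" for x
  proof -
    from e_gen[OF x] obtain a where a: "a \<in> {..<n} \<rightarrow> carrier R" "x = (\<Oplus>\<^bsub>N\<^esub>i\<in>{..<n}. a i \<odot>\<^bsub>N\<^esub> e i)" by blast
    have "g (restrict a {..<n}) = x"
      unfolding g_def a(2) using a(1) e' by (intro N.M.finsum_cong') (auto simp: Pi_iff)
    moreover have "restrict a {..<n} \<in> ?X n" by (rule restrict_PiE_iff[THEN iffD2]) (use a in auto)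
    ultimately show ?thesis by blast
  qed
  let ?b = "\<lambda>j. \<lambda>i\<in>{..<m}. if i = j then \<one> else \<zero>"
  have b: "?b j \<in> ?X m" for j by (rule restrict_PiE_iff[THEN iffD2]) simp
  have "\<exists>a. \<forall>j. a j \<in> ?X n \<and> g (a j) = k (\<pi> (?b j))"
    using gsurj[OF k[OF \<pi>U[OF b]]] by (intro choice) blast
  then obtain a where a: "\<And>j. a j \<in> ?X n" "\<And>j. g (a j) = k (\<pi> (?b j))" by blast
  define A where "A i j = a j i" for i j
  have A: "A \<in> mats R n m" unfolding A_def using a(1) by (auto simp: PiE_iff)
  have Ab: "mat_vec R n m A (?b j) = a j" if j: "j < m" for j
  proof
    fix i
    show "mat_vec R n m A (?b j) i = a j i"
      using mat_vec_basis[OF A _ j, of i] a(1)[of j]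
      by (cases "i < n") (auto simp: A_def mat_vec_def PiE_iff extensional_def)
  qed
  have gA: "g (mat_vec R n m A w) = k (\<pi> w)" if w: "w \<in> ?X m" for w
  proof (rule linear_eq_on_basis[OF \<open>Module.module R N\<close> _ _ _ _ _ _ _ w])
    show "g (mat_vec R n m A x) \<in> carrier N" if "x \<in> ?X m" for x using gN A that by simp
    show "g (mat_vec R n m A (\<lambda>i\<in>{..<m}. x i \<oplus> y i)) = g (mat_vec R n m A x) \<oplus>\<^bsub>N\<^esub> g (mat_vec R n m A y)"
      if "x \<in> ?X m" "y \<in> ?X m" for x y
      unfolding mat_vec_add[OF A that] by (rule gadd) (use A that in simp_all)
    show "g (mat_vec R n m A (\<lambda>i\<in>{..<m}. c \<otimes> x i)) = c \<odot>\<^bsub>N\<^esub> g (mat_vec R n m A x)"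
      if "c \<in> carrier R" "x \<in> ?X m" for c x
      unfolding mat_vec_smult[OF A that(2,1)] by (rule gsmult) (use A that in simp_all)
    show "k (\<pi> x) \<in> carrier N" if "x \<in> ?X m" for x by (rule k[OF \<pi>U[OF that]])
    show "k (\<pi> (\<lambda>i\<in>{..<m}. x i \<oplus> y i)) = k (\<pi> x) \<oplus>\<^bsub>N\<^esub> k (\<pi> y)" if "x \<in> ?X m" "y \<in> ?X m" for x y
      unfolding \<pi>add[OF that] by (rule kadd[OF \<pi>U[OF that(1)] \<pi>U[OF that(2)]])
    show "k (\<pi> (\<lambda>i\<in>{..<m}. c \<otimes> x i)) = c \<odot>\<^bsub>N\<^esub> k (\<pi> x)" if "c \<in> carrier R" "x \<in> ?X m" for c x
      unfolding \<pi>smult[OF that] by (rule ksmult[OF that(1) \<pi>U[OF that(2)]])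
    show "g (mat_vec R n m A (?b j)) = k (\<pi> (?b j))" if "j < m" for j
      unfolding Ab[OF that] by (rule a(2))
  qed
  define \<sigma> where "\<sigma> x = mat_vec R n m A (h x)" for x
  have \<sigma>X: "\<sigma> x \<in> ?X n" if "x \<in> carrier N" for x unfolding \<sigma>_def by (rule mat_vec_closed[OF A hX[OF that]])
  have g\<sigma>: "g (\<sigma> x) = x" if "x \<in> carrier N" for x
    unfolding \<sigma>_def gA[OF hX[OF that]] \<pi>id[OF hU[OF that]] by (rule kh[OF that])
  have \<sigma>add: "\<sigma> (x \<oplus>\<^bsub>N\<^esub> y) = (\<lambda>i\<in>{..<n}. \<sigma> x i \<oplus> \<sigma> y i)" if "x \<in> carrier N" "y \<in> carrier N" for x y
    unfolding \<sigma>_def hadd[OF that] add_std_module by (rule mat_vec_add[OF A hX[OF that(1)] hX[OF that(2)]])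
  have \<sigma>smult: "\<sigma> (c \<odot>\<^bsub>N\<^esub> x) = (\<lambda>i\<in>{..<n}. c \<otimes> \<sigma> x i)" if "c \<in> carrier R" "x \<in> carrier N" for c x
    unfolding \<sigma>_def hsmult[OF that] smult_std_module by (rule mat_vec_smult[OF A hX[OF that(2)] that(1)])
  obtain F where F: "F \<in> mats R n n" and F\<sigma>: "\<And>x. x \<in> ?X n \<Longrightarrow> \<sigma> (g x) = mat_vec R n n F x"
  proof (rule linear_mat_vec_ex[of n "\<lambda>x. \<sigma> (g x)" n])
    show "\<sigma> (g x) \<in> ?X n" if "x \<in> ?X n" for x by (rule \<sigma>X[OF gN[OF that]])
    show "\<sigma> (g (\<lambda>i\<in>{..<n}. x i \<oplus> y i)) = (\<lambda>i\<in>{..<n}. \<sigma> (g x) i \<oplus> \<sigma> (g y) i)" if "x \<in> ?X n" "y \<in> ?X n" for x y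
      unfolding gadd[OF that] by (rule \<sigma>add[OF gN[OF that(1)] gN[OF that(2)]])
    show "\<sigma> (g (\<lambda>i\<in>{..<n}. c \<otimes> x i)) = (\<lambda>i\<in>{..<n}. c \<otimes> \<sigma> (g x) i)" if "c \<in> carrier R" "x \<in> ?X n" for c x
      unfolding gsmult[OF that] by (rule \<sigma>smult[OF that(1) gN[OF that(2)]])
  qed blast
  have FF: "mat_vec R n n F (mat_vec R n n F x) = mat_vec R n n F x" if x: "x \<in> ?X n" for x
    unfolding F\<sigma>[OF x, symmetric] F\<sigma>[OF \<sigma>X[OF gN[OF x]], symmetric] g\<sigma>[OF gN[OF x]] ..
  let ?FF = "\<lambda>i j. \<Oplus>l\<in>{..<n}. F i l \<otimes> F l j"
  have FFc: "?FF \<in> mats R n n" using F by (auto simp: Pi_iff intro!: finsum_closed)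
  have "?FF i j = F i j" if "i < n" "j < n" for i j
    using FF mat_vec_mat_vec[OF F F] that by (intro mat_vec_inj[OF FFc F]) simp_all
  then have idem: "idem_mat R n F" unfolding idem_mat_def using F by (auto simp: Pi_iff)
  have "modules_iso R N (mat_image R n F)"
    unfolding modules_iso_def
  proof (intro exI[of _ \<sigma>] conjI ballI)
    show "bij_betw \<sigma> (carrier N) (carrier (mat_image R n F))"
    proof (rule bij_betw_byWitness[where f' = g])
      show "\<forall>x\<in>carrier N. g (\<sigma> x) = x" using g\<sigma> by blast
      show "\<forall>y\<in>carrier (mat_image R n F). \<sigma> (g y) = y"
        using mat_image_idem[OF idem] F\<sigma> by simp
      show "\<sigma> ` carrier N \<subseteq> carrier (mat_image R n F)"
      proof
        fix y assume "y \<in> \<sigma> ` carrier N"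
        then obtain x where x: "x \<in> carrier N" "y = \<sigma> x" by blast
        have "mat_vec R n n F y = y" unfolding x(2) F\<sigma>[OF \<sigma>X[OF x(1)], symmetric] g\<sigma>[OF x(1)] ..
        then show "y \<in> carrier (mat_image R n F)" using \<sigma>X x by (intro mat_image_idemI) auto
      qed
      show "g ` carrier (mat_image R n F) \<subseteq> carrier N"
        using mat_image_idem(1)[OF idem] gN by blast
    qed
  qed (simp_all add: \<sigma>add \<sigma>smult)
  with idem show thesis by (rule that)
qed

end


section \<open>The local structure theorem\<close>

context cring
begin

lemma Un_minors: "(\<Union>k\<in>{..n}. {I. I \<subseteq> {..<n} \<and> card I = k}) = Pow {..<n::nat}"
  using card_mono[of "{..<n}"] by auto

lemma sum_all_minors:
  assumes F: "idem_mat R n F"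
  shows "(\<Oplus>k\<in>{..n}. \<Oplus>I\<in>{I. I \<subseteq> {..<n} \<and> card I = k}. rank_coeff R n F k \<otimes> det_on R I F) = \<one>"
proof -
  note F' = idem_matD(1)[OF F]
  have "(\<Oplus>k\<in>{..n}. \<Oplus>I\<in>{I. I \<subseteq> {..<n} \<and> card I = k}. rank_coeff R n F k \<otimes> det_on R I F) =
      (\<Oplus>k\<in>{..n}. rank_coeff R n F k)"
    using F' by (intro finsum_cong') (auto simp: sum_minors[OF F])
  then show ?thesis using sum_rank_coeff[OF F'] by simp
qed

text \<open>
  The same sum without the grouping by order, for the enumeration by the subsets of \<open>{..<n}\<close>.
\<close>

lemma sum_all_minors_Pow:
  assumes F: "idem_mat R n F"
  shows "(\<Oplus>I\<in>Pow {..<n}. rank_coeff R n F (card I) \<otimes> det_on R I F) = \<one>"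
proof -
  note F' = idem_matD(1)[OF F]
  let ?s = "\<lambda>I. rank_coeff R n F (card I) \<otimes> det_on R I F"
  have s: "?s I \<in> carrier R" if "I \<subseteq> {..<n}" for I using F' minor_closed[OF F' that] by simp
  have "(\<Oplus>I\<in>(\<Union>k\<in>{..n}. {I. I \<subseteq> {..<n} \<and> card I = k}). ?s I) =
      (\<Oplus>k\<in>{..n}. \<Oplus>I\<in>{I. I \<subseteq> {..<n} \<and> card I = k}. ?s I)"
    using s by (intro add.finprod_UN_disjoint) (auto simp: pairwise_def disjnt_def)
  also have "\<dots> = (\<Oplus>k\<in>{..n}. \<Oplus>I\<in>{I. I \<subseteq> {..<n} \<and> card I = k}. rank_coeff R n F k \<otimes> det_on R I F)"
    using F' minor_closed[OF F'] by (intro finsum_cong' refl Pi_I finsum_closed) auto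
  finally show ?thesis unfolding Un_minors sum_all_minors[OF F] .
qed

text \<open>
  A bijection of \<open>{..<2 ^ n}\<close> with the subsets of \<open>{..<n}\<close> numbers the elements \<open>r_k t\<close>; as their sum
  is \<open>1\<close>, every \<open>x\<close> is the combination with all coefficients equal to \<open>x\<close>.
\<close>

lemma fg_projective_locally_free:
  assumes N: "fg_projective R N" "generated_by R N n"
  shows "\<exists>s \<in> {..<(2::nat) ^ n} \<rightarrow> carrier R.
    {\<Oplus>i\<in>{..<(2::nat) ^ n}. s i \<otimes> a i | a. a \<in> {..<(2::nat) ^ n} \<rightarrow> carrier R} = carrier R \<and>
    (\<forall>i<(2::nat) ^ n. fin_free (loc_ring_at R (s i)) (loc_module_at R (s i) N))"
proof -
  have modN: "Module.module R N" using N(1) unfolding fg_projective_def by blast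
  obtain F where F: "idem_mat R n F" and iso: "modules_iso R N (mat_image R n F)"
    using fg_projective_idem_mat[OF N] .
  note F' = idem_matD(1)[OF F]
  have modM: "Module.module R (mat_image R n F)" by (rule mat_image_module[OF F'])
  let ?s = "\<lambda>I. rank_coeff R n F (card I) \<otimes> det_on R I F" and ?J = "{..<(2::nat) ^ n}"
  have s: "?s I \<in> carrier R" if "I \<subseteq> {..<n}" for I using F' minor_closed[OF F' that] by simp
  have "finite (Pow {..<n})" "card (Pow {..<n}) = 2 ^ n" by (simp_all add: card_Pow)
  then obtain \<phi> where \<phi>: "bij_betw \<phi> ?J (Pow {..<n})"
    using ex_bij_betw_nat_finite[of "Pow {..<n}"] by (auto simp: atLeast0LessThan)
  have \<phi>I: "\<phi> i \<subseteq> {..<n}" if "i \<in> ?J" for i using \<phi> that by (auto simp: bij_betw_def)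
  have s\<phi>: "(\<lambda>i. ?s (\<phi> i)) \<in> ?J \<rightarrow> carrier R" using s \<phi>I by blast
  have "(\<Oplus>i\<in>?J. ?s (\<phi> i)) = (\<Oplus>I\<in>\<phi> ` ?J. ?s I)"
    using \<phi> s by (intro finsum_reindex[symmetric]) (auto simp: bij_betw_def)
  then have sum1: "(\<Oplus>i\<in>?J. ?s (\<phi> i)) = \<one>"
    using \<phi> sum_all_minors_Pow[OF F] by (simp add: bij_betw_def)
  have "{\<Oplus>i\<in>?J. ?s (\<phi> i) \<otimes> a i | a. a \<in> ?J \<rightarrow> carrier R} = carrier R"
  proof
    show "{\<Oplus>i\<in>?J. ?s (\<phi> i) \<otimes> a i | a. a \<in> ?J \<rightarrow> carrier R} \<subseteq> carrier R"
    proof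
      fix x assume "x \<in> {\<Oplus>i\<in>?J. ?s (\<phi> i) \<otimes> a i | a. a \<in> ?J \<rightarrow> carrier R}"
      then obtain a where "a \<in> ?J \<rightarrow> carrier R" "x = (\<Oplus>i\<in>?J. ?s (\<phi> i) \<otimes> a i)" by blast
      then show "x \<in> carrier R" using s\<phi> by (auto intro!: finsum_closed m_closed simp: Pi_iff)
    qed
    show "carrier R \<subseteq> {\<Oplus>i\<in>?J. ?s (\<phi> i) \<otimes> a i | a. a \<in> ?J \<rightarrow> carrier R}"
    proof
      fix x assume x: "x \<in> carrier R"
      have "x = (\<Oplus>i\<in>?J. ?s (\<phi> i)) \<otimes> x" using x sum1 by simp
      also have "\<dots> = (\<Oplus>i\<in>?J. ?s (\<phi> i) \<otimes> x)"
        using x s\<phi> by (intro finsum_ldistr) auto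
      finally have eq: "x = (\<Oplus>i\<in>?J. ?s (\<phi> i) \<otimes> x)" .
      show "x \<in> {\<Oplus>i\<in>?J. ?s (\<phi> i) \<otimes> a i | a. a \<in> ?J \<rightarrow> carrier R}"
        by (rule CollectI, rule exI[of _ "\<lambda>_. x"], rule conjI, rule eq) (use x in simp)
    qed
  qed
  moreover have "fin_free (loc_ring_at R (?s (\<phi> i))) (loc_module_at R (?s (\<phi> i)) N)" if i: "i < 2 ^ n" for i
  proof -
    have I: "\<phi> i \<subseteq> {..<n}" using i by (intro \<phi>I) simp
    interpret loc: localization R "powers_of R (?s (\<phi> i))" by (rule localization_powers_of[OF s[OF I]])
    interpret LN: localization_module R "powers_of R (?s (\<phi> i))" N
      by (intro localization_module.intro loc.localization_axioms modN)
    have "modules_iso (loc_ring_at R (?s (\<phi> i))) (loc_module_at R (?s (\<phi> i)) N)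
        (std_module (loc_ring_at R (?s (\<phi> i))) (card (\<phi> i)))"
      using loc.loc_module_iso[OF modN modM iso] minor_localization_free(2)[OF F I refl]
      by (rule modules_iso_trans)
    then show ?thesis
      unfolding fin_free_def free_of_rank_def using LN.module_loc_module by blast
  qed
  ultimately show ?thesis using s\<phi> by (intro bexI[of _ "\<lambda>i. ?s (\<phi> i)"] conjI allI impI) auto
qed

end

theorem mainTheorem2:
  fixes A :: "('a, 'b) ring_scheme" and n :: nat
  assumes "cring A"
  shows
    "(\<forall>F. idem_mat A n F \<longrightarrow>
       (let M = mat_image A n F;
            r = (\<lambda>k. coeff (UP A) (rank_poly A n F) k);
            minors = (\<lambda>k. {I. I \<subseteq> {..<n} \<and> card I = k});
            s = (\<lambda>k I. r k \<otimes>\<^bsub>A\<^esub> det_on A I F)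
        in
          \<comment> \<open>R has degree at most n and its coefficients are a fundamental system
              of orthogonal idempotents\<close>
          ((\<forall>k. r k \<in> carrier A) \<and> (\<forall>k>n. r k = \<zero>\<^bsub>A\<^esub>) \<and>
           (\<forall>i\<le>n. \<forall>j\<le>n. i \<noteq> j \<longrightarrow> r i \<otimes>\<^bsub>A\<^esub> r j = \<zero>\<^bsub>A\<^esub>) \<and>
           (\<Oplus>\<^bsub>A\<^esub>k\<in>{..n}. r k) = \<one>\<^bsub>A\<^esub>) \<and>
          \<comment> \<open>for both descriptions of the localization at r k: fractions, and the
              ideal generated by r k\<close>
          (\<forall>k\<le>n.
            projective_of_rank (loc_ring_at A (r k))
              (mat_image (loc_ring_at A (r k)) n
                (\<lambda>i j. ring_frac A (powers_of A (r k)) (r k \<otimes>\<^bsub>A\<^esub> F i j) \<one>\<^bsub>A\<^esub>)) k \<and>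
            projective_of_rank (idem_ring A (r k))
              (mat_image (idem_ring A (r k)) n (\<lambda>i j. r k \<otimes>\<^bsub>A\<^esub> F i j)) k) \<and>
          (\<forall>k\<le>n.
            (\<Oplus>\<^bsub>A\<^esub>I\<in>minors k. s k I) = r k \<and>
            (\<forall>I\<in>minors k. free_of_rank (loc_ring_at A (s k I)) (loc_module_at A (s k I) M) k)) \<and>
          (\<Oplus>\<^bsub>A\<^esub>k\<in>{..n}. \<Oplus>\<^bsub>A\<^esub>I\<in>minors k. s k I) = \<one>\<^bsub>A\<^esub> \<and>
          (\<forall>k\<le>n. \<forall>I\<in>minors k. fin_free (loc_ring_at A (s k I)) (loc_module_at A (s k I) M))))
     \<and>
     (\<forall>N :: ('a, 'c, 'd) module_scheme.
        fg_projective A N \<and> generated_by A N n \<longrightarrow>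
        (\<exists>s \<in> {..<(2::nat) ^ n} \<rightarrow> carrier A.
           {\<Oplus>\<^bsub>A\<^esub>i\<in>{..<(2::nat) ^ n}. s i \<otimes>\<^bsub>A\<^esub> a i | a. a \<in> {..<(2::nat) ^ n} \<rightarrow> carrier A} = carrier A \<and>
           (\<forall>i<(2::nat) ^ n. fin_free (loc_ring_at A (s i)) (loc_module_at A (s i) N))))"
proof (intro conjI allI impI, goal_cases)
  case (1 F)
  interpret A: cring A by fact
  note F = 1
  note F' = A.idem_matD(1)[OF F]
  have r: "coeff (UP A) (rank_poly A n F) k = rank_coeff A n F k" for k
    by (rule A.coeff_rank_poly[OF F'])
  have minor: "card I = k \<and> I \<subseteq> {..<n} \<Longrightarrow>
      free_of_rank (loc_ring_at A (rank_coeff A n F k \<otimes>\<^bsub>A\<^esub> det_on A I F))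
        (loc_module_at A (rank_coeff A n F k \<otimes>\<^bsub>A\<^esub> det_on A I F) (mat_image A n F)) k" for I k
    using A.minor_localization_free(1)[OF F] by blast
  show ?case
    unfolding Let_def r
  proof (intro conjI allI impI ballI)
    show "rank_coeff A n F k \<in> carrier A" for k using F' by simp
    show "rank_coeff A n F k = \<zero>\<^bsub>A\<^esub>" if "n < k" for k by (rule A.rank_coeff_above[OF F' that])
    show "rank_coeff A n F i \<otimes>\<^bsub>A\<^esub> rank_coeff A n F j = \<zero>\<^bsub>A\<^esub>" if "i \<le> n" "j \<le> n" "i \<noteq> j" for i j
      using A.rank_coeff_orthogonal[OF F that(1,2)] that(3) by simp
    show "(\<Oplus>\<^bsub>A\<^esub>k\<in>{..n}. rank_coeff A n F k) = \<one>\<^bsub>A\<^esub>" by (rule A.sum_rank_coeff[OF F'])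
  next
    fix k assume k: "k \<le> n"
    show "projective_of_rank (loc_ring_at A (rank_coeff A n F k))
        (mat_image (loc_ring_at A (rank_coeff A n F k)) n
          (\<lambda>i j. ring_frac A (powers_of A (rank_coeff A n F k)) (rank_coeff A n F k \<otimes>\<^bsub>A\<^esub> F i j) \<one>\<^bsub>A\<^esub>)) k"
      by (rule A.projective_of_rank_loc_ring[OF F k])
    show "projective_of_rank (idem_ring A (rank_coeff A n F k))
        (mat_image (idem_ring A (rank_coeff A n F k)) n (\<lambda>i j. rank_coeff A n F k \<otimes>\<^bsub>A\<^esub> F i j)) k"
      by (rule A.projective_of_rank_idem_ring[OF F k])
    show "(\<Oplus>\<^bsub>A\<^esub>I\<in>{I. I \<subseteq> {..<n} \<and> card I = k}. rank_coeff A n F k \<otimes>\<^bsub>A\<^esub> det_on A I F) = rank_coeff A n F k"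
      by (rule A.sum_minors[OF F k])
  next
    show "(\<Oplus>\<^bsub>A\<^esub>k\<in>{..n}. \<Oplus>\<^bsub>A\<^esub>I\<in>{I. I \<subseteq> {..<n} \<and> card I = k}. rank_coeff A n F k \<otimes>\<^bsub>A\<^esub> det_on A I F) = \<one>\<^bsub>A\<^esub>"
      by (rule A.sum_all_minors[OF F])
  qed (use minor in \<open>auto simp: fin_free_def\<close>)
next
  case (2 N)
  interpret A: cring A by fact
  show ?case using A.fg_projective_locally_free 2 by blast
qed

end
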